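(* Assume (A1), (A2) and (A3). Then for every bounded measurable $f:\mathsf X\to\mathbb R$, $$\lim_{n\to\infty}d\,\mathbb E\Big[\sum_{i=1}^d\theta_n(i)f(X_n)\mathbf 1_{\mathsf X_i}(X_n)\Big]=\int_{\mathsf X}f(x)\pi(x)\lambda(dx),$$ and $\mathcal I_n(f)\to\int_{\mathsf X}f(x)\pi(x)\lambda(dx)$ almost surely, where $$\mathcal I_n(f)=d\sum_{i=1}^d\theta_n(i)\Big(\frac1n\sum_{k=1}^nf(X_k)\mathbf 1_{\mathsf X_i}(X_k)\Big).$$
   Context: Setting: $(\mathsf X,\mathcal X)$ Polish space with Borel $\sigma$-algebra and $\sigma$-finite reference measure $\lambda$; $\pi$ a probability density w.r.t. $\lambda$; $d\ge2$; $\mathsf X_1,\dots,\mathsf X_d$ a measurable partition of $\mathsf X$; $I(x)=i$ iff $x\in\mathsf X_i$; $\theta_\star(i)=\int_{\mathsf X_i}\pi\,d\lambda$; $\Theta=\{\theta\in(0,1)^d:\sum_i\theta(i)=1\}$; $\pi_\theta(x)=\big(\sum_{i}\theta_\star(i)/\theta(i)\big)^{-1}\sum_{i}\frac{\pi(x)}{\theta(i)}\mathbf 1_{\mathsf X_i}(x)$. (A1): $0<\inf\pi\le\sup\pi<\infty$ and $\min_i\theta_\star(i)>0$. (A2): $P_\theta$ is the Metropolis–Hastings kernel with target $\pi_\theta\,d\lambda$ and symmetric proposal density $q$ w.r.t. $\lambda$ with $\inf_{\mathsf X^2}q>0$. (A3): $\{\gamma_n\}_{n\ge1}$ deterministic,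 $[0,1)$-valued, non-increasing, $\gamma_n\to0$, $\sum\gamma_n=\infty$, $\sum\gamma_n^2<\infty$. Linearized Wang–Landau algorithm: $X_0\in\mathsf X$, $\theta_0\in\Theta$; $X_{n+1}\sim P_{\theta_n}(X_n,\cdot)$ conditionally on $\mathcal F_n=\sigma(\theta_0,X_0,\dots,X_n)$; $\theta_{n+1}=\theta_n+\gamma_{n+1}H(X_{n+1},\theta_n)$ with $H_i(x,\theta)=\theta(i)(\mathbf 1_{\mathsf X_i}(x)-\theta(I(x)))$. *)

theory Defs
  imports "HOL-Probability.Probability"
begin

definition part_index :: "nat \<Rightarrow> (nat \<Rightarrow> 'a set) \<Rightarrow> 'a \<Rightarrow> nat" where
  "part_index d Xs x = (THE i. i \<in> {1..d} \<and> x \<in> Xs i)"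

definition theta_star :: "'a measure \<Rightarrow> ('a \<Rightarrow> real) \<Rightarrow> (nat \<Rightarrow> 'a set) \<Rightarrow> nat \<Rightarrow> real" where
  "theta_star lam p Xs i = (\<integral>x. indicator (Xs i) x * p x \<partial>lam)"

text \<open>The simplex Theta (theta only matters on {1..d})\<close>
definition Theta :: "nat \<Rightarrow> (nat \<Rightarrow> real) set" where
  "Theta d = {\<theta>. (\<forall>i\<in>{1..d}. 0 < \<theta> i \<and> \<theta> i < 1) \<and> (\<Sum>i=1..d. \<theta> i) = 1}"

definition pi_theta :: "'a measure \<Rightarrow> ('a \<Rightarrow> real) \<Rightarrow> nat \<Rightarrow> (nat \<Rightarrow> 'a set)
    \<Rightarrow> (nat \<Rightarrow> real) \<Rightarrow> 'a \<Rightarrow> real" where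
  "pi_theta lam p d Xs \<theta> x =
     inverse (\<Sum>i=1..d. theta_star lam p Xs i / \<theta> i)
     * (\<Sum>i=1..d. p x / \<theta> i * indicator (Xs i) x)"

text \<open>Metropolis--Hastings kernel with target pi_theta dlam and symmetric proposal density q:
  P_theta(x,B) = int_B q(x,y) alpha(x,y) lam(dy) + 1_B(x) (1 - int q(x,y) alpha(x,y) lam(dy)),
  alpha(x,y) = min(1, pi_theta(y)/pi_theta(x)).\<close>
definition MH_accept :: "'a measure \<Rightarrow> ('a \<Rightarrow> real) \<Rightarrow> nat \<Rightarrow> (nat \<Rightarrow> 'a set)
    \<Rightarrow> (nat \<Rightarrow> real) \<Rightarrow> 'a \<Rightarrow> 'a \<Rightarrow> real" where
  "MH_accept lam p d Xs \<theta> x y = min 1 (pi_theta lam p d Xs \<theta> y / pi_theta lam p d Xs \<theta> x)"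

definition MH_kernel :: "'a measure \<Rightarrow> ('a \<Rightarrow> real) \<Rightarrow> nat \<Rightarrow> (nat \<Rightarrow> 'a set)
    \<Rightarrow> ('a \<Rightarrow> 'a \<Rightarrow> real) \<Rightarrow> (nat \<Rightarrow> real) \<Rightarrow> 'a \<Rightarrow> 'a set \<Rightarrow> real" where
  "MH_kernel lam p d Xs q \<theta> x B =
     (\<integral>y. indicator B y * q x y * MH_accept lam p d Xs \<theta> x y \<partial>lam)
     + indicator B x * (1 - (\<integral>y. q x y * MH_accept lam p d Xs \<theta> x y \<partial>lam))"

definition WL_H :: "nat \<Rightarrow> (nat \<Rightarrow> 'a set) \<Rightarrow> 'a \<Rightarrow> (nat \<Rightarrow> real) \<Rightarrow> nat \<Rightarrow> real" where
  "WL_H d Xs x \<theta> i = \<theta> i * (indicator (Xs i) x - \<theta> (part_index d Xs x))"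

definition filt_sets :: "'w measure \<Rightarrow> nat \<Rightarrow> (nat \<Rightarrow> 'w \<Rightarrow> 'a::topological_space)
    \<Rightarrow> (nat \<Rightarrow> 'w \<Rightarrow> nat \<Rightarrow> real) \<Rightarrow> nat \<Rightarrow> 'w set set" where
  "filt_sets M d X \<theta> n = sigma_sets (space M)
     ({X k -` B \<inter> space M | k B. k \<le> n \<and> B \<in> sets borel}
      \<union> {(\<lambda>\<omega>. \<theta> 0 \<omega> i) -` B \<inter> space M | i B. i \<in> {1..d} \<and> B \<in> sets (borel :: real measure)})"

definition WL_estimator :: "nat \<Rightarrow> (nat \<Rightarrow> 'a set) \<Rightarrow> (nat \<Rightarrow> 'w \<Rightarrow> 'a)
    \<Rightarrow> (nat \<Rightarrow> 'w \<Rightarrow> nat \<Rightarrow> real) \<Rightarrow> ('a \<Rightarrow> real) \<Rightarrow> nat \<Rightarrow> 'w \<Rightarrow> real" where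
  "WL_estimator d Xs X \<theta> f n \<omega> =
     real d * (\<Sum>i=1..d. \<theta> n \<omega> i *
        ((1 / real n) * (\<Sum>k=1..n. f (X k \<omega>) * indicator (Xs i) (X k \<omega>))))"

end

theory Submission
  imports Defs
begin

text \<open>The Metropolis--Hastings kernels \<open>P\<^sub>\<theta>\<close> are minorized by \<open>\<rho> \<pi>\<^sub>\<theta>\<close> with one \<open>\<rho> > 0\<close> for the whole open simplex.
  Hence the Poisson equation for \<open>P\<^sub>\<theta>\<close> has solutions bounded uniformly in \<open>\<theta>\<close>, and they are Lipschitz with
  respect to the ratios of the weights, which change by a factor \<open>1 + O(\<gamma>\<^sub>n)\<close> in each step. Therefore a
  series \<open>\<Sum> v\<^sub>k (g(X\<^sub>k\<^sub>+\<^sub>1) - \<pi>\<^sub>\<theta>\<^sub>k(g))\<close> with adapted square-summable weights of bounded variation converges almost surely.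

  The divergence \<open>KL(\<theta>) = \<Sum> \<theta>\<^sub>\<star>(i) ln (\<theta>\<^sub>\<star>(i) / \<theta>(i))\<close> is a Lyapunov function with increments \<open>O(\<gamma>\<^sub>n)\<close> even near the
  boundary, and its mean drift is at most \<open>- \<gamma>\<^sub>n KL(\<theta>) / \<Sum> (\<theta>\<^sub>\<star>(i) / \<theta>(i))\<close>. With the noise summable, it converges; so
  the path stays in a compact part of the simplex, the limit must be 0, and \<open>\<theta>\<^sub>n \<rightarrow> \<theta>\<^sub>\<star>\<close> without any separate
  recurrence argument.

  The law of large numbers is the case \<open>v\<^sub>k = 1 / (k + 1)\<close> together with Kronecker's lemma. For the expectations the
  bias is frozen for \<open>m\<close> steps, at a cost \<open>O(m\<^sup>2 \<gamma>\<^sub>n)\<close>, and \<open>P\<^sub>\<theta>\<close> forgets its initial state at rate \<open>(1 - \<rho>)\<^sup>m\<close>.\<close>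

subsection \<open>Almost sure convergence of square-summable martingale differences\<close>

text \<open>Nothing in the hypotheses keeps the weights away from 0, where drift estimates usually
  carry factors \<open>1 / \<theta> i\<close>. Two cancellations remove these factors. The
  normalizing constant of the biased density contains every term \<open>ts i / \<theta> i\<close>,
  so it compensates the smallest weight by itself. And the update is multiplicative: to first order
  \<open>ln (\<theta> i)\<close> changes by \<open>\<gamma> (Suc n) * rel_step n \<omega> i\<close>,
  and the \<open>ts\<close>-average of \<open>rel_step\<close> is
  \<open>ts j - \<theta> n \<omega> j\<close> with \<open>j\<close> the stratum of the new state,
  free of reciprocals. Its mean under the biased target is the chi-square divergence of
  \<open>ts\<close> from \<open>\<theta>\<close> divided by \<open>S \<theta>\<close>; that
  divergence dominates the relative entropy, which explains both the Lyapunov function and the form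
  of its drift. The transition law is given through events \<open>A\<close> of the past and sets
  \<open>B\<close> of next states. Accordingly, a martingale difference is here a variable
  orthogonal to all bounded functions of the past; conditional expectations never appear.\<close>

lemma (in prob_space) martingale_difference_maximal:
  fixes D :: "nat \<Rightarrow> 'a \<Rightarrow> real" and F :: "nat \<Rightarrow> 'a measure" and c :: "nat \<Rightarrow> real"
  assumes sub: "\<And>n. subalgebra M (F n)"
    and mono: "\<And>n. sets (F n) \<subseteq> sets (F (Suc n))"
    and D_meas: "\<And>n. D n \<in> borel_measurable (F (Suc n))"
    and D_bound: "\<And>n \<omega>. \<omega> \<in> space M \<Longrightarrow> \<bar>D n \<omega>\<bar> \<le> c n"
    and orth: "\<And>n Z K. Z \<in> borel_measurable (F n) \<Longrightarrow> (\<And>\<omega>. \<omega> \<in> space M \<Longrightarrow> \<bar>Z \<omega>\<bar> \<le> K)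
       \<Longrightarrow> (\<integral>\<omega>. Z \<omega> * D n \<omega> \<partial>M) = 0"
    and \<epsilon>: "0 < \<epsilon>" and mn: "m \<le> n"
  shows "prob {\<omega>\<in>space M. \<exists>j\<in>{m..n}. \<epsilon> \<le> \<bar>\<Sum>k=m..<j. D k \<omega>\<bar>} \<le> (\<Sum>k=m..<n. (c k)\<^sup>2) / \<epsilon>\<^sup>2"
proof -
  have spF: "space (F n) = space M" for n
    using sub[of n] by (simp add: subalgebra_def)
  have Fmono: "sets (F i) \<subseteq> sets (F j)" if "i \<le> j" for i j
    using that mono by (rule lift_Suc_mono_le[where f="\<lambda>n. sets (F n)", rotated])
  have F_up: "f \<in> borel_measurable (F i) \<Longrightarrow> i \<le> j \<Longrightarrow> f \<in> borel_measurable (F j)" for f :: "'a \<Rightarrow> real" and i j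
    using Fmono[of i j] by (auto simp: measurable_def spF)
  have F_M: "f \<in> borel_measurable (F i) \<Longrightarrow> f \<in> borel_measurable M" for f :: "'a \<Rightarrow> real" and i
    using sub measurable_from_subalg by blast
  define S where "S j \<omega> = (\<Sum>k=m..<j. D k \<omega>)" for j \<omega>
  \<comment> \<open>Kolmogorov's argument: \<open>act j\<close> indicates that the partial sums have not left the band up to time \<open>j\<close>,
    so \<open>T\<close> is the martingale stopped at the exit time.\<close>
  define act where "act j \<omega> = (if \<forall>i\<in>{m..j}. \<bar>S i \<omega>\<bar> < \<epsilon> then 1 else 0::real)" for j \<omega>
  define T where "T j \<omega> = (\<Sum>k=m..<j. act k \<omega> * D k \<omega>)" for j \<omega>
  have S_meas: "S j \<in> borel_measurable (F j)" for j
    unfolding S_def by (intro borel_measurable_sum F_up[OF D_meas]) auto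
  have act_meas: "act j \<in> borel_measurable (F j)" for j
  proof -
    have "act j = (\<lambda>\<omega>. \<Prod>i\<in>{m..j}. if \<bar>S i \<omega>\<bar> < \<epsilon> then 1 else 0)"
      by (auto simp: act_def fun_eq_iff intro!: prod_zero[symmetric])
    moreover have "(\<lambda>\<omega>. if \<bar>S i \<omega>\<bar> < \<epsilon> then 1 else 0 :: real) \<in> borel_measurable (F j)" if "i \<in> {m..j}" for i
    proof -
      have "S i \<in> borel_measurable (F j)"
        using that by (intro F_up[OF S_meas]) auto
      then show ?thesis by measurable
    qed
    ultimately show ?thesis by (simp add: borel_measurable_prod)
  qed
  have T_meas: "T j \<in> borel_measurable (F j)" for j
    unfolding T_def
    by (intro borel_measurable_sum borel_measurable_times F_up[OF D_meas] F_up[OF act_meas]) auto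
  have act01: "\<bar>act j \<omega>\<bar> \<le> 1" "act j \<omega> = 0 \<or> act j \<omega> = 1" for j \<omega> by (auto simp: act_def)
  have c0: "0 \<le> c k" for k
    using D_bound[of _ k] not_empty by (meson abs_ge_zero equals0I order_trans)
  have chiD: "\<bar>act k \<omega> * D k \<omega>\<bar> \<le> c k" if "\<omega> \<in> space M" for k \<omega>
    using act01(2)[of k \<omega>] D_bound[OF that, of k] c0[of k] by auto
  have T_bound: "\<bar>T j \<omega>\<bar> \<le> (\<Sum>k=m..<j. c k)" if "\<omega> \<in> space M" for j \<omega>
    unfolding T_def by (rule order_trans[OF sum_abs]) (intro sum_mono chiD that)
  have int: "integrable M f" if "f \<in> borel_measurable (F i)" "\<And>\<omega>. \<omega> \<in> space M \<Longrightarrow> \<bar>f \<omega>\<bar> \<le> K"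
    for f :: "'a \<Rightarrow> real" and i K
    by (intro integrable_const_bound[where B=K] AE_I2 F_M[OF that(1)]) (use that(2) in simp)
  \<comment> \<open>Second moments of the stopped sums add up: \<open>T j * act j\<close> is bounded
    and known at time \<open>j\<close>, so the cross term vanishes by \<open>orth\<close>.\<close>
  have T_sq: "m \<le> j \<Longrightarrow> (\<integral>\<omega>. (T j \<omega>)\<^sup>2 \<partial>M) \<le> (\<Sum>k=m..<j. (c k)\<^sup>2)" for j
  proof (induction j rule: dec_induct)
    case base
    then show ?case by (simp add: T_def)
  next
    case (step j)
    have T_Suc: "T (Suc j) \<omega> = T j \<omega> + act j \<omega> * D j \<omega>" for \<omega>
      using step by (simp add: T_def)
    have sqb: "\<bar>(f::real)\<^sup>2\<bar> \<le> K\<^sup>2" if "\<bar>f\<bar> \<le> K" for f K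
      using that by (metis abs_power2 abs_le_square_iff abs_ge_self order_trans)
    have i1: "integrable M (\<lambda>\<omega>. (T j \<omega>)\<^sup>2)"
      using T_meas[of j] sqb[OF T_bound[of _ j]]
      by (intro int[of _ j "(\<Sum>k=m..<j. c k)\<^sup>2"]) auto
    have i2: "integrable M (\<lambda>\<omega>. (T j \<omega> * act j \<omega>) * D j \<omega>)"
    proof (rule int[of _ "Suc j" "(\<Sum>k=m..<j. c k) * c j"])
      show "(\<lambda>\<omega>. (T j \<omega> * act j \<omega>) * D j \<omega>) \<in> borel_measurable (F (Suc j))"
        by (intro borel_measurable_times D_meas F_up[OF T_meas] F_up[OF act_meas]) auto
      show "\<bar>(T j \<omega> * act j \<omega>) * D j \<omega>\<bar> \<le> (\<Sum>k=m..<j. c k) * c j" if "\<omega> \<in> space M" for \<omega>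
        using mult_mono[OF T_bound[OF that, of j] chiD[OF that, of j]] c0
        by (simp add: abs_mult sum_nonneg ac_simps)
    qed
    have i3: "integrable M (\<lambda>\<omega>. (act j \<omega> * D j \<omega>)\<^sup>2)"
      using sqb[OF chiD] by (intro int[of _ "Suc j" "(c j)\<^sup>2"] borel_measurable_power
         borel_measurable_times D_meas F_up[OF act_meas]) auto
    have orth': "(\<integral>\<omega>. (T j \<omega> * act j \<omega>) * D j \<omega> \<partial>M) = 0"
    proof (rule orth[of _ j "\<Sum>k=m..<j. c k"])
      show "(\<lambda>\<omega>. T j \<omega> * act j \<omega>) \<in> borel_measurable (F j)"
        by (intro borel_measurable_times T_meas act_meas)
      show "\<bar>T j \<omega> * act j \<omega>\<bar> \<le> (\<Sum>k=m..<j. c k)" if "\<omega> \<in> space M" for \<omega>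
        using T_bound[OF that, of j] act01(2)[of j \<omega>] c0 by (auto simp: sum_nonneg)
    qed
    have "(\<integral>\<omega>. (T (Suc j) \<omega>)\<^sup>2 \<partial>M)
        = (\<integral>\<omega>. (T j \<omega>)\<^sup>2 + 2 * ((T j \<omega> * act j \<omega>) * D j \<omega>) + (act j \<omega> * D j \<omega>)\<^sup>2 \<partial>M)"
      unfolding T_Suc by (simp add: power2_sum ac_simps)
    also have "\<dots> = (\<integral>\<omega>. (T j \<omega>)\<^sup>2 \<partial>M) + 2 * 0 + (\<integral>\<omega>. (act j \<omega> * D j \<omega>)\<^sup>2 \<partial>M)"
      using i1 i2 i3 orth' by simp
    also have "(\<integral>\<omega>. (act j \<omega> * D j \<omega>)\<^sup>2 \<partial>M) \<le> (c j)\<^sup>2"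
      using sqb[OF chiD] by (intro integral_le_const i3 AE_I2) auto
    finally show ?case using step by simp
  qed
  \<comment> \<open>The increment that leaves the band is still counted in \<open>T\<close>, so
    \<open>T\<close> freezes at a value outside the band.\<close>
  have inv: "m \<le> j \<Longrightarrow> (act j \<omega> = 1 \<longrightarrow> T j \<omega> = S j \<omega>) \<and> (act j \<omega> = 0 \<longrightarrow> \<epsilon> \<le> \<bar>T j \<omega>\<bar>)" for j \<omega>
  proof (induction j rule: dec_induct)
    case base
    then show ?case using \<epsilon> by (simp add: T_def S_def act_def)
  next
    case (step j)
    have T_Suc: "T (Suc j) \<omega> = T j \<omega> + act j \<omega> * D j \<omega>" and S_Suc: "S (Suc j) \<omega> = S j \<omega> + D j \<omega>"
      using step by (simp_all add: T_def S_def)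
    have act_Suc: "act (Suc j) \<omega> = act j \<omega> * (if \<bar>S (Suc j) \<omega>\<bar> < \<epsilon> then 1 else 0)"
      using step by (auto simp: act_def le_Suc_eq atLeastAtMostSuc_conv)
    show ?case
      using step.IH T_Suc S_Suc act_Suc act01(2)[of j \<omega>] by (auto split: if_splits)
  qed
  have sub1: "{\<omega>\<in>space M. \<exists>j\<in>{m..n}. \<epsilon> \<le> \<bar>S j \<omega>\<bar>} \<subseteq> {\<omega>\<in>space M. \<epsilon>\<^sup>2 \<le> (T n \<omega>)\<^sup>2}"
  proof safe
    fix \<omega> j assume "j \<in> {m..n}" "\<epsilon> \<le> \<bar>S j \<omega>\<bar>"
    then have "act n \<omega> = 0" by (auto simp: act_def not_less)
    then have "\<epsilon> \<le> \<bar>T n \<omega>\<bar>" using inv[OF mn] by blast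
    then show "\<epsilon>\<^sup>2 \<le> (T n \<omega>)\<^sup>2" using \<epsilon> by (simp add: abs_le_square_iff[symmetric])
  qed
  have TM: "T n \<in> borel_measurable M" using T_meas F_M by blast
  have intT: "integrable M (\<lambda>\<omega>. (T n \<omega>)\<^sup>2)"
  proof (rule int)
    show "(\<lambda>\<omega>. (T n \<omega>)\<^sup>2) \<in> borel_measurable (F n)"
      using T_meas by simp
    show "\<bar>(T n \<omega>)\<^sup>2\<bar> \<le> (\<Sum>k=m..<n. c k)\<^sup>2" if "\<omega> \<in> space M" for \<omega>
      using power_mono[OF T_bound[OF that, of n], of 2] by simp
  qed
  have "prob {\<omega>\<in>space M. \<exists>j\<in>{m..n}. \<epsilon> \<le> \<bar>S j \<omega>\<bar>} \<le> prob {\<omega>\<in>space M. \<epsilon>\<^sup>2 \<le> (T n \<omega>)\<^sup>2}"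
    using sub1 TM by (intro finite_measure_mono) auto
  also have "\<dots> \<le> (\<integral>\<omega>. (T n \<omega>)\<^sup>2 \<partial>M) / \<epsilon>\<^sup>2"
    using \<epsilon> TM intT integral_Markov_inequality_measure[of M "\<lambda>\<omega>. (T n \<omega>)\<^sup>2" "space M" "\<epsilon>\<^sup>2"] by simp
  also have "\<dots> \<le> (\<Sum>k=m..<n. (c k)\<^sup>2) / \<epsilon>\<^sup>2"
    using T_sq[OF mn] \<epsilon> by (simp add: divide_right_mono)
  finally show ?thesis by (simp add: S_def)
qed

text \<open>The maximal inequality bounds the fluctuations after time \<open>m\<close> by the tail
  of the squared bounds. That tail vanishes, so almost surely, for every \<epsilon>, all sums
  started late enough stay within \<epsilon>: Cauchy's criterion.\<close>

lemma (in prob_space) martingale_difference_summable: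
  fixes D :: "nat \<Rightarrow> 'a \<Rightarrow> real" and F :: "nat \<Rightarrow> 'a measure" and c :: "nat \<Rightarrow> real"
  assumes sub: "\<And>n. subalgebra M (F n)"
    and mono: "\<And>n. sets (F n) \<subseteq> sets (F (Suc n))"
    and D_meas: "\<And>n. D n \<in> borel_measurable (F (Suc n))"
    and D_bound: "\<And>n \<omega>. \<omega> \<in> space M \<Longrightarrow> \<bar>D n \<omega>\<bar> \<le> c n"
    and orth: "\<And>n Z K. Z \<in> borel_measurable (F n) \<Longrightarrow> (\<And>\<omega>. \<omega> \<in> space M \<Longrightarrow> \<bar>Z \<omega>\<bar> \<le> K)
       \<Longrightarrow> (\<integral>\<omega>. Z \<omega> * D n \<omega> \<partial>M) = 0"
    and c_sq: "summable (\<lambda>n. (c n)\<^sup>2)"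
  shows "AE \<omega> in M. summable (\<lambda>n. D n \<omega>)"
proof -
  have DM [measurable]: "D i \<in> borel_measurable M" for i
    using sub D_meas measurable_from_subalg by blast
  define tail where "tail m = (\<Sum>k. (c (k + m))\<^sup>2)" for m
  have tail_0: "tail \<longlonglongrightarrow> 0"
    unfolding tail_def by (rule suminf_exist_split2[OF c_sq])
  define B where "B \<epsilon> m = {\<omega>\<in>space M. \<exists>j\<in>{m..}. \<epsilon> \<le> \<bar>\<Sum>k=m..<j. D k \<omega>\<bar>}" for \<epsilon> :: real and m
  have B_sets [measurable]: "B \<epsilon> m \<in> sets M" for \<epsilon> m unfolding B_def by measurable
  have B_le: "prob (B \<epsilon> m) \<le> tail m / \<epsilon>\<^sup>2" if "0 < \<epsilon>" for \<epsilon> m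
  proof -
    \<comment> \<open>The maximal inequality has a finite horizon; the events grow with the horizon,
      so continuity from below carries the bound over to \<open>B \<epsilon> m\<close>.\<close>
    define A where "A n = {\<omega>\<in>space M. \<exists>j\<in>{m..n}. \<epsilon> \<le> \<bar>\<Sum>k=m..<j. D k \<omega>\<bar>}" for n
    have A_sets: "A n \<in> sets M" for n unfolding A_def by measurable
    have UA: "(\<Union>n. A n) = B \<epsilon> m" unfolding A_def B_def by (auto; meson atLeastAtMost_iff order_refl)
    have "(\<lambda>n. prob (A n)) \<longlonglongrightarrow> prob (\<Union>n. A n)"
      using A_sets by (intro finite_Lim_measure_incseq) (auto simp: A_def incseq_def)
    moreover have "prob (A n) \<le> tail m / \<epsilon>\<^sup>2" if "m \<le> n" for n
    proof -
      have "prob (A n) \<le> (\<Sum>k=m..<n. (c k)\<^sup>2) / \<epsilon>\<^sup>2"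
        unfolding A_def
        by (rule martingale_difference_maximal[of F D c]; fact)
      also have "(\<Sum>k=m..<n. (c k)\<^sup>2) = (\<Sum>k<n-m. (c (k + m))\<^sup>2)"
        using sum.shift_bounds_nat_ivl[of "\<lambda>k. (c k)\<^sup>2" 0 m "n-m"] that by (simp add: atLeast0LessThan)
      also have "\<dots> \<le> tail m"
        unfolding tail_def using c_sq by (intro sum_le_suminf) (auto simp: summable_iff_shift[of "\<lambda>k. (c k)\<^sup>2"])
      finally show ?thesis by (simp add: divide_right_mono)
    qed
    ultimately show ?thesis unfolding UA by (intro LIMSEQ_le_const2) auto
  qed
  have AE_\<epsilon>: "AE \<omega> in M. \<exists>m. \<omega> \<notin> B \<epsilon> m" if "0 < \<epsilon>" for \<epsilon>
  proof -
    have "prob (\<Inter>m. B \<epsilon> m) \<le> tail m / \<epsilon>\<^sup>2" for m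
      using B_le[OF that, of m] finite_measure_mono[of "\<Inter>m. B \<epsilon> m" "B \<epsilon> m"] B_sets by fastforce
    moreover have "(\<lambda>m. tail m / \<epsilon>\<^sup>2) \<longlonglongrightarrow> 0 / \<epsilon>\<^sup>2"
      using that by (intro tendsto_divide tail_0 tendsto_const) auto
    ultimately have "prob (\<Inter>m. B \<epsilon> m) \<le> 0"
      by (intro LIMSEQ_le_const) auto
    then have "prob (\<Inter>m. B \<epsilon> m) = 0" by (simp add: measure_le_0_iff)
    then have "(\<Inter>m. B \<epsilon> m) \<in> null_sets M"
      by (intro null_setsI) (auto simp: emeasure_eq_measure)
    from AE_not_in[OF this] show ?thesis by eventually_elim auto
  qed
  have "AE \<omega> in M. \<forall>r::nat. \<exists>m. \<omega> \<notin> B (1 / Suc r) m"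
    unfolding AE_all_countable using AE_\<epsilon> by simp
  then show ?thesis
  proof (rule AE_mp, intro AE_I2 impI)
    fix \<omega> assume \<omega>: "\<omega> \<in> space M" and *: "\<forall>r::nat. \<exists>m. \<omega> \<notin> B (1 / Suc r) m"
    show "summable (\<lambda>n. D n \<omega>)"
      unfolding summable_Cauchy
    proof (intro allI impI)
      fix e :: real assume "0 < e"
      \<comment> \<open>Half of \<open>e\<close>, because a general block is the difference of two
        sums that both start at \<open>m\<close>.\<close>
      then obtain r :: nat where r: "1 / Suc r < e / 2"
        using nat_approx_posE[of "e/2"] by auto
      obtain m where "\<omega> \<notin> B (1 / Suc r) m" using * by blast
      then have m: "\<bar>\<Sum>k=m..<j. D k \<omega>\<bar> < e / 2" if "m \<le> j" for j
        using \<omega> that r by (force simp: B_def)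
      have "norm (\<Sum>k=i..<j. D k \<omega>) < e" if "m \<le> i" for i j
      proof (cases "i \<le> j")
        case True
        then have "(\<Sum>k=i..<j. D k \<omega>) = (\<Sum>k=m..<j. D k \<omega>) - (\<Sum>k=m..<i. D k \<omega>)"
          using that by (simp add: sum.atLeastLessThan_concat[of m i j, symmetric])
        then show ?thesis using m[of i] m[of j] that True by simp
      qed (use \<open>0 < e\<close> in auto)
      then show "\<exists>N. \<forall>m\<ge>N. \<forall>n. norm (\<Sum>k=m..<n. D k \<omega>) < e" by blast
    qed
  qed
qed

subsection \<open>The Metropolis--Hastings kernel of a biased target\<close>

text \<open>A sup-norm ball with a pointwise bound rather than one almost everywhere: rejection
  leaves an atom at the current state, where functions are evaluated.\<close>

definition bdd_borel :: "real \<Rightarrow> ('a::topological_space \<Rightarrow> real) set" where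
  "bdd_borel B = {G. G \<in> borel_measurable borel \<and> (\<forall>x. \<bar>G x\<bar> \<le> B)}"

text \<open>Closeness in Hilbert's projective metric. Acceptance ratios and normalized biased densities depend
  on \<open>\<theta>\<close> only through the ratios \<open>\<theta> i / \<theta> j\<close>, so estimates in these terms are uniform up to the
  boundary of the simplex.\<close>
definition ratio_close :: "nat \<Rightarrow> real \<Rightarrow> (nat \<Rightarrow> real) \<Rightarrow> (nat \<Rightarrow> real) \<Rightarrow> bool" where
  "ratio_close d e \<theta> \<theta>' \<longleftrightarrow> (\<forall>i\<in>{1..d}. \<forall>j\<in>{1..d}. \<theta>' i * \<theta> j \<le> (1 + e) * (\<theta> i * \<theta>' j))"

lemma ratio_close_sym: "ratio_close d e \<theta> \<theta>' \<Longrightarrow> ratio_close d e \<theta>' \<theta>"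
  unfolding ratio_close_def by (simp add: mult.commute)

text \<open>The bounds \<open>pl\<close>, \<open>pu\<close>, \<open>ql\<close> are parameters rather
  than existential statements, so that the minorization constant becomes an explicit term
  independent of the bias.\<close>

locale wl_kernel =
  fixes lam :: "'a::polish_space measure"
    and p :: "'a \<Rightarrow> real"
    and d :: nat
    and Xs :: "nat \<Rightarrow> 'a set"
    and q :: "'a \<Rightarrow> 'a \<Rightarrow> real"
    and pl pu ql :: real
  assumes lam_sets: "sets lam = sets borel"
    and p_meas: "p \<in> borel_measurable borel"
    and p_int: "integrable lam p"
    and p_prob: "(\<integral>x. p x \<partial>lam) = 1"
    and d_ge: "d \<ge> 2"
    and Xs_meas: "\<And>i. i \<in> {1..d} \<Longrightarrow> Xs i \<in> sets borel"
    and Xs_disj: "disjoint_family_on Xs {1..d}"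
    and Xs_cover: "(\<Union>i\<in>{1..d}. Xs i) = UNIV"
    and pl: "0 < pl" "\<And>x. pl \<le> p x"
    and pu: "\<And>x. p x \<le> pu"
    and ts_pos: "\<And>i. i \<in> {1..d} \<Longrightarrow> 0 < theta_star lam p Xs i"
    and q_meas: "(\<lambda>(x, y). q x y) \<in> borel_measurable borel"
    and q_int: "\<And>x. integrable lam (q x)"
    and q_dens: "\<And>x. (\<integral>y. q x y \<partial>lam) = 1"
    and q_sym: "\<And>x y. q x y = q y x"
    and ql: "0 < ql" "\<And>x y. ql \<le> q x y"
begin

lemma p_pos: "0 < p x" using pl(1) pl(2)[of x] by linarith
lemma pu_pos: "0 < pu" using p_pos pu by (rule less_le_trans)
lemma q_pos: "0 < q x y" using ql(1) ql(2)[of x y] by linarith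

lemma measurable_lam: "borel_measurable lam = borel_measurable borel"
  by (intro ext measurable_cong_sets) (auto simp: lam_sets)

lemma space_lam [simp]: "space lam = UNIV"
  using sets_eq_imp_space_eq[OF lam_sets] by simp

text \<open>A probability density bounded below by \<open>pl\<close> leaves total mass at most
  \<open>1 / pl\<close>. Bounded measurable functions are therefore integrable.\<close>

lemma finite_lam: "finite_measure lam"
proof
  have "ennreal pl * emeasure lam (space lam) = (\<integral>\<^sup>+x. ennreal pl \<partial>lam)"
    by simp
  also have "\<dots> \<le> (\<integral>\<^sup>+x. ennreal (p x) \<partial>lam)"
    by (intro nn_integral_mono ennreal_leI pl(2))
  also have "\<dots> = ennreal 1"
    using p_int p_pos by (subst nn_integral_eq_integral) (auto simp: p_prob less_imp_le)
  finally have "ennreal pl * emeasure lam (space lam) \<le> 1" by simp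
  then show "emeasure lam (space lam) \<noteq> \<infinity>"
    using pl(1) by (auto simp: ennreal_mult_top top_unique)
qed

sublocale lam: finite_measure lam by (rule finite_lam)

abbreviation J where "J \<equiv> part_index d Xs"
abbreviation ts where "ts \<equiv> theta_star lam p Xs"
abbreviation piT where "piT \<equiv> pi_theta lam p d Xs"
definition S where "S \<theta> = (\<Sum>i=1..d. ts i / \<theta> i)"
definition acc where "acc \<theta> x y = q x y * MH_accept lam p d Xs \<theta> x y"
definition rej where "rej \<theta> x = 1 - (\<integral>y. acc \<theta> x y \<partial>lam)"
definition piI where "piI \<theta> G = (\<integral>y. piT \<theta> y * G y \<partial>lam)"
text \<open>\<open>Op 0 \<theta>\<close> is the Metropolis--Hastings kernel acting on functions; \<open>Op \<rho> \<theta>\<close> is what remains of it, with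
  mass \<open>1 - \<rho>\<close>, once the minorizing part has been split off.\<close>
definition Op where "Op s \<theta> G x = (\<integral>y. (acc \<theta> x y - s * piT \<theta> y) * G y \<partial>lam) + rej \<theta> x * G x"
definition tmin where "tmin = Min (ts ` {1..d})"
text \<open>\<open>ql\<close> comes from the proposal; \<open>pu / tmin\<close> bounds every biased
  density, so its reciprocal bounds acceptance ratios from below relative to the density of the
  proposed state.\<close>

definition \<rho> where "\<rho> = ql * tmin / pu"

section \<open>Strata and the open simplex\<close>

lemma J_ex1: "\<exists>!i. i \<in> {1..d} \<and> x \<in> Xs i"
proof -
  obtain i where "i \<in> {1..d}" "x \<in> Xs i" using Xs_cover by blast
  moreover have "j = i" if "j \<in> {1..d}" "x \<in> Xs j" for j
    using Xs_disj that \<open>i \<in> {1..d}\<close> \<open>x \<in> Xs i\<close> unfolding disjoint_family_on_def by blast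
  ultimately show ?thesis by blast
qed

lemma J_in: "J x \<in> {1..d}" and J_mem: "x \<in> Xs (J x)"
  using theI'[OF J_ex1[of x]] by (auto simp: part_index_def)

lemma J_iff: "i \<in> {1..d} \<Longrightarrow> x \<in> Xs i \<longleftrightarrow> J x = i"
  using J_ex1[of x] J_in[of x] J_mem[of x] by blast

lemma indicator_Xs: "i \<in> {1..d} \<Longrightarrow> indicator (Xs i) x = (if i = J x then 1 else 0 :: real)"
  using J_iff[of i x] by (auto simp: indicator_def)

lemma sum_indicator_Xs: "(\<Sum>i=1..d. f i * indicator (Xs i) x) = (f (J x) :: real)"
proof -
  have "(\<Sum>i=1..d. f i * indicator (Xs i) x) = (\<Sum>i=1..d. if i = J x then f i else 0)"
    by (intro sum.cong) (auto simp: indicator_Xs)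
  then show ?thesis using J_in[of x] by simp
qed

lemma integrable_mult_bdd: "integrable lam f \<Longrightarrow> G \<in> bdd_borel B \<Longrightarrow> integrable lam (\<lambda>y. f y * G y)"
proof (rule Bochner_Integration.integrable_bound[of lam "\<lambda>y. B * f y"])
  assume f: "integrable lam f" and G: "G \<in> bdd_borel B"
  have [measurable]: "f \<in> borel_measurable lam" "G \<in> borel_measurable lam"
    using f G by (auto simp: measurable_lam bdd_borel_def)
  show "integrable lam (\<lambda>y. B * f y)" using f by simp
  show "(\<lambda>y. f y * G y) \<in> borel_measurable lam" by measurable
  have GB: "\<bar>G y\<bar> \<le> \<bar>B\<bar>" for y
  proof -
    have "\<bar>G y\<bar> \<le> B" using G by (simp add: bdd_borel_def)
    then show ?thesis by linarith
  qed
  show "AE y in lam. norm (f y * G y) \<le> norm (B * f y)"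
    using GB by (intro AE_I2) (simp add: abs_mult mult.commute[of "\<bar>B\<bar>"] mult_left_mono)
qed

lemma indicator_Xs_bdd: "i \<in> {1..d} \<Longrightarrow> indicator (Xs i) \<in> bdd_borel 1"
  using Xs_meas by (auto simp: bdd_borel_def indicator_def)

lemma sum_ts: "(\<Sum>i=1..d. ts i) = 1"
proof -
  have "(\<Sum>i=1..d. ts i) = (\<integral>x. (\<Sum>i=1..d. p x * indicator (Xs i) x) \<partial>lam)"
    unfolding theta_star_def using integrable_mult_bdd[OF p_int indicator_Xs_bdd]
    by (subst Bochner_Integration.integral_sum) (auto simp: mult.commute)
  moreover have "(\<Sum>i=1..d. p x * indicator (Xs i) x) = p x" for x
    using sum_indicator_Xs[of "\<lambda>_. p x" x] .
  ultimately show ?thesis using p_prob by (simp only:)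
qed

text \<open>Since \<open>d \<ge> 2\<close>, a second positive coordinate forces each coordinate
  below 1, so only positivity and total mass have to be carried through the recursion.\<close>

lemma Theta_memI:
  assumes pos: "\<And>i. i \<in> {1..d} \<Longrightarrow> 0 < t i" and sum: "(\<Sum>i=1..d. t i) = 1"
  shows "t \<in> Theta d"
proof -
  have "t i < 1" if i: "i \<in> {1..d}" for i
  proof -
    have "\<exists>j\<in>{1..d}. j \<noteq> i" using d_ge by (intro bexI[of _ "if i = 1 then 2 else 1"]) auto
    then obtain j where j: "j \<in> {1..d}" "j \<noteq> i" by blast
    have "t i + t j = (\<Sum>k\<in>{i,j}. t k)" using j by simp
    also have "\<dots> \<le> (\<Sum>k=1..d. t k)" using i j pos by (intro sum_mono2) (auto simp: less_imp_le)
    finally show ?thesis using sum pos[OF j(1)] by simp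
  qed
  then show ?thesis using pos sum by (simp add: Theta_def)
qed

lemma ts_Theta: "ts \<in> Theta d"
  using ts_pos sum_ts by (rule Theta_memI)

lemma ts_less_one: "i \<in> {1..d} \<Longrightarrow> ts i < 1"
  using ts_Theta by (simp add: Theta_def)

lemma tmin_le: "i \<in> {1..d} \<Longrightarrow> tmin \<le> ts i" unfolding tmin_def by (intro Min_le) auto
lemma tmin_pos: "0 < tmin" unfolding tmin_def using d_ge ts_pos by (subst Min_gr_iff) auto
lemma rho_pos: "0 < \<rho>" unfolding \<rho>_def using ql(1) tmin_pos pu_pos by simp

lemma Theta_pos: "\<theta> \<in> Theta d \<Longrightarrow> i \<in> {1..d} \<Longrightarrow> 0 < \<theta> i"
  and Theta_less_one: "\<theta> \<in> Theta d \<Longrightarrow> i \<in> {1..d} \<Longrightarrow> \<theta> i < 1"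
  and Theta_sum: "\<theta> \<in> Theta d \<Longrightarrow> (\<Sum>i=1..d. \<theta> i) = 1"
  by (auto simp: Theta_def)

lemma S_ge: "\<theta> \<in> Theta d \<Longrightarrow> i \<in> {1..d} \<Longrightarrow> ts i / \<theta> i \<le> S \<theta>"
  unfolding S_def using ts_pos Theta_pos
  by (intro member_le_sum) (auto simp: less_imp_le)

lemma S_pos: assumes "\<theta> \<in> Theta d" shows "0 < S \<theta>"
proof -
  have "0 < ts 1 / \<theta> 1" using ts_pos[of 1] Theta_pos[OF assms, of 1] d_ge by simp
  then show ?thesis using S_ge[OF assms, of 1] d_ge by simp
qed

section \<open>Biased densities\<close>

lemma piT_eq: "piT \<theta> x = p x / (\<theta> (J x) * S \<theta>)"
  unfolding pi_theta_def sum_indicator_Xs[of "\<lambda>i. p x / \<theta> i"] S_def[symmetric] by (simp add: divide_inverse ac_simps)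

lemma piT_pos: "\<theta> \<in> Theta d \<Longrightarrow> 0 < piT \<theta> x"
  unfolding piT_eq using p_pos S_pos Theta_pos J_in by simp

text \<open>The single summand of \<open>S \<theta>\<close> that belongs to the stratum of
  \<open>x\<close> already gives \<open>\<theta> (J x) * S \<theta> \<ge> ts (J x)\<close>, however
  small \<open>\<theta> (J x)\<close> is.\<close>

lemma piT_le: assumes "\<theta> \<in> Theta d" shows "piT \<theta> x \<le> pu / tmin"
proof -
  have "tmin \<le> \<theta> (J x) * S \<theta>"
    using S_ge[OF assms J_in[of x]] tmin_le[OF J_in, of x] Theta_pos[OF assms J_in, of x] by (simp add: field_simps)
  then show ?thesis unfolding piT_eq using pu p_pos[of x] tmin_pos pu_pos
    by (intro frac_le) auto
qed

text \<open>The bias is random, so measurability is needed jointly in sample point and state;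
  \<open>\<tau>\<close> will be \<open>\<theta> n\<close> over various sigma-algebras. A one-point
  space for \<open>N\<close> recovers the case of a fixed bias.\<close>

lemma piT_joint_meas:
  assumes "\<And>i. i \<in> {1..d} \<Longrightarrow> (\<lambda>\<omega>. \<tau> \<omega> i) \<in> borel_measurable N"
  shows "(\<lambda>(\<omega>,x). piT (\<tau> \<omega>) x) \<in> borel_measurable (N \<Otimes>\<^sub>M borel)"
proof -
  have [measurable]: "(\<lambda>z. \<tau> (fst z) i) \<in> borel_measurable (N \<Otimes>\<^sub>M borel)"
      "(\<lambda>z. indicator (Xs i) (snd z) :: real) \<in> borel_measurable (N \<Otimes>\<^sub>M borel)" if "i \<in> {1..d}" for i
    using assms[OF that] Xs_meas[OF that] by measurable
  have [measurable]: "(\<lambda>z. p (snd z)) \<in> borel_measurable (N \<Otimes>\<^sub>M borel)"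
    using p_meas by measurable
  show ?thesis
    unfolding pi_theta_def case_prod_beta
    by (intro borel_measurable_times borel_measurable_inverse borel_measurable_sum borel_measurable_divide) measurable
qed

lemma piT_meas [measurable]: "piT \<theta> \<in> borel_measurable borel"
proof -
  have "(\<lambda>(\<omega>::unit,x). piT \<theta> x) \<in> borel_measurable (count_space UNIV \<Otimes>\<^sub>M borel)"
    by (rule piT_joint_meas) auto
  from measurable_compose[OF _ this, of "\<lambda>x. ((), x)" borel] show ?thesis by simp
qed

lemma piT_int: "\<theta> \<in> Theta d \<Longrightarrow> integrable lam (piT \<theta>)"
  using piT_pos piT_le
  by (intro lam.integrable_const_bound[where B="pu / tmin"]) (auto simp: measurable_lam less_imp_le)

lemma piI_1: assumes "\<theta> \<in> Theta d" shows "(\<integral>x. piT \<theta> x \<partial>lam) = 1"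
proof -
  have "(\<integral>x. piT \<theta> x \<partial>lam) = inverse (S \<theta>) * (\<integral>x. (\<Sum>i=1..d. inverse (\<theta> i) * (p x * indicator (Xs i) x)) \<partial>lam)"
    unfolding pi_theta_def S_def[symmetric] by (simp add: divide_inverse ac_simps)
  also have "(\<integral>x. (\<Sum>i=1..d. inverse (\<theta> i) * (p x * indicator (Xs i) x)) \<partial>lam) = S \<theta>"
    using integrable_mult_bdd[OF p_int indicator_Xs_bdd]
    by (subst Bochner_Integration.integral_sum) (auto simp: S_def theta_star_def divide_inverse mult.commute)
  finally show ?thesis using S_pos[OF assms] by simp
qed

lemma piI_bound: assumes "\<theta> \<in> Theta d" "G \<in> bdd_borel B" shows "\<bar>piI \<theta> G\<bar> \<le> B"
proof -
  have "\<bar>piI \<theta> G\<bar> \<le> (\<integral>y. \<bar>piT \<theta> y * G y\<bar> \<partial>lam)" unfolding piI_def by (rule integral_abs_bound)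
  also have "\<dots> \<le> (\<integral>y. piT \<theta> y * B \<partial>lam)"
    using assms piT_pos[OF assms(1)] piT_int[OF assms(1)] integrable_mult_bdd[OF piT_int[OF assms(1)] assms(2)]
    by (intro integral_mono integrable_abs) (auto simp: abs_mult bdd_borel_def less_imp_le intro!: mult_left_mono)
  finally show ?thesis using piI_1[OF assms(1)] by simp
qed

section \<open>Acceptance densities and minorization\<close>

lemma acc_joint_meas:
  assumes "\<And>i. i \<in> {1..d} \<Longrightarrow> (\<lambda>\<omega>. \<tau> \<omega> i) \<in> borel_measurable N"
  shows "(\<lambda>((\<omega>,x),y). acc (\<tau> \<omega>) x y) \<in> borel_measurable ((N \<Otimes>\<^sub>M borel) \<Otimes>\<^sub>M borel)"
proof -
  have "(\<lambda>(x, y). q x y) \<in> borel_measurable (borel \<Otimes>\<^sub>M borel)"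
    using q_meas by (simp add: borel_prod)
  then have [measurable]: "(\<lambda>z. q (snd (fst z)) (snd z)) \<in> borel_measurable ((N \<Otimes>\<^sub>M borel) \<Otimes>\<^sub>M borel)"
    by measurable
  note piT_joint_meas[of \<tau> N, OF assms, measurable]
  show ?thesis
    unfolding acc_def MH_accept_def case_prod_beta by measurable
qed

lemma acc_meas: "(\<lambda>(x,y). acc \<theta> x y) \<in> borel_measurable (borel \<Otimes>\<^sub>M borel)"
proof -
  have "(\<lambda>((\<omega>::unit,x),y). acc \<theta> x y) \<in> borel_measurable ((count_space UNIV \<Otimes>\<^sub>M borel) \<Otimes>\<^sub>M borel)"
    by (rule acc_joint_meas) auto
  from measurable_compose[OF _ this, of "\<lambda>z. (((), fst z), snd z)" "borel \<Otimes>\<^sub>M borel"]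
  show ?thesis by (simp add: case_prod_beta)
qed

lemma acc_section_meas [measurable]: "acc \<theta> x \<in> borel_measurable borel"
  using measurable_compose[OF _ acc_meas, of "\<lambda>y. (x, y)" borel] by simp

lemma MH_accept_01: assumes "\<theta> \<in> Theta d"
  shows "0 < MH_accept lam p d Xs \<theta> x y" "MH_accept lam p d Xs \<theta> x y \<le> 1"
  unfolding MH_accept_def using piT_pos[OF assms] by auto

lemma acc_nonneg: "\<theta> \<in> Theta d \<Longrightarrow> 0 \<le> acc \<theta> x y"
  and acc_le: "\<theta> \<in> Theta d \<Longrightarrow> acc \<theta> x y \<le> q x y"
  unfolding acc_def using MH_accept_01[of \<theta> x y] q_pos[of x y]
  by (auto simp: mult_left_le less_imp_le)

lemma acc_int: "\<theta> \<in> Theta d \<Longrightarrow> integrable lam (acc \<theta> x)"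
  using acc_nonneg acc_le
  by (intro Bochner_Integration.integrable_bound[OF q_int[of x]]) (auto simp: measurable_lam q_pos less_imp_le)

lemma rej_01: assumes "\<theta> \<in> Theta d" shows "0 \<le> rej \<theta> x" "rej \<theta> x \<le> 1"
proof -
  have "(\<integral>y. acc \<theta> x y \<partial>lam) \<le> (\<integral>y. q x y \<partial>lam)"
    by (intro integral_mono acc_int q_int acc_le assms)
  moreover have "0 \<le> (\<integral>y. acc \<theta> x y \<partial>lam)"
    using acc_nonneg[OF assms] by simp
  ultimately show "0 \<le> rej \<theta> x" "rej \<theta> x \<le> 1" by (auto simp: rej_def q_dens)
qed

text \<open>The minorization is uniform up to the boundary of the simplex because the normalizing constant
  of the biased density blows up there.\<close>
lemma acc_minorization: assumes "\<theta> \<in> Theta d" shows "\<rho> * piT \<theta> y \<le> acc \<theta> x y"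
proof -
  have "piT \<theta> y * tmin / pu \<le> 1"
    using piT_le[OF assms, of y] pu_pos tmin_pos by (simp add: field_simps)
  moreover have "piT \<theta> y * tmin / pu \<le> piT \<theta> y / piT \<theta> x"
    using piT_le[OF assms, of x] piT_pos[OF assms, of x] piT_pos[OF assms, of y] pu_pos tmin_pos
    by (simp add: field_simps)
  ultimately have *: "piT \<theta> y * tmin / pu \<le> MH_accept lam p d Xs \<theta> x y"
    by (simp add: MH_accept_def)
  have "\<rho> * piT \<theta> y = ql * (piT \<theta> y * tmin / pu)" by (simp add: \<rho>_def)
  also have "\<dots> \<le> q x y * MH_accept lam p d Xs \<theta> x y"
    using * ql piT_pos[OF assms, of y] tmin_pos pu_pos q_pos[of x y]
    by (intro mult_mono) (auto simp: less_imp_le)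
  finally show ?thesis by (simp add: acc_def)
qed

text \<open>Integrating the minorization compares \<open>\<rho>\<close> with an acceptance
  probability; \<open>ts\<close> and \<open>undefined\<close> merely serve as some bias and some
  state.\<close>

lemma rho_le1: "\<rho> \<le> 1"
proof -
  have "\<rho> = (\<integral>y. \<rho> * piT ts y \<partial>lam)" using piI_1[OF ts_Theta] by simp
  also have "\<dots> \<le> (\<integral>y. acc ts undefined y \<partial>lam)"
    using acc_minorization[OF ts_Theta] piT_int[OF ts_Theta] acc_int[OF ts_Theta] by (intro integral_mono) auto
  also have "\<dots> \<le> 1" using rej_01[OF ts_Theta, of undefined] by (simp add: rej_def)
  finally show ?thesis .
qed

section \<open>Residual kernels and invariance\<close>

lemma Op_int: "\<theta> \<in> Theta d \<Longrightarrow> G \<in> bdd_borel B \<Longrightarrow> integrable lam (\<lambda>y. (acc \<theta> x y - s * piT \<theta> y) * G y)"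
  using acc_int[of \<theta> x] piT_int[of \<theta>] by (intro integrable_mult_bdd) auto

text \<open>For \<open>s \<le> \<rho>\<close> the minorization keeps the residual density
  nonnegative. Together with the rejection atom it has mass \<open>1 - s\<close>, and a positive
  kernel contracts the sup norm by its mass.\<close>

lemma Op_bound:
  assumes "\<theta> \<in> Theta d" "G \<in> bdd_borel B" "0 \<le> s" "s \<le> \<rho>"
  shows "\<bar>Op s \<theta> G x\<bar> \<le> (1 - s) * B"
proof -
  have k0: "0 \<le> acc \<theta> x y - s * piT \<theta> y" for y
    using acc_minorization[OF assms(1), of y x] mult_right_mono[OF assms(4), of "piT \<theta> y"] piT_pos[OF assms(1), of y] by linarith
  have GB: "\<bar>G y\<bar> \<le> B" for y using assms by (auto simp: bdd_borel_def)
  note i = acc_int[OF assms(1), of x] piT_int[OF assms(1)]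
  have "\<bar>\<integral>y. (acc \<theta> x y - s * piT \<theta> y) * G y \<partial>lam\<bar> \<le> (\<integral>y. \<bar>(acc \<theta> x y - s * piT \<theta> y) * G y\<bar> \<partial>lam)"
    by (rule integral_abs_bound)
  also have "\<dots> \<le> (\<integral>y. (acc \<theta> x y - s * piT \<theta> y) * B \<partial>lam)"
    using k0 GB i Op_int[OF assms(1,2)]
    by (intro integral_mono integrable_abs) (auto simp: abs_mult intro!: mult_left_mono)
  also have "\<dots> = (1 - rej \<theta> x - s) * B"
    using i piI_1[OF assms(1)] by (simp add: rej_def)
  finally have 1: "\<bar>\<integral>y. (acc \<theta> x y - s * piT \<theta> y) * G y \<partial>lam\<bar> \<le> (1 - rej \<theta> x - s) * B" .
  have 2: "\<bar>rej \<theta> x * G x\<bar> \<le> rej \<theta> x * B"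
    using rej_01[OF assms(1), of x] GB[of x] by (auto simp: abs_mult intro!: mult_left_mono)
  show ?thesis unfolding Op_def using 1 2 by (auto simp: algebra_simps)
qed

text \<open>\<open>G\<close> may depend on the sample point as well, because iterates and Poisson
  solutions carry the random bias when the kernel is applied to them.\<close>

lemma Op_joint_meas:
  assumes "\<And>i. i \<in> {1..d} \<Longrightarrow> (\<lambda>\<omega>. \<tau> \<omega> i) \<in> borel_measurable N"
    and "(\<lambda>(\<omega>,x). G \<omega> x) \<in> borel_measurable (N \<Otimes>\<^sub>M borel)"
  shows "(\<lambda>(\<omega>,x). Op s (\<tau> \<omega>) (G \<omega>) x) \<in> borel_measurable (N \<Otimes>\<^sub>M borel)"
proof -
  have [measurable]: "(\<lambda>z. acc (\<tau> (fst (fst z))) (snd (fst z)) (snd z)) \<in> borel_measurable ((N \<Otimes>\<^sub>M borel) \<Otimes>\<^sub>M borel)"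
    using acc_joint_meas[of \<tau> N, OF assms(1)] by (simp add: case_prod_beta')
  have [measurable]: "(\<lambda>z. piT (\<tau> (fst (fst z))) (snd z)) \<in> borel_measurable ((N \<Otimes>\<^sub>M borel) \<Otimes>\<^sub>M borel)"
      "(\<lambda>z. G (fst (fst z)) (snd z)) \<in> borel_measurable ((N \<Otimes>\<^sub>M borel) \<Otimes>\<^sub>M borel)"
    using measurable_compose[OF _ piT_joint_meas[of \<tau> N, OF assms(1)],
        of "\<lambda>z. (fst (fst z), snd z)" "(N \<Otimes>\<^sub>M borel) \<Otimes>\<^sub>M borel"]
      measurable_compose[OF _ assms(2),
        of "\<lambda>z. (fst (fst z), snd z)" "(N \<Otimes>\<^sub>M borel) \<Otimes>\<^sub>M borel"]
    by (simp_all add: case_prod_beta')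
  have [measurable]: "(\<lambda>z. G (fst z) (snd z)) \<in> borel_measurable (N \<Otimes>\<^sub>M borel)"
    using assms(2) by (simp add: case_prod_beta')
  have eq: "borel_measurable ((N \<Otimes>\<^sub>M borel) \<Otimes>\<^sub>M lam) = borel_measurable ((N \<Otimes>\<^sub>M borel) \<Otimes>\<^sub>M borel)"
    by (intro ext measurable_cong_sets sets_pair_measure_cong) (auto simp: lam_sets)
  have [measurable]: "(\<lambda>z. \<integral>y. (acc (\<tau> (fst z)) (snd z) y - s * piT (\<tau> (fst z)) y) * G (fst z) y \<partial>lam)
      \<in> borel_measurable (N \<Otimes>\<^sub>M borel)"
    by (intro lam.borel_measurable_lebesgue_integral) (unfold eq case_prod_beta', measurable)
  have [measurable]: "(\<lambda>z. \<integral>y. acc (\<tau> (fst z)) (snd z) y \<partial>lam) \<in> borel_measurable (N \<Otimes>\<^sub>M borel)"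
    by (intro lam.borel_measurable_lebesgue_integral) (unfold eq case_prod_beta', measurable)
  show ?thesis unfolding Op_def rej_def case_prod_beta by measurable
qed

lemma Op_meas: "G \<in> borel_measurable borel \<Longrightarrow> Op s \<theta> G \<in> borel_measurable borel"
proof -
  assume "G \<in> borel_measurable borel"
  then have "(\<lambda>(\<omega>::unit,x). Op s \<theta> G x) \<in> borel_measurable (count_space UNIV \<Otimes>\<^sub>M borel)"
    by (intro Op_joint_meas) auto
  from measurable_compose[OF _ this, of "\<lambda>x. ((), x)" borel] show ?thesis by simp
qed

lemma Op_bdd: "\<theta> \<in> Theta d \<Longrightarrow> G \<in> bdd_borel B \<Longrightarrow> 0 \<le> s \<Longrightarrow> s \<le> \<rho> \<Longrightarrow> Op s \<theta> G \<in> bdd_borel ((1 - s) * B)"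
  using Op_bound Op_meas by (auto simp: bdd_borel_def)

lemma Op_cmult: "Op s \<theta> (\<lambda>y. c * G y) x = c * Op s \<theta> G x"
  unfolding Op_def by (simp add: algebra_simps flip: integral_mult_right_zero)

lemma Op_diff:
  assumes "\<theta> \<in> Theta d" "G \<in> bdd_borel B" "H \<in> bdd_borel C"
  shows "Op s \<theta> (\<lambda>y. G y - H y) x = Op s \<theta> G x - Op s \<theta> H x"
proof -
  have "(\<integral>y. (acc \<theta> x y - s * piT \<theta> y) * (G y - H y) \<partial>lam)
      = (\<integral>y. (acc \<theta> x y - s * piT \<theta> y) * G y \<partial>lam) - (\<integral>y. (acc \<theta> x y - s * piT \<theta> y) * H y \<partial>lam)"
    unfolding right_diff_distrib[of _ "G _" "H _"]
    by (intro Bochner_Integration.integral_diff Op_int[OF assms(1,2)] Op_int[OF assms(1,3)])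
  then show ?thesis unfolding Op_def by (simp add: right_diff_distrib)
qed

lemma Op_0_const: "\<theta> \<in> Theta d \<Longrightarrow> Op 0 \<theta> (\<lambda>_. c) x = c"
  unfolding Op_def using acc_int[of \<theta> x] by (simp add: rej_def algebra_simps)

text \<open>The minorizing part maps every function to a constant, a multiple of its mean. On
  functions of mean zero the kernel itself therefore acts as the contraction
  \<open>Op \<rho> \<theta>\<close>.\<close>

lemma Op_split: "\<theta> \<in> Theta d \<Longrightarrow> G \<in> bdd_borel B \<Longrightarrow> Op 0 \<theta> G x = Op s \<theta> G x + s * piI \<theta> G"
  unfolding Op_def piI_def left_diff_distrib mult.assoc
  using integrable_mult_bdd[OF acc_int] integrable_mult_bdd[OF piT_int]
  by (subst Bochner_Integration.integral_diff) auto

lemma detailed_balance: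
  "\<theta> \<in> Theta d \<Longrightarrow> piT \<theta> x * acc \<theta> x y = q x y * min (piT \<theta> x) (piT \<theta> y)"
  unfolding acc_def MH_accept_def using piT_pos[of \<theta> x] by (auto simp: min_def field_simps)

text \<open>Reversibility: detailed balance and the symmetry of \<open>q\<close> make the flow
  between \<open>x\<close> and \<open>y\<close> symmetric, so the exchanged amount \<open>F\<close>
  is antisymmetric and its double integral vanishes.\<close>

lemma piI_Op: assumes \<theta>: "\<theta> \<in> Theta d" and G: "G \<in> bdd_borel B" shows "piI \<theta> (Op 0 \<theta> G) = piI \<theta> G"
proof -
  interpret P: pair_sigma_finite lam lam ..
  \<comment> \<open>The difference \<open>G y - G x\<close> absorbs the rejection term: a rejected
    proposal changes nothing.\<close>
  define F where "F x y = q x y * min (piT \<theta> x) (piT \<theta> y) * (G y - G x)" for x y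
  have GB: "\<bar>G y\<bar> \<le> B" for y using G by (auto simp: bdd_borel_def)
  have GM [measurable]: "G \<in> borel_measurable borel" using G by (auto simp: bdd_borel_def)
  have eq: "borel_measurable (lam \<Otimes>\<^sub>M lam) = borel_measurable (borel \<Otimes>\<^sub>M borel)"
    by (intro ext measurable_cong_sets sets_pair_measure_cong) (auto simp: lam_sets)
  have [measurable]: "(\<lambda>(x, y). q x y) \<in> borel_measurable (borel \<Otimes>\<^sub>M borel)"
    using q_meas by (simp add: borel_prod)
  have F_meas: "(\<lambda>(x,y). F x y) \<in> borel_measurable (lam \<Otimes>\<^sub>M lam)"
    unfolding F_def eq by measurable
  have q_int2: "integrable (lam \<Otimes>\<^sub>M lam) (\<lambda>(x,y). q x y)"
  proof (rule P.Fubini_integrable)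
    show "(\<lambda>(x,y). q x y) \<in> borel_measurable (lam \<Otimes>\<^sub>M lam)" unfolding eq by measurable
    show "integrable lam (\<lambda>x. \<integral>y. norm (case (x, y) of (x, y) \<Rightarrow> q x y) \<partial>lam)"
      using q_dens q_pos by (simp add: less_imp_le)
    show "AE x in lam. integrable lam (\<lambda>y. case (x, y) of (x, y) \<Rightarrow> q x y)" using q_int by simp
  qed
  \<comment> \<open>Exchanging the integrals requires absolute integrability: \<open>q\<close> is
    integrable on the product because \<open>lam\<close> is finite, and the other factors are
    bounded.\<close>
  have F_int: "integrable (lam \<Otimes>\<^sub>M lam) (\<lambda>(x,y). F x y)"
  proof (rule Bochner_Integration.integrable_bound[OF integrable_mult_left[OF q_int2, of "pu / tmin * (2 * B)"] F_meas])
    have "\<bar>F x y\<bar> \<le> q x y * (pu / tmin * (2 * B))" for x y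
    proof -
      have "\<bar>G y - G x\<bar> \<le> 2 * B" using GB[of x] GB[of y] by linarith
      moreover have "\<bar>min (piT \<theta> x) (piT \<theta> y)\<bar> \<le> pu / tmin"
        using piT_pos[OF \<theta>] piT_le[OF \<theta>, of x] by (simp add: less_imp_le min.coboundedI1)
      ultimately have "\<bar>min (piT \<theta> x) (piT \<theta> y)\<bar> * \<bar>G y - G x\<bar> \<le> pu / tmin * (2 * B)"
        using pu_pos tmin_pos by (intro mult_mono) auto
      then show ?thesis unfolding F_def abs_mult mult.assoc
        using q_pos[of x y] by (simp only: abs_of_pos) (rule mult_left_mono, auto)
    qed
    then show "AE z in lam \<Otimes>\<^sub>M lam. norm (case z of (x, y) \<Rightarrow> F x y)
        \<le> norm ((case z of (x, y) \<Rightarrow> q x y) * (pu / tmin * (2 * B)))"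
      unfolding case_prod_beta' real_norm_def
      by (intro AE_I2 order_trans[OF _ abs_ge_self]) (rule \<open>\<And>x y. \<bar>F x y\<bar> \<le> q x y * (pu / tmin * (2 * B))\<close>)
  qed
  have anti: "F y x = - F x y" for x y unfolding F_def by (simp add: q_sym[of y x] min.commute[of "piT \<theta> y"] right_diff_distrib)
  have "(\<integral>x. (\<integral>y. F x y \<partial>lam) \<partial>lam) = (\<integral>x. (\<integral>y. F y x \<partial>lam) \<partial>lam)"
    by (rule P.Fubini_integral[OF F_int, symmetric])
  moreover have "(\<integral>y. F y x \<partial>lam) = - (\<integral>y. F x y \<partial>lam)" for x
  proof -
    have "(\<integral>y. F y x \<partial>lam) = (\<integral>y. - F x y \<partial>lam)"
      by (intro Bochner_Integration.integral_cong refl anti)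
    also have "\<dots> = - (\<integral>y. F x y \<partial>lam)" by (rule Bochner_Integration.integral_minus)
    finally show ?thesis .
  qed
  ultimately have F0: "(\<integral>x. (\<integral>y. F x y \<partial>lam) \<partial>lam) = 0" by simp
  have "(\<integral>y. F x y \<partial>lam) = piT \<theta> x * Op 0 \<theta> G x - piT \<theta> x * G x" for x
  proof -
    have "F x y = piT \<theta> x * (acc \<theta> x y * G y - G x * acc \<theta> x y)" for y
      unfolding F_def detailed_balance[OF \<theta>, symmetric] by (simp add: algebra_simps)
    then have "(\<integral>y. F x y \<partial>lam) = (\<integral>y. piT \<theta> x * (acc \<theta> x y * G y - G x * acc \<theta> x y) \<partial>lam)"
      by (intro Bochner_Integration.integral_cong) auto
    also have "\<dots> = piT \<theta> x * (\<integral>y. acc \<theta> x y * G y - G x * acc \<theta> x y \<partial>lam)"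
      by (rule integral_mult_right_zero)
    also have "(\<integral>y. acc \<theta> x y * G y - G x * acc \<theta> x y \<partial>lam) = (\<integral>y. acc \<theta> x y * G y \<partial>lam) - G x * (\<integral>y. acc \<theta> x y \<partial>lam)"
      using integrable_mult_bdd[OF acc_int[OF \<theta>] G] acc_int[OF \<theta>, of x] by (subst Bochner_Integration.integral_diff) auto
    finally show ?thesis by (simp add: Op_def rej_def algebra_simps)
  qed
  then have "piI \<theta> (Op 0 \<theta> G) - piI \<theta> G = 0"
    unfolding piI_def
    using F0 integrable_mult_bdd[OF piT_int[OF \<theta>] G] integrable_mult_bdd[OF piT_int[OF \<theta>] Op_bdd[OF \<theta> G, of 0]] rho_pos
    by (subst Bochner_Integration.integral_diff[symmetric]) auto
  then show ?thesis by simp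
qed

end

subsection \<open>Dependence on the bias and the Poisson equation\<close>

lemma abs_diff_le_if_ratio:
  fixes a b e :: real
  assumes "a \<le> (1 + e) * b" "b \<le> (1 + e) * a" "0 \<le> a" "0 \<le> b" "0 \<le> e"
  shows "\<bar>a - b\<bar> \<le> e * (a + b)"
proof -
  have "0 \<le> e * a" "0 \<le> e * b" using assms by simp_all
  then show ?thesis using assms(1,2) unfolding abs_le_iff distrib_right distrib_left by linarith
qed

text \<open>Truncation at 1 turns a relative error into an absolute one: for
  \<open>b \<le> 1\<close> the excess is at most \<open>e * b\<close>, and for larger
  \<open>b\<close> the second minimum is already maximal.\<close>

lemma min_one_ratio:
  fixes a b e :: real
  assumes "a \<le> (1 + e) * b" "0 \<le> b" "0 \<le> e"
  shows "min 1 a - min 1 b \<le> e"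
proof (cases "b \<le> 1")
  case True
  then have "e * b \<le> e" using assms by (simp add: mult_left_le)
  then show ?thesis using True assms by (simp add: algebra_simps min_def)
qed (use assms in auto)

lemma bdd_borel_nonneg: "G \<in> bdd_borel B \<Longrightarrow> 0 \<le> B"
  unfolding bdd_borel_def by (auto intro: order_trans[OF abs_ge_zero])

lemma bdd_borel_diff: "G \<in> bdd_borel B \<Longrightarrow> H \<in> bdd_borel C \<Longrightarrow> (\<lambda>x. G x - H x) \<in> bdd_borel (B + C)"
  unfolding bdd_borel_def by (auto intro!: order_trans[OF abs_triangle_ineq4 add_mono])

context wl_kernel
begin

text \<open>The bias enters only through \<open>\<theta> (J x) * S \<theta>\<close>, a combination
  of the ratios \<open>\<theta> (J x) / \<theta> i\<close> with positive coefficients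
  \<open>ts i\<close>; the hypothesis applies to each term.\<close>

lemma piT_ratio_close:
  assumes \<theta>: "\<theta> \<in> Theta d" and \<theta>': "\<theta>' \<in> Theta d" and h: "ratio_close d e \<theta> \<theta>'"
  shows "piT \<theta> x \<le> (1 + e) * piT \<theta>' x"
proof -
  let ?D = "\<lambda>\<theta>. \<theta> (J x) * S \<theta>"
  have "?D \<theta>' \<le> (1 + e) * ?D \<theta>"
    unfolding S_def sum_distrib_left
  proof (rule sum_mono)
    fix i assume i: "i \<in> {1..d}"
    have "\<theta>' (J x) * \<theta> i \<le> (1 + e) * (\<theta> (J x) * \<theta>' i)"
      using h i J_in[of x] unfolding ratio_close_def by blast
    then have "ts i * (\<theta>' (J x) * \<theta> i) \<le> ts i * ((1 + e) * (\<theta> (J x) * \<theta>' i))"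
      using ts_pos[OF i] by (simp add: mult_left_mono)
    then show "\<theta>' (J x) * (ts i / \<theta>' i) \<le> (1 + e) * (\<theta> (J x) * (ts i / \<theta> i))"
      using Theta_pos[OF \<theta> i] Theta_pos[OF \<theta>' i] by (simp add: field_simps)
  qed
  moreover have "0 < ?D \<theta>" "0 < ?D \<theta>'"
    using S_pos \<theta> \<theta>' Theta_pos J_in by auto
  ultimately have "p x * ?D \<theta>' \<le> p x * ((1 + e) * ?D \<theta>)" 
    using p_pos[of x] by (intro mult_left_mono) auto
  then show ?thesis unfolding piT_eq using \<open>0 < ?D \<theta>\<close> \<open>0 < ?D \<theta>'\<close>
    by (simp add: pos_divide_le_eq pos_le_divide_eq mult_ac)
qed

lemma piT_ratio: "\<theta> \<in> Theta d \<Longrightarrow> piT \<theta> y / piT \<theta> x = (p y * \<theta> (J x)) / (p x * \<theta> (J y))"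
  unfolding piT_eq using S_pos[of \<theta>] by (simp add: field_simps)

text \<open>The normalizing constants cancel in an acceptance ratio, which leaves one ratio of
  weights.\<close>

lemma MH_accept_ratio_close:
  assumes \<theta>: "\<theta> \<in> Theta d" and \<theta>': "\<theta>' \<in> Theta d" and h: "ratio_close d e \<theta> \<theta>'" and e: "0 \<le> e"
  shows "MH_accept lam p d Xs \<theta>' x y - MH_accept lam p d Xs \<theta> x y \<le> e"
proof -
  have "\<theta>' (J x) * \<theta> (J y) \<le> (1 + e) * (\<theta> (J x) * \<theta>' (J y))"
    using h J_in unfolding ratio_close_def by blast
  then have "p y * (\<theta>' (J x) * \<theta> (J y)) \<le> p y * ((1 + e) * (\<theta> (J x) * \<theta>' (J y)))"
    using p_pos[of y] by (simp add: mult_left_mono)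
  then have "piT \<theta>' y / piT \<theta>' x \<le> (1 + e) * (piT \<theta> y / piT \<theta> x)"
    unfolding piT_ratio[OF \<theta>] piT_ratio[OF \<theta>']
    using p_pos[of x] Theta_pos[OF \<theta> J_in[of y]] Theta_pos[OF \<theta>' J_in[of y]] by (simp add: field_simps)
  then show ?thesis unfolding MH_accept_def
    using piT_pos[OF \<theta>] e by (intro min_one_ratio) (auto simp: less_imp_le)
qed

lemma acc_ratio_close:
  assumes \<theta>: "\<theta> \<in> Theta d" and \<theta>': "\<theta>' \<in> Theta d" and h: "ratio_close d e \<theta> \<theta>'" and e: "0 \<le> e"
  shows "\<bar>acc \<theta> x y - acc \<theta>' x y\<bar> \<le> e * q x y"
proof -
  have "\<bar>MH_accept lam p d Xs \<theta> x y - MH_accept lam p d Xs \<theta>' x y\<bar> \<le> e"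
    using MH_accept_ratio_close[OF assms] MH_accept_ratio_close[OF \<theta>' \<theta> ratio_close_sym[OF h] e] by (simp add: abs_le_iff)
  then show ?thesis unfolding acc_def right_diff_distrib[symmetric] abs_mult
    using q_pos[of x y] by (simp add: mult.commute mult_right_mono)
qed

lemma piI_ratio_close:
  assumes \<theta>: "\<theta> \<in> Theta d" and \<theta>': "\<theta>' \<in> Theta d" and h: "ratio_close d e \<theta> \<theta>'" and e: "0 \<le> e"
    and G: "G \<in> bdd_borel B"
  shows "\<bar>piI \<theta> G - piI \<theta>' G\<bar> \<le> 2 * e * B"
proof -
  note i = piT_int[OF \<theta>] piT_int[OF \<theta>']
  have B: "\<bar>G y\<bar> \<le> B" for y using G by (auto simp: bdd_borel_def)
  have "piI \<theta> G - piI \<theta>' G = (\<integral>y. (piT \<theta> y - piT \<theta>' y) * G y \<partial>lam)"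
    unfolding piI_def left_diff_distrib using integrable_mult_bdd[OF i(1) G] integrable_mult_bdd[OF i(2) G] by simp
  also have "\<bar>\<dots>\<bar> \<le> (\<integral>y. \<bar>(piT \<theta> y - piT \<theta>' y) * G y\<bar> \<partial>lam)" by (rule integral_abs_bound)
  also have "\<dots> \<le> (\<integral>y. e * (piT \<theta> y + piT \<theta>' y) * B \<partial>lam)"
  proof (rule integral_mono)
    show "integrable lam (\<lambda>y. \<bar>(piT \<theta> y - piT \<theta>' y) * G y\<bar>)"
      using i by (intro integrable_abs integrable_mult_bdd[OF _ G]) auto
    show "integrable lam (\<lambda>y. e * (piT \<theta> y + piT \<theta>' y) * B)" using i by simp
    fix y
    have "\<bar>piT \<theta> y - piT \<theta>' y\<bar> \<le> e * (piT \<theta> y + piT \<theta>' y)"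
      using piT_ratio_close[OF \<theta> \<theta>' h] piT_ratio_close[OF \<theta>' \<theta> ratio_close_sym[OF h]] piT_pos[OF \<theta>] piT_pos[OF \<theta>'] e
      by (intro abs_diff_le_if_ratio) (auto simp: less_imp_le)
    then show "\<bar>(piT \<theta> y - piT \<theta>' y) * G y\<bar> \<le> e * (piT \<theta> y + piT \<theta>' y) * B"
      unfolding abs_mult using B[of y] by (intro mult_mono) auto
  qed
  also have "\<dots> = 2 * e * B" using i piI_1[OF \<theta>] piI_1[OF \<theta>'] by simp
  finally show ?thesis .
qed

text \<open>Whatever is not accepted stays at \<open>x\<close>, so
  \<open>Op 0 \<theta> G x - G x\<close> is the integral of
  \<open>acc \<theta> x y * (G y - G x)\<close>. Hence the rejection terms need no separate
  estimate, and the factor 2 is the oscillation of \<open>G\<close>.\<close>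

lemma Op_0_ratio_close:
  assumes \<theta>: "\<theta> \<in> Theta d" and \<theta>': "\<theta>' \<in> Theta d" and h: "ratio_close d e \<theta> \<theta>'" and e: "0 \<le> e"
    and G: "G \<in> bdd_borel B"
  shows "\<bar>Op 0 \<theta> G x - Op 0 \<theta>' G x\<bar> \<le> 2 * e * B"
proof -
  note i = acc_int[OF \<theta>, of x] acc_int[OF \<theta>', of x]
  have B: "\<bar>G y\<bar> \<le> B" for y using G by (auto simp: bdd_borel_def)
  then have D: "(\<lambda>y. G y - G x) \<in> bdd_borel (B + B)"
    using G by (intro bdd_borel_diff) (auto simp: bdd_borel_def)
  have "Op 0 \<theta> G x - Op 0 \<theta>' G x = (\<integral>y. (acc \<theta> x y - acc \<theta>' x y) * (G y - G x) \<partial>lam)"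
    unfolding Op_def rej_def left_diff_distrib right_diff_distrib
    using integrable_mult_bdd[OF i(1) G] integrable_mult_bdd[OF i(2) G] i by simp
  then have "\<bar>Op 0 \<theta> G x - Op 0 \<theta>' G x\<bar> \<le> (\<integral>y. \<bar>(acc \<theta> x y - acc \<theta>' x y) * (G y - G x)\<bar> \<partial>lam)"
    by (simp only: integral_abs_bound)
  also have "\<dots> \<le> (\<integral>y. e * q x y * (2 * B) \<partial>lam)"
  proof (rule integral_mono)
    show "integrable lam (\<lambda>y. \<bar>(acc \<theta> x y - acc \<theta>' x y) * (G y - G x)\<bar>)"
      by (intro integrable_abs integrable_mult_bdd[OF Bochner_Integration.integrable_diff[OF i] D])
    show "integrable lam (\<lambda>y. e * q x y * (2 * B))" using q_int[of x] by simp
    show "\<bar>(acc \<theta> x y - acc \<theta>' x y) * (G y - G x)\<bar> \<le> e * q x y * (2 * B)" for y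
      unfolding abs_mult using B[of x] B[of y] acc_ratio_close[OF \<theta> \<theta>' h e, of x y] e q_pos[of x y]
      by (intro mult_mono) auto
  qed
  also have "\<dots> = 2 * e * B" using q_dens[of x] by simp
  finally show ?thesis .
qed

text \<open>The constant is \<open>2 + 2\<close>: one share from the full kernel, the other from the
  minorizing part that was split off.\<close>

lemma Op_ratio_close:
  assumes \<theta>: "\<theta> \<in> Theta d" and \<theta>': "\<theta>' \<in> Theta d" and h: "ratio_close d e \<theta> \<theta>'" and e: "0 \<le> e"
    and G: "G \<in> bdd_borel B" and s: "0 \<le> s" "s \<le> 1"
  shows "\<bar>Op s \<theta> G x - Op s \<theta>' G x\<bar> \<le> 4 * e * B"
proof -
  have "Op s \<theta> G x - Op s \<theta>' G x = (Op 0 \<theta> G x - Op 0 \<theta>' G x) - s * (piI \<theta> G - piI \<theta>' G)"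
    using Op_split[OF \<theta> G, of x s] Op_split[OF \<theta>' G, of x s] by (simp add: algebra_simps)
  moreover have "\<bar>s * (piI \<theta> G - piI \<theta>' G)\<bar> \<le> \<bar>piI \<theta> G - piI \<theta>' G\<bar>"
    using s by (simp add: abs_mult mult_left_le_one_le)
  ultimately show ?thesis
    using Op_0_ratio_close[OF \<theta> \<theta>' h e G, of x] piI_ratio_close[OF \<theta> \<theta>' h e G] by linarith
qed

text \<open>With \<open>s = 0\<close> these are the multi-step transitions under a frozen bias; with
  \<open>s = \<rho>\<close> they are the terms of a Neumann series.\<close>

primrec iter where
  "iter s g 0 \<theta> = g"
| "iter s g (Suc m) \<theta> = Op s \<theta> (iter s g m \<theta>)"

lemma iter_bdd: "\<theta> \<in> Theta d \<Longrightarrow> g \<in> bdd_borel B \<Longrightarrow> 0 \<le> s \<Longrightarrow> s \<le> \<rho> \<Longrightarrow> iter s g m \<theta> \<in> bdd_borel ((1 - s) ^ m * B)"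
  by (induction m) (auto simp: mult.assoc intro: Op_bdd)

lemma iter_joint_meas:
  assumes "\<And>i. i \<in> {1..d} \<Longrightarrow> (\<lambda>\<omega>. \<tau> \<omega> i) \<in> borel_measurable N" and "g \<in> borel_measurable borel"
  shows "(\<lambda>(\<omega>,x). iter s g m (\<tau> \<omega>) x) \<in> borel_measurable (N \<Otimes>\<^sub>M borel)"
proof (induction m)
  case 0
  then show ?case using assms(2) by simp
next
  case (Suc m)
  then show ?case using Op_joint_meas[OF assms(1) Suc] by simp
qed

lemma iter_0_bdd: "\<theta> \<in> Theta d \<Longrightarrow> g \<in> bdd_borel B \<Longrightarrow> iter 0 g m \<theta> \<in> bdd_borel B"
  using iter_bdd[of \<theta> g B 0 m] rho_pos by simp

text \<open>The kernels are exchanged one at a time. Since \<open>Op 0\<close> does not increase the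
  sup norm, the costs simply add up.\<close>

lemma iter_0_ratio_close:
  assumes \<theta>: "\<theta> \<in> Theta d" and \<theta>': "\<theta>' \<in> Theta d" and h: "ratio_close d e \<theta> \<theta>'" and e: "0 \<le> e"
    and g: "g \<in> bdd_borel B"
  shows "\<bar>iter 0 g m \<theta> x - iter 0 g m \<theta>' x\<bar> \<le> real m * (4 * e * B)"
proof (induction m arbitrary: x)
  case 0
  then show ?case by simp
next
  case (Suc m)
  note b = iter_0_bdd[OF \<theta> g, of m] iter_0_bdd[OF \<theta>' g, of m]
  have "(\<lambda>x. iter 0 g m \<theta> x - iter 0 g m \<theta>' x) \<in> bdd_borel (real m * (4 * e * B))"
    using Suc bdd_borel_diff[OF b] by (auto simp: bdd_borel_def)
  then have "\<bar>Op 0 \<theta>' (\<lambda>x. iter 0 g m \<theta> x - iter 0 g m \<theta>' x) x\<bar> \<le> real m * (4 * e * B)"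
    using Op_bound[OF \<theta>', of _ _ 0] rho_pos by fastforce
  then have "\<bar>Op 0 \<theta>' (iter 0 g m \<theta>) x - Op 0 \<theta>' (iter 0 g m \<theta>') x\<bar> \<le> real m * (4 * e * B)"
    by (simp add: Op_diff[OF \<theta>' b])
  moreover have "\<bar>Op 0 \<theta> (iter 0 g m \<theta>) x - Op 0 \<theta>' (iter 0 g m \<theta>) x\<bar> \<le> 4 * e * B"
    using Op_ratio_close[OF \<theta> \<theta>' h e b(1), of 0] by simp
  ultimately show ?case by (simp add: algebra_simps)
qed

text \<open>By invariance the centred iterates keep mean zero under the biased target, so each
  further step contracts by \<open>1 - \<rho>\<close>; \<open>2 * B\<close> bounds the centred
  \<open>g\<close>.\<close>

lemma iter_0_ergodic:
  assumes \<theta>: "\<theta> \<in> Theta d" and g: "g \<in> bdd_borel B"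
  shows "\<bar>iter 0 g m \<theta> x - piI \<theta> g\<bar> \<le> (1 - \<rho>) ^ m * (2 * B)"
proof (induction m arbitrary: x)
  case 0
  have "\<bar>g x\<bar> \<le> B" using g by (simp add: bdd_borel_def)
  then show ?case using piI_bound[OF \<theta> g] by simp
next
  case (Suc m)
  let ?c = "\<lambda>_. piI \<theta> g"
  note b = iter_0_bdd[OF \<theta> g, of m]
  have c: "?c \<in> bdd_borel B" using piI_bound[OF \<theta> g] by (auto simp: bdd_borel_def)
  have pi_it: "piI \<theta> (iter 0 g m \<theta>) = piI \<theta> g" for m
    by (induction m) (simp_all add: piI_Op[OF \<theta> iter_0_bdd[OF \<theta> g]])
  have D: "(\<lambda>x. iter 0 g m \<theta> x - piI \<theta> g) \<in> bdd_borel ((1 - \<rho>) ^ m * (2 * B))"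
    using Suc bdd_borel_diff[OF b c] by (auto simp: bdd_borel_def)
  have "piI \<theta> (\<lambda>x. iter 0 g m \<theta> x - piI \<theta> g) = piI \<theta> (iter 0 g m \<theta>) - piI \<theta> g"
    using integrable_mult_bdd[OF piT_int[OF \<theta>] b] piT_int[OF \<theta>] piI_1[OF \<theta>] by (simp add: piI_def right_diff_distrib)
  then have "piI \<theta> (\<lambda>x. iter 0 g m \<theta> x - piI \<theta> g) = 0" by (simp add: pi_it)
  then have "Op \<rho> \<theta> (\<lambda>x. iter 0 g m \<theta> x - piI \<theta> g) x = Op 0 \<theta> (\<lambda>x. iter 0 g m \<theta> x - piI \<theta> g) x"
    using Op_split[OF \<theta> D, of x \<rho>] by simp
  also have "\<dots> = iter 0 g (Suc m) \<theta> x - piI \<theta> g"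
    by (simp add: Op_diff[OF \<theta> b c] Op_0_const[OF \<theta>])
  finally show ?case using Op_bound[OF \<theta> D, of \<rho> x] rho_pos by (simp add: mult.assoc)
qed

text \<open>The Neumann series of the residual kernel, a contraction with factor \<open>1 - \<rho>\<close>: its fixed-point
  equation yields at once the bound, the Poisson equation and the Lipschitz dependence on \<open>\<theta>\<close>.\<close>
definition poisson where "poisson g \<theta> x = (\<Sum>m. iter \<rho> g m \<theta> x)"

lemma one_minus_rho: "0 \<le> 1 - \<rho>" "1 - \<rho> < 1" "norm (1 - \<rho>) < 1"
  using rho_pos rho_le1 by auto

lemma iter_rho_bound: "\<theta> \<in> Theta d \<Longrightarrow> g \<in> bdd_borel B \<Longrightarrow> \<bar>iter \<rho> g m \<theta> x\<bar> \<le> (1 - \<rho>) ^ m * B"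
  using iter_bdd[of \<theta> g B \<rho> m] rho_pos by (auto simp: bdd_borel_def)

lemma rho_geometric_summable: "summable (\<lambda>m. (1 - \<rho>) ^ m * B)"
  by (intro summable_mult2 summable_geometric one_minus_rho)

lemma iter_summable: "\<theta> \<in> Theta d \<Longrightarrow> g \<in> bdd_borel B \<Longrightarrow> summable (\<lambda>m. iter \<rho> g m \<theta> x)"
  using iter_rho_bound by (intro summable_comparison_test'[OF rho_geometric_summable[of B]]) auto

text \<open>\<open>N = 0\<close> is the sup bound for the solution. For general \<open>N\<close>,
  uniformity in \<open>x\<close> allows the kernel to be applied to the series.\<close>

lemma poisson_tail:
  assumes \<theta>: "\<theta> \<in> Theta d" and g: "g \<in> bdd_borel B"
  shows "\<bar>poisson g \<theta> x - (\<Sum>m<N. iter \<rho> g m \<theta> x)\<bar> \<le> (1 - \<rho>) ^ N * B / \<rho>"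
proof -
  have "poisson g \<theta> x - (\<Sum>m<N. iter \<rho> g m \<theta> x) = (\<Sum>m. iter \<rho> g (m + N) \<theta> x)"
    unfolding poisson_def using suminf_split_initial_segment[OF iter_summable[OF \<theta> g], of x N] by simp
  also have "\<bar>\<dots>\<bar> \<le> (\<Sum>m. (1 - \<rho>) ^ N * B * (1 - \<rho>) ^ m)"
  proof -
    have 1: "\<bar>iter \<rho> g (m + N) \<theta> x\<bar> \<le> (1 - \<rho>) ^ N * B * (1 - \<rho>) ^ m" for m
      using iter_rho_bound[OF \<theta> g, of "m + N" x] by (simp add: power_add mult_ac)
    have 2: "summable (\<lambda>m. (1 - \<rho>) ^ N * B * (1 - \<rho>) ^ m)"
      by (intro summable_mult summable_geometric one_minus_rho)
    have 3: "summable (\<lambda>m. \<bar>iter \<rho> g (m + N) \<theta> x\<bar>)"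
      using 1 by (intro summable_comparison_test'[OF 2]) auto
    show ?thesis using summable_rabs[OF 3] suminf_le[OF 1 3 2] by linarith
  qed
  also have "\<dots> = (1 - \<rho>) ^ N * B / \<rho>"
    using one_minus_rho(3) by (subst suminf_mult) (auto simp: suminf_geometric summable_geometric)
  finally show ?thesis .
qed

lemma poisson_joint_meas:
  assumes "\<And>i. i \<in> {1..d} \<Longrightarrow> (\<lambda>\<omega>. \<tau> \<omega> i) \<in> borel_measurable N" and "g \<in> borel_measurable borel"
  shows "(\<lambda>(\<omega>,x). poisson g (\<tau> \<omega>) x) \<in> borel_measurable (N \<Otimes>\<^sub>M borel)"
  unfolding poisson_def case_prod_beta'
  by (intro borel_measurable_suminf iter_joint_meas[of \<tau> N g, OF assms, unfolded case_prod_beta'])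

lemma poisson_bdd: assumes \<theta>: "\<theta> \<in> Theta d" and g: "g \<in> bdd_borel B" shows "poisson g \<theta> \<in> bdd_borel (B / \<rho>)"
proof -
  have "iter \<rho> g m \<theta> \<in> borel_measurable borel" for m
    using iter_bdd[OF \<theta> g, of \<rho> m] rho_pos by (auto simp: bdd_borel_def)
  then have "poisson g \<theta> \<in> borel_measurable borel"
    unfolding poisson_def[abs_def] by (intro borel_measurable_suminf) auto
  then show ?thesis using poisson_tail[OF \<theta> g, of _ 0] by (auto simp: bdd_borel_def)
qed

text \<open>Partial sums satisfy the recursion exactly, and they converge uniformly, so the operator
  passes to the limit.\<close>

lemma poisson_fixpoint:
  assumes \<theta>: "\<theta> \<in> Theta d" and g: "g \<in> bdd_borel B"
  shows "poisson g \<theta> x = g x + Op \<rho> \<theta> (poisson g \<theta>) x"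
proof -
  define W where "W N x = (\<Sum>m<N. iter \<rho> g m \<theta> x)" for N x
  have it: "iter \<rho> g m \<theta> \<in> bdd_borel ((1 - \<rho>) ^ m * B)" for m
    using iter_bdd[OF \<theta> g, of \<rho> m] rho_pos by simp
  have B0: "0 \<le> B" using bdd_borel_nonneg[OF g] .
  have W_bdd: "\<exists>C. W N \<in> bdd_borel C" for N
  proof -
    have "\<bar>W N x\<bar> \<le> (\<Sum>m<N. (1 - \<rho>) ^ m * B)" for x
      unfolding W_def using it by (intro order_trans[OF sum_abs] sum_mono) (auto simp: bdd_borel_def)
    moreover have "W N \<in> borel_measurable borel"
      unfolding W_def[abs_def] using it by (intro borel_measurable_sum) (auto simp: bdd_borel_def)
    ultimately show ?thesis by (auto simp: bdd_borel_def)
  qed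
  have W_Suc: "W (Suc N) x = g x + Op \<rho> \<theta> (W N) x" for N x
  proof (induction N arbitrary: x)
    case 0
    then show ?case by (simp add: W_def Op_def)
  next
    case (Suc N)
    obtain C where C: "W (Suc N) \<in> bdd_borel C" using W_bdd by blast
    obtain C' where C': "W N \<in> bdd_borel C'" using W_bdd by blast
    have "Op \<rho> \<theta> (W (Suc N)) x - Op \<rho> \<theta> (W N) x = Op \<rho> \<theta> (\<lambda>y. W (Suc N) y - W N y) x"
      by (rule Op_diff[OF \<theta> C C', symmetric])
    also have "\<dots> = iter \<rho> g (Suc N) \<theta> x" by (simp add: W_def)
    also have "\<dots> = W (Suc (Suc N)) x - W (Suc N) x" by (simp add: W_def)
    finally show ?case using Suc[of x] by linarith
  qed
  \<comment> \<open>Two truncation errors occur: that of the series itself and that of its image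
    under \<open>Op \<rho> \<theta>\<close>.\<close>
  have le: "\<bar>poisson g \<theta> x - (g x + Op \<rho> \<theta> (poisson g \<theta>) x)\<bar> \<le> 2 * ((1 - \<rho>) ^ N * B / \<rho>)" for N
  proof -
    obtain C where C: "W N \<in> bdd_borel C" using W_bdd by blast
    have "(\<lambda>y. poisson g \<theta> y - W N y) \<in> bdd_borel ((1 - \<rho>) ^ N * B / \<rho>)"
      using bdd_borel_diff[OF poisson_bdd[OF \<theta> g] C] poisson_tail[OF \<theta> g, of _ N] by (auto simp: bdd_borel_def W_def)
    then have "\<bar>Op \<rho> \<theta> (\<lambda>y. poisson g \<theta> y - W N y) x\<bar> \<le> (1 - \<rho>) * ((1 - \<rho>) ^ N * B / \<rho>)"
      using rho_pos by (intro Op_bound[OF \<theta>]) auto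
    also have "\<dots> \<le> (1 - \<rho>) ^ N * B / \<rho>"
      using one_minus_rho rho_pos B0 by (intro mult_left_le_one_le) auto
    finally have "\<bar>Op \<rho> \<theta> (poisson g \<theta>) x - Op \<rho> \<theta> (W N) x\<bar> \<le> (1 - \<rho>) ^ N * B / \<rho>"
      by (simp add: Op_diff[OF \<theta> poisson_bdd[OF \<theta> g] C])
    moreover have "\<bar>poisson g \<theta> x - W (Suc N) x\<bar> \<le> (1 - \<rho>) ^ N * B / \<rho>"
    proof -
      have "(1 - \<rho>) * ((1 - \<rho>) ^ N * B / \<rho>) \<le> (1 - \<rho>) ^ N * B / \<rho>"
        using one_minus_rho rho_pos B0 by (intro mult_left_le_one_le) auto
      then show ?thesis using poisson_tail[OF \<theta> g, of x "Suc N"] by (simp add: W_def mult.assoc)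
    qed
    ultimately show ?thesis using W_Suc[of N x] by linarith
  qed
  have "(\<lambda>N. 2 * ((1 - \<rho>) ^ N * B / \<rho>)) \<longlonglongrightarrow> 2 * (0 * B / \<rho>)"
    by (intro tendsto_intros LIMSEQ_power_zero one_minus_rho) (use rho_pos in auto)
  then have "\<bar>poisson g \<theta> x - (g x + Op \<rho> \<theta> (poisson g \<theta>) x)\<bar> \<le> 0"
    using le by (intro LIMSEQ_le_const) auto
  then show ?thesis by simp
qed

text \<open>The constant in the Poisson equation is identified by integrating against the invariant density.\<close>
lemma poisson_equation:
  assumes \<theta>: "\<theta> \<in> Theta d" and g: "g \<in> bdd_borel B"
  shows "poisson g \<theta> x - Op 0 \<theta> (poisson g \<theta>) x = g x - piI \<theta> g"
proof -
  note w = poisson_bdd[OF \<theta> g]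
  have eq: "Op 0 \<theta> (poisson g \<theta>) y = poisson g \<theta> y - g y + \<rho> * piI \<theta> (poisson g \<theta>)" for y
    using poisson_fixpoint[OF \<theta> g, of y] Op_split[OF \<theta> w, of y \<rho>] by simp
  have "piI \<theta> (poisson g \<theta>) = piI \<theta> (\<lambda>y. poisson g \<theta> y - g y + \<rho> * piI \<theta> (poisson g \<theta>))"
    using piI_Op[OF \<theta> w] unfolding eq[abs_def] by simp
  also have "\<dots> = piI \<theta> (poisson g \<theta>) - piI \<theta> g + \<rho> * piI \<theta> (poisson g \<theta>)"
    unfolding piI_def[of \<theta> "\<lambda>y. poisson g \<theta> y - g y + \<rho> * piI \<theta> (poisson g \<theta>)"]
    using integrable_mult_bdd[OF piT_int[OF \<theta>] w] integrable_mult_bdd[OF piT_int[OF \<theta>] g] piT_int[OF \<theta>] piI_1[OF \<theta>]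
    by (simp add: distrib_left right_diff_distrib piI_def)
  finally show ?thesis using eq[of x] by simp
qed

text \<open>Subtracting two fixed-point equations shows that the difference \<open>D\<close> equals
  a kernel perturbation plus \<open>Op \<rho> \<theta>' D\<close>. The sup of \<open>D\<close> is
  absorbed by the contraction: one \<open>1 / \<rho>\<close> comes from this, the other from the
  bound on the solution.\<close>

lemma poisson_ratio_close:
  assumes \<theta>: "\<theta> \<in> Theta d" and \<theta>': "\<theta>' \<in> Theta d" and h: "ratio_close d e \<theta> \<theta>'" and e: "0 \<le> e"
    and g: "g \<in> bdd_borel B"
  shows "\<bar>poisson g \<theta> x - poisson g \<theta>' x\<bar> \<le> 4 * e * B / \<rho>\<^sup>2"
proof -
  note w = poisson_bdd[OF \<theta> g] poisson_bdd[OF \<theta>' g]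
  define D where "D x = poisson g \<theta> x - poisson g \<theta>' x" for x
  have D_bdd: "D \<in> bdd_borel (B / \<rho> + B / \<rho>)" unfolding D_def[abs_def] by (rule bdd_borel_diff[OF w])
  \<comment> \<open>The absorption below is legitimate only because this supremum is finite.\<close>
  define K where "K = (SUP x. \<bar>D x\<bar>)"
  have bdd: "bdd_above (range (\<lambda>x. \<bar>D x\<bar>))"
    using D_bdd by (auto simp: bdd_borel_def intro!: bdd_aboveI2)
  have DK: "\<bar>D x\<bar> \<le> K" for x unfolding K_def by (rule cSUP_upper[OF _ bdd]) simp
  then have D_bdd': "D \<in> bdd_borel K" using D_bdd by (auto simp: bdd_borel_def)
  have "\<bar>D x\<bar> \<le> 4 * e * (B / \<rho>) + (1 - \<rho>) * K" for x
  proof -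
    have "D x = (Op \<rho> \<theta> (poisson g \<theta>) x - Op \<rho> \<theta>' (poisson g \<theta>) x) + Op \<rho> \<theta>' D x"
      using poisson_fixpoint[OF \<theta> g, of x] poisson_fixpoint[OF \<theta>' g, of x] Op_diff[OF \<theta>' w, of \<rho> x]
      by (simp add: D_def[abs_def])
    moreover have "\<bar>Op \<rho> \<theta> (poisson g \<theta>) x - Op \<rho> \<theta>' (poisson g \<theta>) x\<bar> \<le> 4 * e * (B / \<rho>)"
      using Op_ratio_close[OF \<theta> \<theta>' h e w(1), of \<rho>] rho_pos rho_le1 by simp
    moreover have "\<bar>Op \<rho> \<theta>' D x\<bar> \<le> (1 - \<rho>) * K"
      using Op_bound[OF \<theta>' D_bdd', of \<rho>] rho_pos by simp
    ultimately show ?thesis by linarith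
  qed
  then have "K \<le> 4 * e * (B / \<rho>) + (1 - \<rho>) * K" unfolding K_def by (intro cSUP_least) auto
  then have "\<rho> * K \<le> 4 * e * (B / \<rho>)" by (simp add: algebra_simps)
  then have "K \<le> 4 * e * B / \<rho>\<^sup>2" using rho_pos by (simp add: field_simps power2_eq_square)
  then show ?thesis using DK[of x] by (simp add: D_def)
qed

text \<open>For the bias \<open>ts\<close> the normalizing sum is exactly \<open>d\<close>, so the
  weight \<open>ts i * d\<close> undoes the biasing of stratum \<open>i\<close>. This is the origin
  of the factor \<open>d\<close> in the estimator.\<close>

lemma piI_ts: assumes g: "g \<in> bdd_borel B"
  shows "(\<Sum>i=1..d. ts i * (real d * piI ts (\<lambda>x. g x * indicator (Xs i) x))) = (\<integral>x. g x * p x \<partial>lam)"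
proof -
  have Sts: "S ts = real d"
    unfolding S_def using ts_pos by (simp add: less_imp_neq[THEN not_sym])
  have i_eq: "ts i * (real d * piI ts (\<lambda>x. g x * indicator (Xs i) x)) = (\<integral>x. (p x * g x) * indicator (Xs i) x \<partial>lam)"
    if i: "i \<in> {1..d}" for i
  proof -
    have "ts i * (real d * (piT ts x * (g x * indicator (Xs i) x))) = (p x * g x) * indicator (Xs i) x" for x
      using ts_pos[OF i] d_ge indicator_Xs[OF i, of x] by (cases "J x = i") (auto simp: piT_eq Sts)
    moreover have "ts i * (real d * piI ts (\<lambda>x. g x * indicator (Xs i) x))
        = (\<integral>x. ts i * (real d * (piT ts x * (g x * indicator (Xs i) x))) \<partial>lam)"
      unfolding piI_def by simp
    ultimately show ?thesis by (simp only:)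
  qed
  have "(\<Sum>i=1..d. ts i * (real d * piI ts (\<lambda>x. g x * indicator (Xs i) x)))
      = (\<integral>x. (\<Sum>i=1..d. (p x * g x) * indicator (Xs i) x) \<partial>lam)"
    using i_eq integrable_mult_bdd[OF integrable_mult_bdd[OF p_int g] indicator_Xs_bdd]
    by (subst Bochner_Integration.integral_sum) auto
  moreover have "(\<Sum>i=1..d. (p x * g x) * indicator (Xs i) x) = g x * p x" for x
    using sum_indicator_Xs[of "\<lambda>_. p x * g x" x] by (simp only: mult.commute)
  ultimately show ?thesis by (simp only:)
qed

lemma piI_ind: assumes "\<theta> \<in> Theta d" "i \<in> {1..d}"
  shows "piI \<theta> (indicator (Xs i)) = ts i / (\<theta> i * S \<theta>)"
proof -
  have "piT \<theta> x * indicator (Xs i) x = indicator (Xs i) x * p x / (\<theta> i * S \<theta>)" for x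
    unfolding piT_eq using assms by (simp add: indicator_Xs)
  then show ?thesis unfolding piI_def theta_star_def by simp
qed

end

subsection \<open>The adaptive chain\<close>

locale wl_process = wl_kernel lam p d Xs q pl pu ql + prob_space M
  for lam :: "'a::polish_space measure" and p d Xs q pl pu ql and M :: "'w measure" +
  fixes \<gamma> :: "nat \<Rightarrow> real" and X :: "nat \<Rightarrow> 'w \<Rightarrow> 'a" and \<theta> :: "nat \<Rightarrow> 'w \<Rightarrow> nat \<Rightarrow> real"
  assumes g_range: "\<And>n. 1 \<le> n \<Longrightarrow> 0 \<le> \<gamma> n \<and> \<gamma> n < 1"
    and g_mono: "\<And>n m. 1 \<le> n \<Longrightarrow> n \<le> m \<Longrightarrow> \<gamma> m \<le> \<gamma> n"
    and g_lim: "\<gamma> \<longlonglongrightarrow> 0"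
    and g_div: "\<not> summable \<gamma>"
    and g_sq: "summable (\<lambda>n. (\<gamma> n)\<^sup>2)"
    and X_meas [measurable]: "\<And>n. X n \<in> borel_measurable M"
    and th0_meas: "\<And>i. i \<in> {1..d} \<Longrightarrow> (\<lambda>\<omega>. \<theta> 0 \<omega> i) \<in> borel_measurable M"
    and th0_Theta: "\<And>\<omega>. \<omega> \<in> space M \<Longrightarrow> \<theta> 0 \<omega> \<in> Theta d"
    and X_cond: "\<And>n A B. A \<in> filt_sets M d X \<theta> n \<Longrightarrow> B \<in> sets borel \<Longrightarrow>
        emeasure M (A \<inter> {\<omega>\<in>space M. X (Suc n) \<omega> \<in> B})
        = (\<integral>\<^sup>+\<omega>. indicator A \<omega> * ennreal (MH_kernel lam p d Xs q (\<theta> n \<omega>) (X n \<omega>) B) \<partial>M)"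
    and th_upd: "\<And>n \<omega>. \<omega> \<in> space M \<Longrightarrow> \<theta> (Suc n) \<omega>
        = (\<lambda>i. \<theta> n \<omega> i + \<gamma> (Suc n) * WL_H d Xs (X (Suc n) \<omega>) (\<theta> n \<omega>) i)"
begin

text \<open>The relative increment, \<open>WL_H\<close> divided by the weight. It lies between -1
  and 1 everywhere on the simplex, which gives uniform control of ratios and logarithms of the
  weights.\<close>

definition rel_step where "rel_step n \<omega> i = indicator (Xs i) (X (Suc n) \<omega>) - \<theta> n \<omega> (J (X (Suc n) \<omega>))"

lemma theta_Suc: "\<omega> \<in> space M \<Longrightarrow> \<theta> (Suc n) \<omega> i = \<theta> n \<omega> i * (1 + \<gamma> (Suc n) * rel_step n \<omega> i)"
  unfolding th_upd WL_H_def rel_step_def by (simp add: algebra_simps)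

lemma rel_step_bounds:
  assumes "\<theta> n \<omega> \<in> Theta d" "i \<in> {1..d}"
  shows "-1 < rel_step n \<omega> i" "rel_step n \<omega> i \<le> 1"
  using Theta_pos[OF assms(1) J_in[of "X (Suc n) \<omega>"]] Theta_less_one[OF assms(1) J_in[of "X (Suc n) \<omega>"]]
  unfolding rel_step_def by (auto simp: indicator_def)

text \<open>Used twice: with the current weights as \<open>c\<close> the right side is 0, so total
  mass is conserved; with \<open>c = ts\<close> it is the first-order decrease of the
  divergence.\<close>

lemma sum_mult_rel_step:
  assumes "\<theta> n \<omega> \<in> Theta d"
  shows "(\<Sum>i=1..d. c i * rel_step n \<omega> i)
     = c (J (X (Suc n) \<omega>)) - (\<Sum>i=1..d. c i) * \<theta> n \<omega> (J (X (Suc n) \<omega>))"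
  unfolding rel_step_def right_diff_distrib sum_subtractf sum_indicator_Xs by (simp add: sum_distrib_right)

lemma gamma_Suc: "0 \<le> \<gamma> (Suc n)" "\<gamma> (Suc n) < 1" "\<gamma> (Suc n) \<le> \<gamma> 1"
  using g_range[of "Suc n"] g_mono[of 1 "Suc n"] by auto

lemma gamma_one: "0 \<le> \<gamma> 1" "\<gamma> 1 < 1" using g_range[of 1] by auto

lemma step_factor_bounds:
  assumes "\<theta> n \<omega> \<in> Theta d" "i \<in> {1..d}"
  shows "1 - \<gamma> (Suc n) \<le> 1 + \<gamma> (Suc n) * rel_step n \<omega> i" "1 + \<gamma> (Suc n) * rel_step n \<omega> i \<le> 1 + \<gamma> (Suc n)"
  using mult_left_mono[of "-1" "rel_step n \<omega> i" "\<gamma> (Suc n)"] mult_left_mono[of "rel_step n \<omega> i" 1 "\<gamma> (Suc n)"]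
    rel_step_bounds[OF assms] gamma_Suc[of n] by auto

lemma theta_in_Theta: "\<omega> \<in> space M \<Longrightarrow> \<theta> n \<omega> \<in> Theta d"
proof (induction n)
  case 0
  then show ?case by (rule th0_Theta)
next
  case (Suc n)
  note IH = Suc.IH[OF Suc.prems]
  show ?case
  proof (rule Theta_memI)
    show "0 < \<theta> (Suc n) \<omega> i" if "i \<in> {1..d}" for i
      unfolding theta_Suc[OF Suc.prems] using step_factor_bounds[OF IH that] Theta_pos[OF IH that] gamma_Suc[of n]
      by (intro mult_pos_pos) auto
    have "(\<Sum>i=1..d. \<theta> (Suc n) \<omega> i) = (\<Sum>i=1..d. \<theta> n \<omega> i) + \<gamma> (Suc n) * (\<Sum>i=1..d. \<theta> n \<omega> i * rel_step n \<omega> i)"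
      unfolding theta_Suc[OF Suc.prems] sum_distrib_left sum.distrib[symmetric]
      by (intro sum.cong) (auto simp: algebra_simps)
    then show "(\<Sum>i=1..d. \<theta> (Suc n) \<omega> i) = 1"
      unfolding sum_mult_rel_step[OF IH] using Theta_sum[OF IH] by simp
  qed
qed

text \<open>In one step a ratio of weights changes by a factor of at most
  \<open>(1 + g) / (1 - g)\<close> with \<open>g = \<gamma> (Suc n)\<close>; this
  \<open>\<kappa>\<close> makes it at most \<open>1 + \<kappa> * g\<close> for all
  \<open>g \<le> \<gamma> 1\<close>.\<close>

definition \<kappa> where "\<kappa> = 2 / (1 - \<gamma> 1)"

lemma kappa_pos: "0 < \<kappa>" unfolding \<kappa>_def using gamma_one by simp

lemma theta_ratio_close: assumes \<omega>: "\<omega> \<in> space M" shows "ratio_close d (\<kappa> * \<gamma> (Suc n)) (\<theta> n \<omega>) (\<theta> (Suc n) \<omega>)"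
  unfolding ratio_close_def
proof (intro ballI)
  fix i j assume i: "i \<in> {1..d}" and j: "j \<in> {1..d}"
  note T = theta_in_Theta[OF \<omega>, of n]
  have "2 * \<gamma> (Suc n) \<le> \<kappa> * \<gamma> (Suc n) * (1 - \<gamma> (Suc n))"
  proof -
    have "1 - \<gamma> 1 \<noteq> 0" using gamma_one by linarith
    then have "2 = \<kappa> * (1 - \<gamma> 1)" by (metis \<kappa>_def nonzero_eq_divide_eq)
    also have "\<dots> \<le> \<kappa> * (1 - \<gamma> (Suc n))" using kappa_pos gamma_Suc[of n] by simp
    finally show ?thesis using gamma_Suc(1)[of n] mult_right_mono[of 2 "\<kappa> * (1 - \<gamma> (Suc n))" "\<gamma> (Suc n)"]
      by (simp add: mult_ac)
  qed
  then have "1 + \<gamma> (Suc n) \<le> (1 + \<kappa> * \<gamma> (Suc n)) * (1 - \<gamma> (Suc n))" by (simp add: algebra_simps)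
  also have "\<dots> \<le> (1 + \<kappa> * \<gamma> (Suc n)) * (1 + \<gamma> (Suc n) * rel_step n \<omega> j)"
    using step_factor_bounds[OF T j] kappa_pos gamma_Suc[of n] by (intro mult_left_mono) auto
  finally have "1 + \<gamma> (Suc n) * rel_step n \<omega> i \<le> (1 + \<kappa> * \<gamma> (Suc n)) * (1 + \<gamma> (Suc n) * rel_step n \<omega> j)"
    using step_factor_bounds[OF T i] by linarith
  then have "(\<theta> n \<omega> i * \<theta> n \<omega> j) * (1 + \<gamma> (Suc n) * rel_step n \<omega> i)
      \<le> (\<theta> n \<omega> i * \<theta> n \<omega> j) * ((1 + \<kappa> * \<gamma> (Suc n)) * (1 + \<gamma> (Suc n) * rel_step n \<omega> j))"
    using Theta_pos[OF T i] Theta_pos[OF T j] by (intro mult_left_mono) auto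
  then show "\<theta> (Suc n) \<omega> i * \<theta> n \<omega> j \<le> (1 + \<kappa> * \<gamma> (Suc n)) * (\<theta> n \<omega> i * \<theta> (Suc n) \<omega> j)"
    unfolding theta_Suc[OF \<omega>] by (simp only: mult_ac)
qed

text \<open>The sigma-algebra of \<open>filt_sets\<close> as a measure space, so that measurability
  of functions and product sigma-algebras can be expressed with it.\<close>

definition Filt where "Filt n = sigma (space M)
     ({X k -` B \<inter> space M | k B. k \<le> n \<and> B \<in> sets borel}
      \<union> {(\<lambda>\<omega>. \<theta> 0 \<omega> i) -` B \<inter> space M | i B. i \<in> {1..d} \<and> B \<in> sets (borel :: real measure)})"

lemma space_Filt [simp]: "space (Filt n) = space M"
  by (simp add: Filt_def space_measure_of_conv)

lemma sets_Filt: "sets (Filt n) = filt_sets M d X \<theta> n"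
  unfolding Filt_def filt_sets_def by (rule sets_measure_of) blast

lemma subalgebra_Filt: "subalgebra M (Filt n)"
  unfolding subalgebra_def sets_Filt filt_sets_def
  using th0_meas X_meas by (auto intro!: sets.sigma_sets_subset measurable_sets)

lemma Filt_mono: "sets (Filt n) \<subseteq> sets (Filt (Suc n))"
  unfolding sets_Filt filt_sets_def by (intro sigma_sets_mono' Un_mono) (blast intro: le_SucI)+

lemma X_Filt: "k \<le> n \<Longrightarrow> X k \<in> borel_measurable (Filt n)"
  unfolding measurable_def sets_Filt filt_sets_def by (auto intro!: sigma_sets.Basic)

lemma Filt_le: "i \<le> j \<Longrightarrow> f \<in> borel_measurable (Filt i) \<Longrightarrow> f \<in> borel_measurable (Filt j)"
  using lift_Suc_mono_le[of "\<lambda>n. sets (Filt n)" i j, OF Filt_mono] by (auto simp: measurable_def)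

lemma Filt_M: "f \<in> borel_measurable (Filt n) \<Longrightarrow> f \<in> borel_measurable M"
  using measurable_from_subalg[OF subalgebra_Filt] by blast

lemma theta_Filt: "i \<in> {1..d} \<Longrightarrow> (\<lambda>\<omega>. \<theta> n \<omega> i) \<in> borel_measurable (Filt n)"
proof (induction n arbitrary: i)
  case 0
  then show ?case
    unfolding measurable_def sets_Filt filt_sets_def by (auto intro!: sigma_sets.Basic)
next
  case (Suc n)
  have t: "(\<lambda>\<omega>. \<theta> n \<omega> j) \<in> borel_measurable (Filt (Suc n))" if "j \<in> {1..d}" for j
    using Filt_le[OF _ Suc.IH[OF that]] by simp
  have x: "(\<lambda>\<omega>. indicator (Xs j) (X (Suc n) \<omega>) :: real) \<in> borel_measurable (Filt (Suc n))" if "j \<in> {1..d}" for j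
    using measurable_compose[OF X_Filt[OF order_refl] borel_measurable_indicator[OF Xs_meas[OF that]]] .
  \<comment> \<open>The update reads a random coordinate of a random vector; a finite sum over
    strata replaces this evaluation by measurable products.\<close>
  have "(\<lambda>\<omega>. \<theta> n \<omega> i * (1 + \<gamma> (Suc n) * (indicator (Xs i) (X (Suc n) \<omega>)
      - (\<Sum>j=1..d. \<theta> n \<omega> j * indicator (Xs j) (X (Suc n) \<omega>))))) \<in> borel_measurable (Filt (Suc n))"
    using Suc.prems
    by (intro borel_measurable_times borel_measurable_add borel_measurable_diff borel_measurable_sum
        borel_measurable_const t x) auto
  then show ?case
    by (rule measurable_cong[THEN iffD2, rotated]) (simp only: space_Filt theta_Suc rel_step_def sum_indicator_Xs)
qed

lemma theta_meas: "i \<in> {1..d} \<Longrightarrow> (\<lambda>\<omega>. \<theta> n \<omega> i) \<in> borel_measurable M"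
  by (rule Filt_M[OF theta_Filt])

text \<open>The transition kernel on extended nonnegative functions of the past and the next state: monotone
  convergence then extends the conditional law from rectangles to all product-measurable functions.\<close>
definition nn_Op where "nn_Op n G \<omega> = (\<integral>\<^sup>+y. ennreal (acc (\<theta> n \<omega>) (X n \<omega>) y) * G (\<omega>, y) \<partial>lam)
    + ennreal (rej (\<theta> n \<omega>) (X n \<omega>)) * G (\<omega>, X n \<omega>)"

lemma acc_Filt: "(\<lambda>z. acc (\<theta> n (fst z)) (X n (fst z)) (snd z)) \<in> borel_measurable (Filt n \<Otimes>\<^sub>M borel)"
proof -
  have "(\<lambda>z. ((fst z, X n (fst z)), snd z)) \<in> measurable (Filt n \<Otimes>\<^sub>M borel) ((Filt n \<Otimes>\<^sub>M borel) \<Otimes>\<^sub>M borel)"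
    using X_Filt[OF order_refl, of n] by measurable
  from measurable_compose[OF this acc_joint_meas[of "\<theta> n" "Filt n", OF theta_Filt]]
  show ?thesis by simp
qed

lemma measurable_Filt_lam: "borel_measurable (Filt n \<Otimes>\<^sub>M lam) = borel_measurable (Filt n \<Otimes>\<^sub>M borel)"
  by (intro ext measurable_cong_sets sets_pair_measure_cong) (auto simp: lam_sets)

lemma rej_Filt: "(\<lambda>\<omega>. rej (\<theta> n \<omega>) (X n \<omega>)) \<in> borel_measurable (Filt n)"
  unfolding rej_def using acc_Filt[of n]
  by (intro borel_measurable_diff borel_measurable_const lam.borel_measurable_lebesgue_integral)
     (simp add: measurable_Filt_lam case_prod_beta')

lemma nn_Op_meas:
  assumes G: "G \<in> borel_measurable (Filt n \<Otimes>\<^sub>M borel)"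
  shows "nn_Op n G \<in> borel_measurable (Filt n)"
proof -
  have "(\<lambda>\<omega>. \<integral>\<^sup>+y. ennreal (acc (\<theta> n \<omega>) (X n \<omega>) y) * G (\<omega>, y) \<partial>lam) \<in> borel_measurable (Filt n)"
    using acc_Filt[of n] G
    by (intro lam.borel_measurable_nn_integral) (simp add: measurable_Filt_lam case_prod_beta')
  moreover have "(\<lambda>\<omega>. G (\<omega>, X n \<omega>)) \<in> borel_measurable (Filt n)"
    using measurable_compose[OF measurable_Pair[OF measurable_ident X_Filt[OF order_refl]] G] by (simp add: id_def)
  moreover note rej_Filt[of n]
  ultimately show ?thesis unfolding nn_Op_def[abs_def] by measurable
qed

lemma section_measurable: "G \<in> borel_measurable (Filt n \<Otimes>\<^sub>M borel) \<Longrightarrow> \<omega> \<in> space M \<Longrightarrow> (\<lambda>y. G (\<omega>, y)) \<in> borel_measurable lam"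
  unfolding measurable_lam by (rule measurable_Pair2[of _ "Filt n"]) auto

lemma compose_X_measurable: "G \<in> borel_measurable (Filt n \<Otimes>\<^sub>M borel) \<Longrightarrow> (\<lambda>\<omega>. G (\<omega>, X (Suc n) \<omega>)) \<in> borel_measurable M"
proof -
  assume G: "G \<in> borel_measurable (Filt n \<Otimes>\<^sub>M borel)"
  have "(\<lambda>\<omega>. (\<omega>, X (Suc n) \<omega>)) \<in> measurable M (Filt n \<Otimes>\<^sub>M borel)"
    using measurable_from_subalg[OF subalgebra_Filt measurable_ident] by (intro measurable_Pair) (auto simp: id_def)
  from measurable_compose[OF this G] show ?thesis .
qed

lemma acc_section_lam [measurable]: "acc t x \<in> borel_measurable lam" by (simp add: measurable_lam)

lemma nn_Op_cong: "\<omega> \<in> space M \<Longrightarrow> (\<And>y. G (\<omega>, y) = H (\<omega>, y)) \<Longrightarrow> nn_Op n G \<omega> = nn_Op n H \<omega>"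
  unfolding nn_Op_def by simp

lemma nn_Op_cmult: "G \<in> borel_measurable (Filt n \<Otimes>\<^sub>M borel) \<Longrightarrow> \<omega> \<in> space M \<Longrightarrow> nn_Op n (\<lambda>z. c * G z) \<omega> = c * nn_Op n G \<omega>"
  using section_measurable[of G n \<omega>] unfolding nn_Op_def distrib_left
  by (subst nn_integral_cmult[symmetric]) (auto simp: mult_ac)

lemma nn_Op_add: "G \<in> borel_measurable (Filt n \<Otimes>\<^sub>M borel) \<Longrightarrow> H \<in> borel_measurable (Filt n \<Otimes>\<^sub>M borel) \<Longrightarrow>
   \<omega> \<in> space M \<Longrightarrow> nn_Op n (\<lambda>z. G z + H z) \<omega> = nn_Op n G \<omega> + nn_Op n H \<omega>"
  using section_measurable[of G n \<omega>] section_measurable[of H n \<omega>] unfolding nn_Op_def distrib_left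
  by (subst nn_integral_add) (auto simp: ac_simps)

lemma nn_Op_SUP:
  assumes U: "\<And>i. U i \<in> borel_measurable (Filt n \<Otimes>\<^sub>M borel)" and inc: "incseq U" and \<omega>: "\<omega> \<in> space M"
  shows "nn_Op n (\<lambda>z. SUP i. U i z) \<omega> = (SUP i. nn_Op n (U i) \<omega>)"
proof -
  have UL [measurable]: "(\<lambda>y. U i (\<omega>, y)) \<in> borel_measurable lam" for i by (rule section_measurable[OF U \<omega>])
  have mono: "U i z \<le> U j z" if "i \<le> j" for i j z using inc that unfolding incseq_def le_fun_def by blast
  have "(\<integral>\<^sup>+y. ennreal (acc (\<theta> n \<omega>) (X n \<omega>) y) * (SUP i. U i (\<omega>, y)) \<partial>lam)
      = (SUP i. \<integral>\<^sup>+y. ennreal (acc (\<theta> n \<omega>) (X n \<omega>) y) * U i (\<omega>, y) \<partial>lam)"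
    unfolding SUP_mult_left_ennreal
    by (intro nn_integral_monotone_convergence_SUP) (auto simp: incseq_def le_fun_def intro!: mult_left_mono mono)
  then show ?thesis unfolding nn_Op_def SUP_mult_left_ennreal
    by (subst ennreal_SUP_add) (auto simp: incseq_def intro!: nn_integral_mono mult_left_mono mono)
qed

lemma nn_Op_1: assumes "\<omega> \<in> space M" shows "nn_Op n (\<lambda>_. 1) \<omega> = 1"
proof -
  note T = theta_in_Theta[OF assms, of n]
  have "(\<integral>\<^sup>+y. ennreal (acc (\<theta> n \<omega>) (X n \<omega>) y) \<partial>lam) = ennreal (\<integral>y. acc (\<theta> n \<omega>) (X n \<omega>) y \<partial>lam)"
    by (intro nn_integral_eq_integral acc_int[OF T] AE_I2 acc_nonneg[OF T])
  then show ?thesis unfolding nn_Op_def using rej_01[OF T, of "X n \<omega>"] acc_nonneg[OF T]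
    by (simp add: rej_def ennreal_plus[symmetric] del: ennreal_plus)
qed

lemma nn_Op_rectangle:
  assumes \<omega>: "\<omega> \<in> space M" and B: "B \<in> sets borel"
  shows "nn_Op n (indicator (A \<times> B)) \<omega> = indicator A \<omega> * ennreal (MH_kernel lam p d Xs q (\<theta> n \<omega>) (X n \<omega>) B)"
proof -
  note T = theta_in_Theta[OF \<omega>, of n]
  have Bb: "(indicator B :: 'a \<Rightarrow> real) \<in> bdd_borel 1" using B by (auto simp: bdd_borel_def indicator_def)
  have ind: "indicator (A \<times> B) (\<omega>, y) = (indicator A \<omega> * ennreal (indicator B y))" for y
    by (simp add: indicator_def)
  have "(\<integral>\<^sup>+y. ennreal (acc (\<theta> n \<omega>) (X n \<omega>) y) * ennreal (indicator B y) \<partial>lam)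
      = ennreal (\<integral>y. acc (\<theta> n \<omega>) (X n \<omega>) y * indicator B y \<partial>lam)"
    using acc_nonneg[OF T] integrable_mult_bdd[OF acc_int[OF T] Bb]
    by (simp add: ennreal_mult'[symmetric] nn_integral_eq_integral)
  moreover have "MH_kernel lam p d Xs q (\<theta> n \<omega>) (X n \<omega>) B
      = (\<integral>y. acc (\<theta> n \<omega>) (X n \<omega>) y * indicator B y \<partial>lam) + rej (\<theta> n \<omega>) (X n \<omega>) * indicator B (X n \<omega>)"
    unfolding MH_kernel_def rej_def acc_def by (simp add: mult_ac)
  moreover have "0 \<le> (\<integral>y. acc (\<theta> n \<omega>) (X n \<omega>) y * indicator B y \<partial>lam)"
    using acc_nonneg[OF T] by (intro integral_nonneg_AE AE_I2) auto
  moreover have "nn_Op n (indicator (A \<times> B)) \<omega> = indicator A \<omega> * ((\<integral>\<^sup>+y. ennreal (acc (\<theta> n \<omega>) (X n \<omega>) y) * ennreal (indicator B y) \<partial>lam)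
      + ennreal (rej (\<theta> n \<omega>) (X n \<omega>)) * ennreal (indicator B (X n \<omega>)))"
    unfolding nn_Op_def ind by (simp add: indicator_def distrib_left)
  ultimately show ?thesis using rej_01[OF T]
    by (simp add: ennreal_plus ennreal_mult')
qed

text \<open>A Dynkin argument: rectangles are stable under intersection and generate the product
  sigma-algebra, and on them the claim is \<open>X_cond\<close>. Complements use that the kernel has
  mass 1 and that the cancelled integral is finite.\<close>

lemma transition_sets:
  assumes E: "E \<in> sets (Filt n \<Otimes>\<^sub>M borel)"
  shows "(\<integral>\<^sup>+\<omega>. indicator E (\<omega>, X (Suc n) \<omega>) \<partial>M) = (\<integral>\<^sup>+\<omega>. nn_Op n (indicator E) \<omega> \<partial>M)"
proof -
  let ?G = "{a \<times> b | a b. a \<in> sets (Filt n) \<and> b \<in> sets (borel :: 'a measure)}"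
  let ?\<Omega> = "space (Filt n) \<times> space (borel :: 'a measure)"
  have sG: "sets (Filt n \<Otimes>\<^sub>M borel) = sigma_sets ?\<Omega> ?G" by (rule sets_pair_measure)
  have "E \<in> sigma_sets ?\<Omega> ?G" using E by (simp only: sG)
  with Int_stable_pair_measure_generator pair_measure_closed show ?thesis
  proof (induction rule: sigma_sets_induct_disjoint)
    case (basic E)
    then obtain A B where AB: "E = A \<times> B" "A \<in> sets (Filt n)" "B \<in> sets (borel :: 'a measure)" by blast
    have AM: "A \<in> sets M" using AB(2) subalgebra_Filt by (auto simp: subalgebra_def)
    have "(\<integral>\<^sup>+\<omega>. indicator E (\<omega>, X (Suc n) \<omega>) \<partial>M) = (\<integral>\<^sup>+\<omega>. indicator (A \<inter> {\<omega>\<in>space M. X (Suc n) \<omega> \<in> B}) \<omega> \<partial>M)"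
      by (intro nn_integral_cong) (auto simp: AB(1) indicator_def)
    also have "\<dots> = emeasure M (A \<inter> {\<omega>\<in>space M. X (Suc n) \<omega> \<in> B})"
      by (intro nn_integral_indicator sets.Int AM) (use AB(3) in measurable)
    also have "\<dots> = (\<integral>\<^sup>+\<omega>. nn_Op n (indicator E) \<omega> \<partial>M)"
      unfolding X_cond[OF AB(2)[unfolded sets_Filt] AB(3)] AB(1)
      by (intro nn_integral_cong) (simp add: nn_Op_rectangle AB(3))
    finally show ?case .
  next
    case empty
    then show ?case by (simp add: nn_Op_def)
  next
    case (compl E)
    have EM: "E \<in> sets (Filt n \<Otimes>\<^sub>M borel)" using compl(1) by (simp only: sG)
    then have CM: "?\<Omega> - E \<in> sets (Filt n \<Otimes>\<^sub>M borel)" using sets.compl_sets by (fastforce simp: space_pair_measure)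
    have iE: "indicator E \<in> borel_measurable (Filt n \<Otimes>\<^sub>M borel)"
      "(indicator (?\<Omega> - E) :: _ \<Rightarrow> ennreal) \<in> borel_measurable (Filt n \<Otimes>\<^sub>M borel)"
      using EM CM by auto
    have one: "indicator (?\<Omega> - E) (\<omega>, y) + indicator E (\<omega>, y) = (1::ennreal)" if "\<omega> \<in> space M" for \<omega> y
      using that by (auto simp: indicator_def)
    have "(\<integral>\<^sup>+\<omega>. indicator (?\<Omega> - E) (\<omega>, X (Suc n) \<omega>) \<partial>M) + (\<integral>\<^sup>+\<omega>. indicator E (\<omega>, X (Suc n) \<omega>) \<partial>M)
        = (\<integral>\<^sup>+\<omega>. indicator (?\<Omega> - E) (\<omega>, X (Suc n) \<omega>) + indicator E (\<omega>, X (Suc n) \<omega>) \<partial>M)"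
      by (intro nn_integral_add[symmetric] compose_X_measurable iE)
    also have "\<dots> = (\<integral>\<^sup>+\<omega>. nn_Op n (indicator (?\<Omega> - E)) \<omega> + nn_Op n (indicator E) \<omega> \<partial>M)"
    proof (rule nn_integral_cong)
      fix \<omega> assume \<omega>: "\<omega> \<in> space M"
      have "nn_Op n (indicator (?\<Omega> - E)) \<omega> + nn_Op n (indicator E) \<omega> = nn_Op n (\<lambda>_. 1) \<omega>"
        unfolding nn_Op_add[OF iE(2,1) \<omega>, symmetric] by (rule nn_Op_cong[OF \<omega>]) (rule one[OF \<omega>])
      then show "indicator (?\<Omega> - E) (\<omega>, X (Suc n) \<omega>) + indicator E (\<omega>, X (Suc n) \<omega>)
          = nn_Op n (indicator (?\<Omega> - E)) \<omega> + nn_Op n (indicator E) \<omega>"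
        by (simp only: one[OF \<omega>] nn_Op_1[OF \<omega>])
    qed
    also have "\<dots> = (\<integral>\<^sup>+\<omega>. nn_Op n (indicator (?\<Omega> - E)) \<omega> \<partial>M) + (\<integral>\<^sup>+\<omega>. nn_Op n (indicator E) \<omega> \<partial>M)"
      by (intro nn_integral_add Filt_M[OF nn_Op_meas] iE)
    finally have eq: "(\<integral>\<^sup>+\<omega>. indicator E (\<omega>, X (Suc n) \<omega>) \<partial>M) + (\<integral>\<^sup>+\<omega>. indicator (?\<Omega> - E) (\<omega>, X (Suc n) \<omega>) \<partial>M)
        = (\<integral>\<^sup>+\<omega>. indicator E (\<omega>, X (Suc n) \<omega>) \<partial>M) + (\<integral>\<^sup>+\<omega>. nn_Op n (indicator (?\<Omega> - E)) \<omega> \<partial>M)"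
      by (simp only: compl.IH add.commute)
    have "(\<integral>\<^sup>+\<omega>. indicator E (\<omega>, X (Suc n) \<omega>) \<partial>M) \<le> (\<integral>\<^sup>+\<omega>. 1 \<partial>M)"
      by (intro nn_integral_mono) (auto simp: indicator_def)
    then have "(\<integral>\<^sup>+\<omega>. indicator E (\<omega>, X (Suc n) \<omega>) \<partial>M) \<noteq> \<top>"
      by (auto simp: emeasure_space_1 top_unique)
    with eq show ?case by (simp add: ennreal_add_left_cancel)
  next
    case (union E)
    have EM: "E i \<in> sets (Filt n \<Otimes>\<^sub>M borel)" for i using union.hyps(2) unfolding sG by blast
    have UE: "indicator (\<Union>i. E i) z = (\<Sum>i. indicator (E i) z :: ennreal)" for z
      using union.hyps(1) by (rule suminf_indicator[symmetric])
    have "(\<integral>\<^sup>+\<omega>. indicator (\<Union>i. E i) (\<omega>, X (Suc n) \<omega>) \<partial>M) = (\<Sum>i. \<integral>\<^sup>+\<omega>. indicator (E i) (\<omega>, X (Suc n) \<omega>) \<partial>M)"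
      unfolding UE by (intro nn_integral_suminf compose_X_measurable borel_measurable_indicator EM)
    also have "\<dots> = (\<Sum>i. \<integral>\<^sup>+\<omega>. nn_Op n (indicator (E i)) \<omega> \<partial>M)" by (simp only: union.IH)
    also have "\<dots> = (\<integral>\<^sup>+\<omega>. (\<Sum>i. nn_Op n (indicator (E i)) \<omega>) \<partial>M)"
      by (intro nn_integral_suminf[symmetric] Filt_M[OF nn_Op_meas] borel_measurable_indicator EM)
    also have "\<dots> = (\<integral>\<^sup>+\<omega>. nn_Op n (indicator (\<Union>i. E i)) \<omega> \<partial>M)"
    proof (rule nn_integral_cong)
      fix \<omega> assume \<omega>: "\<omega> \<in> space M"
      have [measurable]: "(\<lambda>y. indicator (E i) (\<omega>, y) :: ennreal) \<in> borel_measurable lam" for i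
        by (intro section_measurable[of _ n, OF _ \<omega>] borel_measurable_indicator EM)
      show "(\<Sum>i. nn_Op n (indicator (E i)) \<omega>) = nn_Op n (indicator (\<Union>i. E i)) \<omega>"
        unfolding nn_Op_def UE ennreal_suminf_cmult[symmetric]
        by (subst nn_integral_suminf) (auto simp: suminf_add simp del: ennreal_suminf_cmult)
    qed
    finally show ?case .
  qed
qed

lemma transition_nn:
  assumes G: "G \<in> borel_measurable (Filt n \<Otimes>\<^sub>M borel)"
  shows "(\<integral>\<^sup>+\<omega>. G (\<omega>, X (Suc n) \<omega>) \<partial>M) = (\<integral>\<^sup>+\<omega>. nn_Op n G \<omega> \<partial>M)"
  using G
proof (induction rule: borel_measurable_induct)
  case (cong f g)
  have fg: "f (\<omega>, y) = g (\<omega>, y)" if "\<omega> \<in> space M" for \<omega> y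
    using that by (intro cong.hyps(3)) (simp add: space_pair_measure)
  have "(\<integral>\<^sup>+\<omega>. f (\<omega>, X (Suc n) \<omega>) \<partial>M) = (\<integral>\<^sup>+\<omega>. g (\<omega>, X (Suc n) \<omega>) \<partial>M)"
    by (intro nn_integral_cong fg)
  also have "\<dots> = (\<integral>\<^sup>+\<omega>. nn_Op n f \<omega> \<partial>M)"
    unfolding cong.IH by (intro nn_integral_cong nn_Op_cong fg[symmetric])
  finally show ?case .
next
  case (set A)
  then show ?case by (rule transition_sets)
next
  case (mult u c)
  have "(\<integral>\<^sup>+\<omega>. c * u (\<omega>, X (Suc n) \<omega>) \<partial>M) = c * (\<integral>\<^sup>+\<omega>. nn_Op n u \<omega> \<partial>M)"
    unfolding mult.IH[symmetric] by (intro nn_integral_cmult compose_X_measurable mult.hyps(2))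
  also have "\<dots> = (\<integral>\<^sup>+\<omega>. c * nn_Op n u \<omega> \<partial>M)"
    by (intro nn_integral_cmult[symmetric] Filt_M[OF nn_Op_meas] mult.hyps(2))
  also have "\<dots> = (\<integral>\<^sup>+\<omega>. nn_Op n (\<lambda>z. c * u z) \<omega> \<partial>M)"
    by (intro nn_integral_cong nn_Op_cmult[symmetric] mult.hyps(2))
  finally show ?case .
next
  case (add u v)
  have "(\<integral>\<^sup>+\<omega>. v (\<omega>, X (Suc n) \<omega>) + u (\<omega>, X (Suc n) \<omega>) \<partial>M) = (\<integral>\<^sup>+\<omega>. nn_Op n v \<omega> \<partial>M) + (\<integral>\<^sup>+\<omega>. nn_Op n u \<omega> \<partial>M)"
    unfolding add.IH[symmetric] by (intro nn_integral_add compose_X_measurable add.hyps)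
  also have "\<dots> = (\<integral>\<^sup>+\<omega>. nn_Op n v \<omega> + nn_Op n u \<omega> \<partial>M)"
    by (intro nn_integral_add[symmetric] Filt_M[OF nn_Op_meas] add.hyps)
  also have "\<dots> = (\<integral>\<^sup>+\<omega>. nn_Op n (\<lambda>z. v z + u z) \<omega> \<partial>M)"
    by (intro nn_integral_cong nn_Op_add[symmetric] add.hyps)
  finally show ?case .
next
  case (seq U)
  have mono: "U i z \<le> U j z" if "i \<le> j" for i j z using seq.hyps(3) that unfolding incseq_def le_fun_def by blast
  have "(\<integral>\<^sup>+\<omega>. (SUP i. U i (\<omega>, X (Suc n) \<omega>)) \<partial>M) = (SUP i. \<integral>\<^sup>+\<omega>. nn_Op n (U i) \<omega> \<partial>M)"
    unfolding seq.IH[symmetric]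
    by (intro nn_integral_monotone_convergence_SUP compose_X_measurable seq.hyps(1)) (auto simp: incseq_def le_fun_def intro: mono)
  also have "\<dots> = (\<integral>\<^sup>+\<omega>. (SUP i. nn_Op n (U i) \<omega>) \<partial>M)"
    by (intro nn_integral_monotone_convergence_SUP[symmetric] Filt_M[OF nn_Op_meas] seq.hyps(1))
       (auto simp: incseq_def le_fun_def nn_Op_def intro!: add_mono nn_integral_mono mult_left_mono mono)
  also have "\<dots> = (\<integral>\<^sup>+\<omega>. nn_Op n (\<lambda>z. SUP i. U i z) \<omega> \<partial>M)"
    by (intro nn_integral_cong nn_Op_SUP[symmetric] seq.hyps)
  finally show ?case by (simp add: image_comp SUP_apply[abs_def])
qed

text \<open>Adding the constant \<open>B\<close> makes the function nonnegative; the kernel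
  preserves constants, so the shift can be removed afterwards.\<close>

lemma transition_real:
  assumes G: "(\<lambda>(\<omega>, y). G \<omega> y) \<in> borel_measurable (Filt n \<Otimes>\<^sub>M borel)"
    and B: "\<And>\<omega> y. \<omega> \<in> space M \<Longrightarrow> \<bar>G \<omega> y\<bar> \<le> B"
  shows "(\<integral>\<omega>. G \<omega> (X (Suc n) \<omega>) \<partial>M) = (\<integral>\<omega>. Op 0 (\<theta> n \<omega>) (G \<omega>) (X n \<omega>) \<partial>M)"
    and "(\<lambda>\<omega>. G \<omega> (X (Suc n) \<omega>)) \<in> borel_measurable M"
    and "(\<lambda>\<omega>. Op 0 (\<theta> n \<omega>) (G \<omega>) (X n \<omega>)) \<in> borel_measurable (Filt n)"
proof -
  have Gb: "G \<omega> \<in> bdd_borel B" if "\<omega> \<in> space M" for \<omega>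
    using measurable_Pair2[OF G, of \<omega>] B that by (auto simp: bdd_borel_def)
  define H where "H = (\<lambda>(\<omega>, y). ennreal (G \<omega> y + B))"
  have H: "H \<in> borel_measurable (Filt n \<Otimes>\<^sub>M borel)"
    using G unfolding H_def case_prod_beta' by measurable
  have pos: "0 \<le> G \<omega> y + B" if "\<omega> \<in> space M" for \<omega> y using B[OF that, of y] by linarith
  show 2: "(\<lambda>\<omega>. G \<omega> (X (Suc n) \<omega>)) \<in> borel_measurable M"
    using compose_X_measurable[OF G] by simp
  show 3: "(\<lambda>\<omega>. Op 0 (\<theta> n \<omega>) (G \<omega>) (X n \<omega>)) \<in> borel_measurable (Filt n)"
    using measurable_compose[OF _ Op_joint_meas[of "\<theta> n" "Filt n" G 0, OF theta_Filt G], of "\<lambda>\<omega>. (\<omega>, X n \<omega>)" "Filt n"] X_Filt[OF order_refl, of n]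
    by simp
  have nn_Op_H: "nn_Op n H \<omega> = ennreal (Op 0 (\<theta> n \<omega>) (G \<omega>) (X n \<omega>) + B)"
    and OB: "\<bar>Op 0 (\<theta> n \<omega>) (G \<omega>) (X n \<omega>)\<bar> \<le> B" if \<omega>: "\<omega> \<in> space M" for \<omega>
  proof -
    note T = theta_in_Theta[OF \<omega>, of n]
    let ?a = "acc (\<theta> n \<omega>) (X n \<omega>)" and ?r = "rej (\<theta> n \<omega>) (X n \<omega>)"
    have i: "integrable lam (\<lambda>y. ?a y * G \<omega> y)" "integrable lam ?a"
      using integrable_mult_bdd[OF acc_int[OF T] Gb[OF \<omega>]] acc_int[OF T] by auto
    then have i': "integrable lam (\<lambda>y. ?a y * (G \<omega> y + B))" by (simp add: distrib_left)
    have "(\<integral>\<^sup>+y. ennreal (?a y) * H (\<omega>, y) \<partial>lam) = (\<integral>\<^sup>+y. ennreal (?a y * (G \<omega> y + B)) \<partial>lam)"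
      using acc_nonneg[OF T] by (simp add: H_def ennreal_mult')
    also have "\<dots> = ennreal (\<integral>y. ?a y * (G \<omega> y + B) \<partial>lam)"
      using acc_nonneg[OF T] pos[OF \<omega>] by (intro nn_integral_eq_integral i' AE_I2) auto
    also have "(\<integral>y. ?a y * (G \<omega> y + B) \<partial>lam) = (\<integral>y. ?a y * G \<omega> y \<partial>lam) + (1 - ?r) * B"
      using i by (simp add: distrib_left rej_def)
    finally have 1: "(\<integral>\<^sup>+y. ennreal (?a y) * H (\<omega>, y) \<partial>lam) = ennreal ((\<integral>y. ?a y * G \<omega> y \<partial>lam) + (1 - ?r) * B)" .
    have 2: "ennreal ?r * H (\<omega>, X n \<omega>) = ennreal (?r * (G \<omega> (X n \<omega>) + B))"
      using rej_01[OF T] by (simp add: H_def ennreal_mult')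
    have "0 \<le> (\<integral>y. ?a y * (G \<omega> y + B) \<partial>lam)"
      using acc_nonneg[OF T] pos[OF \<omega>] by (intro integral_nonneg_AE AE_I2) auto
    then have 3: "0 \<le> (\<integral>y. ?a y * G \<omega> y \<partial>lam) + (1 - ?r) * B"
      using i by (simp add: distrib_left rej_def)
    have "nn_Op n H \<omega> = ennreal ((\<integral>y. ?a y * G \<omega> y \<partial>lam) + (1 - ?r) * B + ?r * (G \<omega> (X n \<omega>) + B))"
      unfolding nn_Op_def 1 2 using 3 rej_01[OF T] pos[OF \<omega>] by (intro ennreal_plus[symmetric]) auto
    then show "nn_Op n H \<omega> = ennreal (Op 0 (\<theta> n \<omega>) (G \<omega>) (X n \<omega>) + B)"
      by (simp add: Op_def algebra_simps)
    show "\<bar>Op 0 (\<theta> n \<omega>) (G \<omega>) (X n \<omega>)\<bar> \<le> B"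
      using Op_bound[OF T Gb[OF \<omega>], of 0] rho_pos by simp
  qed
  have int1: "integrable M (\<lambda>\<omega>. G \<omega> (X (Suc n) \<omega>))"
    using 2 B by (intro integrable_const_bound[where B=B] AE_I2) auto
  have int2: "integrable M (\<lambda>\<omega>. Op 0 (\<theta> n \<omega>) (G \<omega>) (X n \<omega>))"
    using Filt_M[OF 3] OB by (intro integrable_const_bound[where B=B] AE_I2) auto
  have "ennreal (\<integral>\<omega>. G \<omega> (X (Suc n) \<omega>) + B \<partial>M) = (\<integral>\<^sup>+\<omega>. ennreal (G \<omega> (X (Suc n) \<omega>) + B) \<partial>M)"
    using int1 pos by (intro nn_integral_eq_integral[symmetric] AE_I2) auto
  also have "\<dots> = (\<integral>\<^sup>+\<omega>. nn_Op n H \<omega> \<partial>M)" using transition_nn[OF H] by (simp add: H_def)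
  also have "\<dots> = (\<integral>\<^sup>+\<omega>. ennreal (Op 0 (\<theta> n \<omega>) (G \<omega>) (X n \<omega>) + B) \<partial>M)"
    by (intro nn_integral_cong nn_Op_H)
  also have "\<dots> = ennreal (\<integral>\<omega>. Op 0 (\<theta> n \<omega>) (G \<omega>) (X n \<omega>) + B \<partial>M)"
    using int2 OB by (intro nn_integral_eq_integral AE_I2) (auto simp: abs_le_iff, smt (verit))
  finally have "(\<integral>\<omega>. G \<omega> (X (Suc n) \<omega>) + B \<partial>M) = (\<integral>\<omega>. Op 0 (\<theta> n \<omega>) (G \<omega>) (X n \<omega>) + B \<partial>M)"
    using pos OB by (subst (asm) ennreal_inj) (auto intro!: integral_nonneg_AE AE_I2 simp: abs_le_iff, smt (verit))
  then show "(\<integral>\<omega>. G \<omega> (X (Suc n) \<omega>) \<partial>M) = (\<integral>\<omega>. Op 0 (\<theta> n \<omega>) (G \<omega>) (X n \<omega>) \<partial>M)"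
    using int1 int2 by simp
qed

end

subsection \<open>Convergence of the bias\<close>

lemma LIMSEQ_bounded:
  fixes Y :: "nat \<Rightarrow> real"
  assumes "Y \<longlonglongrightarrow> L"
  shows "\<exists>C. \<forall>n. \<bar>Y n\<bar> \<le> C"
  using convergent_imp_Bseq[OF convergentI[OF assms]] unfolding Bseq_def real_norm_def by blast

lemma cesaro_mean_zero:
  fixes Y :: "nat \<Rightarrow> real"
  assumes "Y \<longlonglongrightarrow> 0"
  shows "(\<lambda>n. (\<Sum>k<n. Y k) / real n) \<longlonglongrightarrow> 0"
proof (rule LIMSEQ_I)
  fix r :: real assume r: "0 < r"
  obtain N where N: "\<And>n. N \<le> n \<Longrightarrow> \<bar>Y n\<bar> < r / 2"
    using LIMSEQ_D[OF assms, of "r/2"] r by auto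
  define C where "C = (\<Sum>k<N. \<bar>Y k\<bar>)"
  obtain N' :: nat where N': "2 * C / r < real N'" using reals_Archimedean2 by blast
  have "norm ((\<Sum>k<n. Y k) / real n - 0) < r" if n: "max N (Suc N') \<le> n" for n
  proof -
    have "\<bar>\<Sum>k<n. Y k\<bar> \<le> (\<Sum>k<n. \<bar>Y k\<bar>)" by (rule sum_abs)
    also have "\<dots> = C + (\<Sum>k=N..<n. \<bar>Y k\<bar>)"
      using n sum.atLeastLessThan_concat[of 0 N n "\<lambda>k. \<bar>Y k\<bar>"] by (simp add: C_def atLeast0LessThan)
    also have "(\<Sum>k=N..<n. \<bar>Y k\<bar>) \<le> (\<Sum>k=N..<n. r / 2)"
      using N by (intro sum_mono) (auto simp: less_imp_le)
    also have "\<dots> \<le> real n * (r / 2)" using r by (simp add: mult_right_mono)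
    finally have 1: "\<bar>\<Sum>k<n. Y k\<bar> \<le> C + real n * (r / 2)" by simp
    have "2 * C < real N' * r" using N' r by (simp add: pos_divide_less_eq)
    also have "\<dots> \<le> real n * r" using n r by (intro mult_right_mono) auto
    finally have "\<bar>\<Sum>k<n. Y k\<bar> < real n * r" using 1 by simp
    then show ?thesis using n by (simp add: abs_divide divide_less_eq mult.commute)
  qed
  then show "\<exists>no. \<forall>n\<ge>no. norm ((\<Sum>k<n. Y k) / real n - 0) < r" by blast
qed

lemma cesaro_mean:
  fixes Y :: "nat \<Rightarrow> real"
  assumes "Y \<longlonglongrightarrow> L"
  shows "(\<lambda>n. (\<Sum>k<n. Y k) / real n) \<longlonglongrightarrow> L"
proof -
  have "(\<lambda>n. (\<Sum>k<n. Y k - L) / real n + L) \<longlonglongrightarrow> 0 + L"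
    using assms by (intro tendsto_add tendsto_const cesaro_mean_zero) (simp add: LIM_zero_iff)
  moreover have "\<forall>\<^sub>F n in sequentially. (\<Sum>k<n. Y k - L) / real n + L = (\<Sum>k<n. Y k) / real n"
    using eventually_gt_at_top[of 0] by eventually_elim (simp add: sum_subtractf field_simps)
  ultimately show ?thesis by (simp add: tendsto_cong)
qed

text \<open>Summation by parts writes the mean of \<open>x\<close> as \<open>s n\<close> minus the
  Cesaro mean of \<open>s\<close>, where \<open>s\<close> is the sequence of partial sums of the
  weighted series; both have the same limit.\<close>

lemma kronecker_mean:
  fixes x :: "nat \<Rightarrow> real"
  assumes "summable (\<lambda>k. 1 / real (Suc k) * x k)"
  shows "(\<lambda>n. (\<Sum>k<n. x k) / real n) \<longlonglongrightarrow> 0"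
proof -
  define s where "s n = (\<Sum>k<n. 1 / real (Suc k) * x k)" for n
  have s: "s \<longlonglongrightarrow> (\<Sum>k. 1 / real (Suc k) * x k)"
    unfolding s_def[abs_def] by (rule summable_LIMSEQ[OF assms])
  have eq: "(\<Sum>k<n. x k) = real n * s n - (\<Sum>k<n. s k)" for n
  proof (induction n)
    case (Suc n)
    have "s (Suc n) = s n + 1 / real (Suc n) * x n" by (simp add: s_def)
    then have "real (Suc n) * s (Suc n) = real (Suc n) * s n + x n" by (simp add: distrib_left del: of_nat_Suc)
    then show ?case using Suc by (simp add: algebra_simps)
  qed (simp add: s_def)
  have "(\<lambda>n. s n - (\<Sum>k<n. s k) / real n) \<longlonglongrightarrow> 0"
    using tendsto_diff[OF s cesaro_mean[OF s]] by simp
  moreover have "\<forall>\<^sub>F n in sequentially. s n - (\<Sum>k<n. s k) / real n = (\<Sum>k<n. x k) / real n"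
    using eventually_gt_at_top[of 0] by eventually_elim (simp add: eq diff_divide_distrib)
  ultimately show ?thesis by (simp add: tendsto_cong)
qed

text \<open>Summation by parts moves the difference from \<open>h\<close>, which is merely bounded,
  to \<open>v\<close>, whose variation is finite.\<close>

lemma abel_summable:
  fixes v h :: "nat \<Rightarrow> real"
  assumes v: "v \<longlonglongrightarrow> 0" and dv: "summable (\<lambda>k. \<bar>v (Suc k) - v k\<bar>)" and h: "\<And>k. \<bar>h k\<bar> \<le> C"
  shows "summable (\<lambda>k. v k * (h k - h (Suc k)))"
proof -
  have "(\<lambda>k. v k * h k) \<longlonglongrightarrow> 0"
  proof (rule tendsto_0_le[OF v, of _ C])
    show "\<forall>\<^sub>F k in sequentially. norm (v k * h k) \<le> norm (v k) * C"
      using h by (intro always_eventually) (auto simp: abs_mult mult_left_mono)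
  qed
  from telescope_summable'[OF this]
  have 1: "summable (\<lambda>k. v k * h k - v (Suc k) * h (Suc k))" .
  have 2: "summable (\<lambda>k. (v (Suc k) - v k) * h (Suc k))"
    using h by (intro summable_comparison_test'[OF summable_mult2[OF dv, of C]]) (auto simp: abs_mult mult_left_mono)
  have "v k * (h k - h (Suc k)) = (v k * h k - v (Suc k) * h (Suc k)) + (v (Suc k) - v k) * h (Suc k)" for k
    by (simp add: algebra_simps)
  then show ?thesis using summable_add[OF 1 2] by simp
qed

lemma ln_one_plus_lower:
  fixes x :: real assumes "-1 < x" shows "x - x\<^sup>2 / (1 + x) \<le> ln (1 + x)"
proof -
  have "1 - 1 / (1 + x) \<le> ln (1 + x)"
    using ln_le_minus_one[of "1 / (1 + x)"] assms by (simp add: ln_div)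
  moreover have "x - x\<^sup>2 / (1 + x) = 1 - 1 / (1 + x)"
    using assms by (simp add: field_simps power2_eq_square)
  ultimately show ?thesis by simp
qed

context wl_process
begin

section \<open>Summability of the weighted noise\<close>

lemma gamma_Suc_sq: "summable (\<lambda>k. (\<gamma> (Suc k))\<^sup>2)"
  using g_sq by (subst summable_Suc_iff)

text \<open>The increments are split by the Poisson equation into a martingale difference, an Abel sum,
  and a term controlled by the variation of the parameter in one step.\<close>
lemma noise_summable:
  assumes g: "g \<in> bdd_borel B"
    and v_meas: "\<And>k. v k \<in> borel_measurable (Filt k)"
    and v_bound: "\<And>k \<omega>. \<omega> \<in> space M \<Longrightarrow> \<bar>v k \<omega>\<bar> \<le> a k"
    and a_sq: "summable (\<lambda>k. (a k)\<^sup>2)"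
    and v_var: "\<And>\<omega>. \<omega> \<in> space M \<Longrightarrow> summable (\<lambda>k. \<bar>v (Suc k) \<omega> - v k \<omega>\<bar>)"
  shows "AE \<omega> in M. summable (\<lambda>k. v k \<omega> * (g (X (Suc k) \<omega>) - piI (\<theta> k \<omega>) g))"
proof -
  have g_meas: "g \<in> borel_measurable borel" using g by (simp add: bdd_borel_def)
  define w where "w k \<omega> = poisson g (\<theta> k \<omega>)" for k \<omega>
  define h where "h k \<omega> = Op 0 (\<theta> k \<omega>) (w k \<omega>) (X k \<omega>)" for k \<omega>
  define D where "D k \<omega> = v k \<omega> * (w k \<omega> (X (Suc k) \<omega>) - h k \<omega>)" for k \<omega>
  define Bw where "Bw = B / \<rho>"
  have B0: "0 \<le> B" by (rule bdd_borel_nonneg[OF g])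
  have Bw0: "0 \<le> Bw" using B0 rho_pos by (simp add: Bw_def)
  obtain \<omega>0 where \<omega>0: "\<omega>0 \<in> space M" using not_empty by blast
  have a0: "0 \<le> a k" for k using v_bound[OF \<omega>0, of k] abs_ge_zero order_trans by blast
  have w_meas: "(\<lambda>(\<omega>, y). w k \<omega> y) \<in> borel_measurable (Filt k \<Otimes>\<^sub>M borel)" for k
    unfolding w_def by (rule poisson_joint_meas[OF theta_Filt g_meas])
  have w_bdd: "w k \<omega> \<in> bdd_borel Bw" if "\<omega> \<in> space M" for k \<omega>
    unfolding w_def Bw_def by (rule poisson_bdd[OF theta_in_Theta[OF that] g])
  then have w_le: "\<bar>w k \<omega> y\<bar> \<le> Bw" if "\<omega> \<in> space M" for k \<omega> y
    using that by (auto simp: bdd_borel_def)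
  have h_meas: "h k \<in> borel_measurable (Filt k)" for k
    unfolding h_def[abs_def] by (rule transition_real(3)[OF w_meas w_le])
  have h_le: "\<bar>h k \<omega>\<bar> \<le> Bw" if "\<omega> \<in> space M" for k \<omega>
    unfolding h_def using Op_bound[OF theta_in_Theta[OF that] w_bdd[OF that], of 0] rho_pos by simp
  have wX_meas: "(\<lambda>\<omega>. w k \<omega> (X (Suc k) \<omega>)) \<in> borel_measurable (Filt (Suc k))" for k
  proof -
    have "(\<lambda>\<omega>. \<omega>) \<in> measurable (Filt (Suc k)) (Filt k)"
      using measurable_from_subalg[OF _ measurable_ident, of "Filt (Suc k)" "Filt k"] Filt_mono[of k]
      by (simp add: subalgebra_def id_def)
    then have "(\<lambda>\<omega>. (\<omega>, X (Suc k) \<omega>)) \<in> measurable (Filt (Suc k)) (Filt k \<Otimes>\<^sub>M borel)"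
      by (intro measurable_Pair X_Filt order_refl)
    from measurable_compose[OF this w_meas] show ?thesis by simp
  qed
  have "AE \<omega> in M. summable (\<lambda>k. D k \<omega>)"
  proof (rule martingale_difference_summable[where F=Filt and c="\<lambda>k. a k * (2 * Bw)"])
    show "subalgebra M (Filt n)" for n by (rule subalgebra_Filt)
    show "sets (Filt n) \<subseteq> sets (Filt (Suc n))" for n by (rule Filt_mono)
    show "D n \<in> borel_measurable (Filt (Suc n))" for n
      unfolding D_def[abs_def]
      by (intro borel_measurable_times borel_measurable_diff wX_meas Filt_le[OF _ v_meas] Filt_le[OF _ h_meas]) auto
    show "\<bar>D n \<omega>\<bar> \<le> a n * (2 * Bw)" if "\<omega> \<in> space M" for n \<omega>
      unfolding D_def abs_mult using v_bound[OF that, of n] a0[of n] w_le[OF that, of n "X (Suc n) \<omega>"] h_le[OF that, of n]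
      by (intro mult_mono) auto
    show "summable (\<lambda>n. (a n * (2 * Bw))\<^sup>2)"
      unfolding power_mult_distrib by (rule summable_mult2[OF a_sq])
    show "(\<integral>\<omega>. Z \<omega> * D n \<omega> \<partial>M) = 0"
      if Z: "Z \<in> borel_measurable (Filt n)" and K: "\<And>\<omega>. \<omega> \<in> space M \<Longrightarrow> \<bar>Z \<omega>\<bar> \<le> K" for n Z K
    proof -
      \<comment> \<open>Both factors are known at time \<open>n\<close>, so their product can be
        pulled out of the kernel; the prediction \<open>h\<close> then cancels the mean of the next
        value.\<close>
      define u where "u \<omega> = Z \<omega> * v n \<omega>" for \<omega>
      have u_meas: "u \<in> borel_measurable (Filt n)" unfolding u_def[abs_def] by (intro borel_measurable_times Z v_meas)
      have u_le: "\<bar>u \<omega>\<bar> \<le> K * a n" if "\<omega> \<in> space M" for \<omega>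
        unfolding u_def abs_mult using K[OF that] v_bound[OF that, of n] by (intro mult_mono) auto
      define G where "G \<omega> y = u \<omega> * w n \<omega> y" for \<omega> y
      have G_meas: "(\<lambda>(\<omega>, y). G \<omega> y) \<in> borel_measurable (Filt n \<Otimes>\<^sub>M borel)"
        using w_meas[of n] measurable_compose[OF measurable_fst u_meas, of borel]
        unfolding G_def case_prod_beta' by (intro borel_measurable_times) auto
      have G_le: "\<bar>G \<omega> y\<bar> \<le> (K * a n) * Bw" if "\<omega> \<in> space M" for \<omega> y
        unfolding G_def abs_mult using u_le[OF that] w_le[OF that, of n y] by (intro mult_mono) auto
      have OpG: "Op 0 (\<theta> n \<omega>) (G \<omega>) (X n \<omega>) = u \<omega> * h n \<omega>" for \<omega>
        unfolding G_def h_def by (rule Op_cmult)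
      note c = transition_real[OF G_meas G_le, unfolded OpG]
      have i1: "integrable M (\<lambda>\<omega>. G \<omega> (X (Suc n) \<omega>))"
        using c(2) G_le by (intro integrable_const_bound[where B="(K * a n) * Bw"] AE_I2) auto
      have "\<bar>u \<omega> * h n \<omega>\<bar> \<le> (K * a n) * Bw" if "\<omega> \<in> space M" for \<omega>
        unfolding abs_mult using u_le[OF that] h_le[OF that, of n] by (intro mult_mono) auto
      then have i2: "integrable M (\<lambda>\<omega>. u \<omega> * h n \<omega>)"
        using Filt_M[OF c(3)] by (intro integrable_const_bound[where B="(K * a n) * Bw"] AE_I2) auto
      have "(\<integral>\<omega>. Z \<omega> * D n \<omega> \<partial>M) = (\<integral>\<omega>. G \<omega> (X (Suc n) \<omega>) - u \<omega> * h n \<omega> \<partial>M)"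
        unfolding D_def G_def u_def by (intro Bochner_Integration.integral_cong) (auto simp: algebra_simps)
      also have "\<dots> = 0" using i1 i2 c(1) by simp
      finally show ?thesis .
    qed
  qed
  then show ?thesis
  proof (rule AE_mp, intro AE_I2 impI)
    fix \<omega> assume \<omega>: "\<omega> \<in> space M" and D_sum: "summable (\<lambda>k. D k \<omega>)"
    \<comment> \<open>The change of the one-step prediction at the new state when the bias is
      updated. Two Poisson equations turn it into differences of solutions and of stationary means,
      both of order \<open>\<gamma> (Suc k)\<close>.\<close>
    define r where "r k = h (Suc k) \<omega> - Op 0 (\<theta> k \<omega>) (w k \<omega>) (X (Suc k) \<omega>)" for k
    have "(\<lambda>k. (a k)\<^sup>2) \<longlonglongrightarrow> 0" by (rule summable_LIMSEQ_zero[OF a_sq])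
    then have "(\<lambda>k. sqrt ((a k)\<^sup>2)) \<longlonglongrightarrow> sqrt 0" by (rule tendsto_real_sqrt)
    then have a_lim: "a \<longlonglongrightarrow> 0" using a0 by simp
    have v_lim: "(\<lambda>k. v k \<omega>) \<longlonglongrightarrow> 0"
      by (rule Lim_null_comparison[OF _ a_lim]) (use v_bound[OF \<omega>] in auto)
    have 1: "summable (\<lambda>k. v k \<omega> * (h k \<omega> - h (Suc k) \<omega>))"
      by (rule abel_summable[OF v_lim v_var[OF \<omega>] h_le[OF \<omega>]])
    define c where "c = (4 * B / \<rho>\<^sup>2 + 2 * B) * \<kappa>"
    have r_le: "\<bar>r k\<bar> \<le> c * \<gamma> (Suc k)" for k
    proof -
      note T = theta_in_Theta[OF \<omega>, of k] theta_in_Theta[OF \<omega>, of "Suc k"] and hc = theta_ratio_close[OF \<omega>, of k]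
      have e0: "0 \<le> \<kappa> * \<gamma> (Suc k)" using kappa_pos gamma_Suc[of k] by simp
      have "r k = (w (Suc k) \<omega> (X (Suc k) \<omega>) - w k \<omega> (X (Suc k) \<omega>)) + (piI (\<theta> (Suc k) \<omega>) g - piI (\<theta> k \<omega>) g)"
        using poisson_equation[OF T(1) g, of "X (Suc k) \<omega>"] poisson_equation[OF T(2) g, of "X (Suc k) \<omega>"]
        by (simp add: r_def h_def w_def)
      moreover have "\<bar>w (Suc k) \<omega> (X (Suc k) \<omega>) - w k \<omega> (X (Suc k) \<omega>)\<bar> \<le> 4 * (\<kappa> * \<gamma> (Suc k)) * B / \<rho>\<^sup>2"
        using poisson_ratio_close[OF T hc e0 g, of "X (Suc k) \<omega>"] by (simp add: w_def abs_minus_commute)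
      moreover have "\<bar>piI (\<theta> (Suc k) \<omega>) g - piI (\<theta> k \<omega>) g\<bar> \<le> 2 * (\<kappa> * \<gamma> (Suc k)) * B"
        using piI_ratio_close[OF T hc e0 g] by (simp add: abs_minus_commute)
      moreover have "4 * (\<kappa> * \<gamma> (Suc k)) * B / \<rho>\<^sup>2 + 2 * (\<kappa> * \<gamma> (Suc k)) * B = c * \<gamma> (Suc k)"
        by (simp add: c_def algebra_simps)
      ultimately show ?thesis by linarith
    qed
    have c0: "0 \<le> c" using B0 kappa_pos by (simp add: c_def)
    have 2: "summable (\<lambda>k. v k \<omega> * r k)"
    proof (rule summable_comparison_test')
      show "summable (\<lambda>k. c * ((a k)\<^sup>2 + (\<gamma> (Suc k))\<^sup>2))"
        by (intro summable_mult summable_add a_sq gamma_Suc_sq)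
      show "norm (v k \<omega> * r k) \<le> c * ((a k)\<^sup>2 + (\<gamma> (Suc k))\<^sup>2)" for k
      proof -
        have "norm (v k \<omega> * r k) \<le> a k * (c * \<gamma> (Suc k))"
          unfolding real_norm_def abs_mult using v_bound[OF \<omega>, of k] r_le[of k] a0[of k] by (intro mult_mono) auto
        also have "\<dots> = c * (a k * \<gamma> (Suc k))" by simp
        also have "\<dots> \<le> c * ((a k)\<^sup>2 + (\<gamma> (Suc k))\<^sup>2)"
          using sum_squares_bound[of "a k" "\<gamma> (Suc k)"] mult_nonneg_nonneg[OF a0 gamma_Suc(1), of k k]
          by (intro mult_left_mono c0) linarith
        finally show ?thesis .
      qed
    qed
    have "v k \<omega> * (g (X (Suc k) \<omega>) - piI (\<theta> k \<omega>) g)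
        = D k \<omega> + v k \<omega> * (h k \<omega> - h (Suc k) \<omega>) + v k \<omega> * r k" for k
      using poisson_equation[OF theta_in_Theta[OF \<omega>] g, of k "X (Suc k) \<omega>"]
      by (simp add: D_def r_def w_def flip: distrib_left)
    then show "summable (\<lambda>k. v k \<omega> * (g (X (Suc k) \<omega>) - piI (\<theta> k \<omega>) g))"
      using summable_add[OF summable_add[OF D_sum 1] 2] by simp
  qed
qed

section \<open>The relative entropy as Lyapunov function\<close>

definition KL where "KL t = (\<Sum>i=1..d. ts i * ln (ts i / t i))"

text \<open>Applying \<open>ln y \<le> y - 1\<close> to \<open>y = sqrt (t i / ts i)\<close> bounds
  the relative entropy below by a Hellinger distance. Hence it is nonnegative, and its convergence
  to 0 forces convergence of each weight.\<close>

lemma KL_hellinger: assumes t: "t \<in> Theta d" shows "(\<Sum>i=1..d. (sqrt (ts i) - sqrt (t i))\<^sup>2) \<le> KL t"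
proof -
  have i_le: "2 * ts i - 2 * sqrt (ts i) * sqrt (t i) \<le> ts i * ln (ts i / t i)" if i: "i \<in> {1..d}" for i
  proof -
    note p = ts_pos[OF i] Theta_pos[OF t i]
    have "ln (sqrt (t i / ts i)) \<le> sqrt (t i / ts i) - 1" using p by (intro ln_le_minus_one) simp
    then have "- 2 * (sqrt (t i / ts i) - 1) \<le> ln (ts i / t i)" using p by (simp add: ln_sqrt ln_div)
    then have "ts i * (- 2 * (sqrt (t i / ts i) - 1)) \<le> ts i * ln (ts i / t i)"
      using p by (intro mult_left_mono) auto
    moreover have "ts i * sqrt (t i / ts i) = sqrt (ts i) * sqrt (t i)"
    proof -
      have "ts i * sqrt (t i / ts i) = sqrt ((ts i)\<^sup>2 * (t i / ts i))"
        using p by (simp only: real_sqrt_mult real_sqrt_abs abs_of_pos)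
      also have "(ts i)\<^sup>2 * (t i / ts i) = ts i * t i" using p by (simp add: power2_eq_square)
      finally show ?thesis by (simp only: real_sqrt_mult)
    qed
    ultimately show ?thesis by (simp add: algebra_simps)
  qed
  have "(\<Sum>i=1..d. (sqrt (ts i) - sqrt (t i))\<^sup>2) = (\<Sum>i=1..d. ts i + t i - 2 * sqrt (ts i) * sqrt (t i))"
    using ts_pos Theta_pos[OF t] by (intro sum.cong) (auto simp: power2_diff less_imp_le)
  also have "\<dots> = (\<Sum>i=1..d. 2 * ts i - 2 * sqrt (ts i) * sqrt (t i))"
    by (simp add: sum.distrib sum_subtractf sum_ts Theta_sum[OF t] del: One_nat_def flip: sum_distrib_left)
  also have "\<dots> \<le> KL t" unfolding KL_def by (intro sum_mono i_le)
  finally show ?thesis .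
qed

lemma KL_nonneg: "t \<in> Theta d \<Longrightarrow> 0 \<le> KL t"
  by (rule order_trans[OF sum_nonneg KL_hellinger]) auto

definition drift where "drift t = (\<Sum>i=1..d. (ts i - t i) * piI t (indicator (Xs i)))"

text \<open>\<open>S t * drift t\<close> is the chi-square divergence of \<open>ts\<close> from
  \<open>t\<close>, and \<open>ln y \<le> y - 1\<close> with \<open>y = ts i / t i\<close> shows
  that it dominates the relative entropy.\<close>

lemma drift_ge: assumes t: "t \<in> Theta d" shows "KL t / S t \<le> drift t"
proof -
  have "KL t \<le> (\<Sum>i=1..d. ts i * (ts i / t i - 1))"
    unfolding KL_def using ts_pos Theta_pos[OF t]
    by (intro sum_mono mult_left_mono ln_le_minus_one) (auto simp: less_imp_le)
  also have "\<dots> = (\<Sum>i=1..d. (ts i - t i) * ts i / t i)"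
  proof (intro sum.cong refl)
    fix i assume "i \<in> {1..d}"
    then have "t i \<noteq> 0" using Theta_pos[OF t] by force
    then show "ts i * (ts i / t i - 1) = (ts i - t i) * ts i / t i" by (simp add: field_simps)
  qed
  finally have "KL t / S t \<le> (\<Sum>i=1..d. (ts i - t i) * ts i / t i) / S t"
    using S_pos[OF t] by (simp add: divide_right_mono)
  also have "\<dots> = drift t"
    unfolding drift_def sum_divide_distrib using piI_ind[OF t] by (intro sum.cong) auto
  finally show ?thesis .
qed

text \<open>This keeps a path of bounded divergence away from the boundary of the simplex.\<close>
lemma S_le_KL: assumes t: "t \<in> Theta d" shows "S t \<le> exp ((KL t - (\<Sum>i=1..d. ts i * ln (ts i))) / tmin)"
proof -
  let ?K = "KL t - (\<Sum>i=1..d. ts i * ln (ts i))"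
  have K: "?K = (\<Sum>i=1..d. ts i * ln (1 / t i))"
    unfolding KL_def sum_subtractf[symmetric]
  proof (intro sum.cong refl)
    fix i assume i: "i \<in> {1..d}"
    show "ts i * ln (ts i / t i) - ts i * ln (ts i) = ts i * ln (1 / t i)"
      using ts_pos[OF i] Theta_pos[OF t i] by (simp add: ln_div right_diff_distrib)
  qed
  have i_le: "1 / t i \<le> exp (?K / tmin)" if i: "i \<in> {1..d}" for i
  proof -
    have nn: "0 \<le> ln (1 / t j)" if "j \<in> {1..d}" for j
      using Theta_pos[OF t that] Theta_less_one[OF t that] by (intro ln_ge_zero) (simp add: less_imp_le)
    have "tmin * ln (1 / t i) \<le> ts i * ln (1 / t i)"
      using tmin_le[OF i] nn[OF i] by (intro mult_right_mono)
    also have "\<dots> \<le> ?K"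
      unfolding K using i nn ts_pos by (intro member_le_sum) (auto simp: less_imp_le)
    finally have "ln (1 / t i) \<le> ?K / tmin" using tmin_pos by (simp add: pos_le_divide_eq mult.commute)
    then show ?thesis using Theta_pos[OF t i] by (metis exp_le_cancel_iff exp_ln zero_less_divide_1_iff)
  qed
  have "S t \<le> (\<Sum>i=1..d. ts i * exp (?K / tmin))"
    unfolding S_def
  proof (rule sum_mono)
    fix i assume i: "i \<in> {1..d}"
    show "ts i / t i \<le> ts i * exp (?K / tmin)"
      using mult_left_mono[OF i_le[OF i], of "ts i"] ts_pos[OF i] by simp
  qed
  also have "\<dots> = exp (?K / tmin)" using sum_ts by (simp flip: sum_distrib_right)
  finally show ?thesis .
qed

text \<open>The update multiplies \<open>\<theta> i\<close> by \<open>1 + x\<close>, so the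
  divergence loses the \<open>ts\<close>-average of \<open>ln (1 + x)\<close>. The linear part of
  the logarithm gives the displayed sum; \<open>R\<close> collects \<open>x - ln (1 + x)\<close>,
  which lies between 0 and \<open>x\<^sup>2 / (1 + x)\<close>, uniformly on the simplex.\<close>

lemma KL_step:
  assumes \<omega>: "\<omega> \<in> space M"
  obtains R where "0 \<le> R" "R \<le> (\<gamma> (Suc n))\<^sup>2 / (1 - \<gamma> 1)"
    "KL (\<theta> (Suc n) \<omega>) = KL (\<theta> n \<omega>)
       - \<gamma> (Suc n) * (\<Sum>i=1..d. (ts i - \<theta> n \<omega> i) * indicator (Xs i) (X (Suc n) \<omega>)) + R"
proof -
  note T = theta_in_Theta[OF \<omega>, of n]
  let ?x = "\<lambda>i. \<gamma> (Suc n) * rel_step n \<omega> i"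
  define R where "R = (\<Sum>i=1..d. ts i * (?x i - ln (1 + ?x i)))"
  have x1: "-1 < ?x i" "1 - \<gamma> 1 \<le> 1 + ?x i" if "i \<in> {1..d}" for i
    using step_factor_bounds[OF T that] gamma_Suc[of n] by auto
  have x2: "(?x i)\<^sup>2 \<le> (\<gamma> (Suc n))\<^sup>2" if "i \<in> {1..d}" for i
  proof -
    have "\<bar>?x i\<bar> \<le> \<gamma> (Suc n)" using step_factor_bounds[OF T that] by linarith
    then show ?thesis by (metis abs_le_square_iff abs_of_nonneg gamma_Suc(1))
  qed
  have lb: "0 \<le> ?x i - ln (1 + ?x i)" if "i \<in> {1..d}" for i
    using ln_add_one_self_le_self2[OF x1(1)[OF that]] by simp
  have ub: "?x i - ln (1 + ?x i) \<le> (\<gamma> (Suc n))\<^sup>2 / (1 - \<gamma> 1)" if "i \<in> {1..d}" for i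
  proof -
    have "?x i - ln (1 + ?x i) \<le> (?x i)\<^sup>2 / (1 + ?x i)" using ln_one_plus_lower[OF x1(1)[OF that]] by simp
    also have "\<dots> \<le> (\<gamma> (Suc n))\<^sup>2 / (1 - \<gamma> 1)"
      using x1[OF that] x2[OF that] gamma_one by (intro frac_le) auto
    finally show ?thesis .
  qed
  have "0 \<le> R" unfolding R_def using lb ts_pos by (intro sum_nonneg mult_nonneg_nonneg) (auto simp: less_imp_le)
  moreover have "R \<le> (\<gamma> (Suc n))\<^sup>2 / (1 - \<gamma> 1)"
  proof -
    have "R \<le> (\<Sum>i=1..d. ts i * ((\<gamma> (Suc n))\<^sup>2 / (1 - \<gamma> 1)))"
      unfolding R_def using ub ts_pos by (intro sum_mono mult_left_mono) (auto simp: less_imp_le)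
    also have "\<dots> = (\<gamma> (Suc n))\<^sup>2 / (1 - \<gamma> 1)" using sum_ts by (simp only: sum_distrib_right[symmetric])
    finally show ?thesis .
  qed
  moreover have "KL (\<theta> (Suc n) \<omega>) = KL (\<theta> n \<omega>)
       - \<gamma> (Suc n) * (\<Sum>i=1..d. (ts i - \<theta> n \<omega> i) * indicator (Xs i) (X (Suc n) \<omega>)) + R"
  proof -
    have "(\<Sum>i=1..d. (ts i - \<theta> n \<omega> i) * indicator (Xs i) (X (Suc n) \<omega>)) = (\<Sum>i=1..d. ts i * rel_step n \<omega> i)"
      unfolding sum_mult_rel_step[OF T] sum_ts sum_indicator_Xs by simp
    moreover have "KL (\<theta> (Suc n) \<omega>) = (\<Sum>i=1..d. ts i * ln (ts i / \<theta> n \<omega> i) - ts i * ln (1 + ?x i))"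
      unfolding KL_def
    proof (rule sum.cong)
      fix i assume i: "i \<in> {1..d}"
      have "ln (ts i / \<theta> (Suc n) \<omega> i) = ln (ts i / \<theta> n \<omega> i) - ln (1 + ?x i)"
        unfolding theta_Suc[OF \<omega>] using Theta_pos[OF T i] ts_pos[OF i] x1(1)[OF i] by (simp add: ln_div ln_mult)
      then show "ts i * ln (ts i / \<theta> (Suc n) \<omega> i) = ts i * ln (ts i / \<theta> n \<omega> i) - ts i * ln (1 + ?x i)"
        by (simp add: right_diff_distrib)
    qed simp
    ultimately show ?thesis
      by (simp add: R_def KL_def sum_subtractf right_diff_distrib sum_distrib_left mult.left_commute)
  qed
  ultimately show ?thesis by (rule that)
qed

text \<open>A pathwise Robbins-Siegmund argument: once the noise series converges, the rest is
  deterministic.\<close>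

lemma theta_tendsto_path:
  assumes \<omega>: "\<omega> \<in> space M"
    and N: "\<And>i. i \<in> {1..d} \<Longrightarrow> summable (\<lambda>k. \<gamma> (Suc k) * (ts i - \<theta> k \<omega> i)
              * (indicator (Xs i) (X (Suc k) \<omega>) - piI (\<theta> k \<omega>) (indicator (Xs i))))"
    and i: "i \<in> {1..d}"
  shows "(\<lambda>n. \<theta> n \<omega> i) \<longlonglongrightarrow> ts i"
proof -
  define V where "V n = KL (\<theta> n \<omega>)" for n
  have V0: "0 \<le> V n" for n unfolding V_def by (rule KL_nonneg[OF theta_in_Theta[OF \<omega>]])
  define b where "b n = \<gamma> (Suc n) * drift (\<theta> n \<omega>)" for n
  define W where "W n = (\<Sum>i=1..d. \<gamma> (Suc n) * (ts i - \<theta> n \<omega> i)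
              * (indicator (Xs i) (X (Suc n) \<omega>) - piI (\<theta> n \<omega>) (indicator (Xs i))))" for n
  have W: "summable W" unfolding W_def[abs_def] by (rule summable_sum[OF N])
  define R where "R n = V (Suc n) - V n + W n + b n" for n
  have Wb: "W n + b n = \<gamma> (Suc n) * (\<Sum>i=1..d. (ts i - \<theta> n \<omega> i) * indicator (Xs i) (X (Suc n) \<omega>))" for n
    unfolding W_def b_def drift_def sum_distrib_left sum.distrib[symmetric] by (intro sum.cong) (auto simp: algebra_simps)
  have R_bounds: "0 \<le> R n \<and> R n \<le> (\<gamma> (Suc n))\<^sup>2 / (1 - \<gamma> 1)" for n
    using KL_step[OF \<omega>, of n] unfolding R_def V_def add.assoc Wb by (smt (verit))
  have R: "summable R"
    by (rule summable_comparison_test'[OF summable_divide[OF gamma_Suc_sq, of "1 - \<gamma> 1"]]) (use R_bounds in auto)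
  have drift_V: "V n / S (\<theta> n \<omega>) \<le> drift (\<theta> n \<omega>)" for n
    unfolding V_def by (rule drift_ge[OF theta_in_Theta[OF \<omega>]])
  have drift0: "0 \<le> drift (\<theta> n \<omega>)" for n
    using drift_V[of n] V0[of n] S_pos[OF theta_in_Theta[OF \<omega>, of n]] by (meson divide_nonneg_pos order_trans)
  have b0: "0 \<le> b n" for n unfolding b_def using drift0 gamma_Suc[of n] by simp
  have V_sum: "V n = V 0 + (\<Sum>k<n. R k - W k - b k)" for n
    by (induction n) (auto simp: R_def)
  have RW: "summable (\<lambda>k. R k - W k)" by (rule summable_diff[OF R W])
  then obtain C where C: "\<And>n. \<bar>\<Sum>k<n. R k - W k\<bar> \<le> C"
    using LIMSEQ_bounded[OF summable_LIMSEQ] by blast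
  \<comment> \<open>\<open>V\<close> cannot become negative, so the accumulated decrease is at most
    \<open>V 0\<close> plus a bound on the convergent perturbation.\<close>
  have b: "summable b"
  proof (rule summableI_nonneg_bounded[OF b0])
    fix n
    have "(\<Sum>k<n. b k) = V 0 - V n + (\<Sum>k<n. R k - W k)"
      using V_sum[of n] by (simp add: sum_subtractf)
    then show "(\<Sum>k<n. b k) \<le> V 0 + C" using C[of n] V0[of n] by linarith
  qed
  have RWb: "summable (\<lambda>k. R k - W k - b k)" by (rule summable_diff[OF RW b])
  define L where "L = V 0 + (\<Sum>k. R k - W k - b k)"
  have "(\<lambda>n. V 0 + (\<Sum>k<n. R k - W k - b k)) \<longlonglongrightarrow> L"
    unfolding L_def by (intro tendsto_add tendsto_const summable_LIMSEQ[OF RWb])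
  moreover have "(\<lambda>n. V 0 + (\<Sum>k<n. R k - W k - b k)) = V"
    by (rule ext) (rule V_sum[symmetric])
  ultimately have VL: "V \<longlonglongrightarrow> L" by (simp only:)
  obtain K where "\<And>n. \<bar>V n\<bar> \<le> K"
    using LIMSEQ_bounded[OF VL] by blast
  then have K: "V n \<le> K" for n by (rule abs_le_D1)
  \<comment> \<open>\<open>V\<close> is bounded along the path, hence so is \<open>S\<close>; the
    drift then dominates a fixed multiple of \<open>V\<close>.\<close>
  define Q where "Q = exp ((K - (\<Sum>i=1..d. ts i * ln (ts i))) / tmin)"
  have SQ: "S (\<theta> n \<omega>) \<le> Q" for n
  proof -
    have "S (\<theta> n \<omega>) \<le> exp ((V n - (\<Sum>i=1..d. ts i * ln (ts i))) / tmin)"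
      unfolding V_def by (rule S_le_KL[OF theta_in_Theta[OF \<omega>]])
    also have "\<dots> \<le> Q" unfolding Q_def using K[of n] tmin_pos by (simp add: divide_right_mono)
    finally show ?thesis .
  qed
  have Q0: "0 < Q" by (simp add: Q_def)
  have gV: "summable (\<lambda>n. \<gamma> (Suc n) * V n)"
  proof (rule summable_comparison_test'[OF summable_mult[OF b, of Q]])
    fix n
    have "V n = Q * (V n / Q)" using Q0 by simp
    also have "\<dots> \<le> Q * (V n / S (\<theta> n \<omega>))"
      using V0[of n] SQ[of n] Q0 S_pos[OF theta_in_Theta[OF \<omega>, of n]] by (intro mult_left_mono divide_left_mono) auto
    also have "\<dots> \<le> Q * drift (\<theta> n \<omega>)" using drift_V[of n] Q0 by (intro mult_left_mono) auto
    finally have "\<gamma> (Suc n) * V n \<le> \<gamma> (Suc n) * (Q * drift (\<theta> n \<omega>))" using gamma_Suc[of n] by (intro mult_left_mono)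
    then show "norm (\<gamma> (Suc n) * V n) \<le> Q * b n" using gamma_Suc[of n] V0[of n] by (simp add: b_def mult_ac)
  qed
  \<comment> \<open>A positive limit would make \<open>\<gamma>\<close> itself summable by
    comparison with \<open>\<gamma> (Suc n) * V n\<close>.\<close>
  have "L = 0"
  proof (rule ccontr)
    assume "L \<noteq> 0"
    then have L: "0 < L" using LIMSEQ_le_const[OF VL, of 0] V0 by force
    then have "\<forall>\<^sub>F n in sequentially. L / 2 < V n" using order_tendstoD(1)[OF VL, of "L/2"] by simp
    then have "\<forall>\<^sub>F n in sequentially. norm (\<gamma> (Suc n)) \<le> 2 / L * (\<gamma> (Suc n) * V n)"
    proof eventually_elim
      case (elim n)
      have "\<gamma> (Suc n) * (L / 2) \<le> \<gamma> (Suc n) * V n" using elim gamma_Suc[of n] by (intro mult_left_mono) auto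
      then show ?case using L gamma_Suc[of n] by (simp add: field_simps)
    qed
    then have "summable (\<lambda>n. \<gamma> (Suc n))"
      by (rule summable_comparison_test_ev[OF _ summable_mult[OF gV]])
    then show False using g_div by (simp add: summable_Suc_iff)
  qed
  with VL have V_lim: "V \<longlonglongrightarrow> 0" by simp
  have sq_le: "(sqrt (ts i) - sqrt (\<theta> n \<omega> i))\<^sup>2 \<le> V n" for n
  proof -
    have "(sqrt (ts i) - sqrt (\<theta> n \<omega> i))\<^sup>2 \<le> (\<Sum>i=1..d. (sqrt (ts i) - sqrt (\<theta> n \<omega> i))\<^sup>2)"
      using i by (intro member_le_sum) auto
    then show ?thesis using KL_hellinger[OF theta_in_Theta[OF \<omega>], of n] unfolding V_def by linarith
  qed
  have "\<bar>sqrt (ts i) - sqrt (\<theta> n \<omega> i)\<bar> \<le> sqrt (V n)" for n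
    using sq_le[of n] by (intro real_le_rsqrt) simp
  then have "\<forall>\<^sub>F n in sequentially. norm (sqrt (ts i) - sqrt (\<theta> n \<omega> i)) \<le> sqrt (V n)" by simp
  moreover have "(\<lambda>n. sqrt (V n)) \<longlonglongrightarrow> 0" using tendsto_real_sqrt[OF V_lim] by simp
  ultimately have "(\<lambda>n. sqrt (ts i) - sqrt (\<theta> n \<omega> i)) \<longlonglongrightarrow> 0"
    by (rule Lim_null_comparison)
  then have "(\<lambda>n. sqrt (ts i) - (sqrt (ts i) - sqrt (\<theta> n \<omega> i))) \<longlonglongrightarrow> sqrt (ts i) - 0"
    by (intro tendsto_diff tendsto_const)
  then have "(\<lambda>n. (sqrt (\<theta> n \<omega> i))\<^sup>2) \<longlonglongrightarrow> (sqrt (ts i))\<^sup>2"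
    by (intro tendsto_power) simp
  then show ?thesis using ts_pos[OF i] Theta_pos[OF theta_in_Theta[OF \<omega>] i] by (simp add: less_imp_le)
qed

lemma theta_tendsto: "AE \<omega> in M. \<forall>i\<in>{1..d}. (\<lambda>n. \<theta> n \<omega> i) \<longlonglongrightarrow> ts i"
proof -
  have "AE \<omega> in M. summable (\<lambda>k. \<gamma> (Suc k) * (ts i - \<theta> k \<omega> i)
              * (indicator (Xs i) (X (Suc k) \<omega>) - piI (\<theta> k \<omega>) (indicator (Xs i))))" if i: "i \<in> {1..d}" for i
  proof (rule noise_summable[OF indicator_Xs_bdd[OF i], where a="\<lambda>k. \<gamma> (Suc k)"])
    show "(\<lambda>\<omega>. \<gamma> (Suc k) * (ts i - \<theta> k \<omega> i)) \<in> borel_measurable (Filt k)" for k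
      using theta_Filt[OF i] by (intro borel_measurable_times borel_measurable_diff) auto
    have ti: "\<bar>ts i - \<theta> k \<omega> i\<bar> \<le> 1" if "\<omega> \<in> space M" for k \<omega>
      using Theta_pos[OF theta_in_Theta[OF that] i, of k] Theta_less_one[OF theta_in_Theta[OF that] i, of k] ts_pos[OF i] ts_less_one[OF i]
      by linarith
    show "\<bar>\<gamma> (Suc k) * (ts i - \<theta> k \<omega> i)\<bar> \<le> \<gamma> (Suc k)" if "\<omega> \<in> space M" for k \<omega>
      using ti[OF that, of k] gamma_Suc[of k] by (simp add: abs_mult mult_left_le)
    show "summable (\<lambda>k. (\<gamma> (Suc k))\<^sup>2)" by (rule gamma_Suc_sq)
    \<comment> \<open>The weight varies because the step size decreases, which telescopes by
      monotonicity, and because the bias moves by at most \<open>\<gamma> (Suc k)\<close>, which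
      contributes a square.\<close>
    show "summable (\<lambda>k. \<bar>\<gamma> (Suc (Suc k)) * (ts i - \<theta> (Suc k) \<omega> i) - \<gamma> (Suc k) * (ts i - \<theta> k \<omega> i)\<bar>)"
      if \<omega>: "\<omega> \<in> space M" for \<omega>
    proof (rule summable_comparison_test')
      have "summable (\<lambda>k. \<gamma> (Suc k) - \<gamma> (Suc (Suc k)))"
        by (rule telescope_summable'[OF LIMSEQ_Suc[OF g_lim]])
      then show "summable (\<lambda>k. (\<gamma> (Suc k) - \<gamma> (Suc (Suc k))) + (\<gamma> (Suc k))\<^sup>2)"
        by (rule summable_add[OF _ gamma_Suc_sq])
      fix k
      have g: "0 \<le> \<gamma> (Suc k) - \<gamma> (Suc (Suc k))" using g_mono[of "Suc k" "Suc (Suc k)"] by simp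
      have dth: "\<bar>\<theta> (Suc k) \<omega> i - \<theta> k \<omega> i\<bar> \<le> \<gamma> (Suc k)"
      proof -
        have "\<bar>\<theta> k \<omega> i * rel_step k \<omega> i\<bar> \<le> 1 * 1"
          unfolding abs_mult using rel_step_bounds[OF theta_in_Theta[OF \<omega>] i, of k] Theta_pos[OF theta_in_Theta[OF \<omega>] i, of k]
            Theta_less_one[OF theta_in_Theta[OF \<omega>] i, of k] by (intro mult_mono) auto
        moreover have "\<theta> (Suc k) \<omega> i - \<theta> k \<omega> i = \<gamma> (Suc k) * (\<theta> k \<omega> i * rel_step k \<omega> i)"
          unfolding theta_Suc[OF \<omega>] by (simp add: algebra_simps)
        ultimately show ?thesis using gamma_Suc[of k] by (simp add: abs_mult[of "\<gamma> (Suc k)"] mult_left_le)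
      qed
      have "\<gamma> (Suc (Suc k)) * (ts i - \<theta> (Suc k) \<omega> i) - \<gamma> (Suc k) * (ts i - \<theta> k \<omega> i)
         = - ((\<gamma> (Suc k) - \<gamma> (Suc (Suc k))) * (ts i - \<theta> (Suc k) \<omega> i)) - \<gamma> (Suc k) * (\<theta> (Suc k) \<omega> i - \<theta> k \<omega> i)"
        by (simp add: algebra_simps)
      moreover have "\<bar>(\<gamma> (Suc k) - \<gamma> (Suc (Suc k))) * (ts i - \<theta> (Suc k) \<omega> i)\<bar> \<le> \<gamma> (Suc k) - \<gamma> (Suc (Suc k))"
        using ti[OF \<omega>, of "Suc k"] g by (simp add: abs_mult mult_left_le)
      moreover have "\<bar>\<gamma> (Suc k) * (\<theta> (Suc k) \<omega> i - \<theta> k \<omega> i)\<bar> \<le> (\<gamma> (Suc k))\<^sup>2"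
        unfolding abs_mult power2_eq_square using dth gamma_Suc[of k] by (intro mult_mono) auto
      ultimately show "norm \<bar>\<gamma> (Suc (Suc k)) * (ts i - \<theta> (Suc k) \<omega> i) - \<gamma> (Suc k) * (ts i - \<theta> k \<omega> i)\<bar>
          \<le> (\<gamma> (Suc k) - \<gamma> (Suc (Suc k))) + (\<gamma> (Suc k))\<^sup>2"
        unfolding real_norm_def by linarith
    qed
  qed
  then have "AE \<omega> in M. \<forall>i\<in>{1..d}. summable (\<lambda>k. \<gamma> (Suc k) * (ts i - \<theta> k \<omega> i)
              * (indicator (Xs i) (X (Suc k) \<omega>) - piI (\<theta> k \<omega>) (indicator (Xs i))))"
    by (intro AE_finite_allI) auto
  then show ?thesis
    by (rule AE_mp) (auto intro!: AE_I2 theta_tendsto_path)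
qed

end

subsection \<open>Ergodic averages and expectations\<close>

lemma (in prob_space) integrable_bounded:
  fixes f :: "'a \<Rightarrow> real"
  assumes "f \<in> borel_measurable M" "\<And>\<omega>. \<omega> \<in> space M \<Longrightarrow> \<bar>f \<omega>\<bar> \<le> C"
  shows "integrable M f"
  using assms by (intro integrable_const_bound[where B=C] AE_I2) auto

lemma (in prob_space) abs_integral_le:
  fixes f :: "'a \<Rightarrow> real"
  assumes "f \<in> borel_measurable M" "\<And>\<omega>. \<omega> \<in> space M \<Longrightarrow> \<bar>f \<omega>\<bar> \<le> C"
  shows "\<bar>\<integral>\<omega>. f \<omega> \<partial>M\<bar> \<le> C"
proof -
  have i: "integrable M f" by (rule integrable_bounded[OF assms])
  have "\<bar>\<integral>\<omega>. f \<omega> \<partial>M\<bar> \<le> (\<integral>\<omega>. \<bar>f \<omega>\<bar> \<partial>M)" by (rule integral_abs_bound)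
  also have "\<dots> \<le> C" using i assms(2) by (intro integral_le_const integrable_abs AE_I2) auto
  finally show ?thesis .
qed

context wl_process
begin

text \<open>Displays the stationary mean as a rational function of finitely many weights; continuity
  and measurability in the bias become elementary.\<close>

lemma piI_formula:
  assumes g: "g \<in> bdd_borel B"
  shows "piI t g = inverse (S t) * (\<Sum>i=1..d. (\<integral>x. p x * g x * indicator (Xs i) x \<partial>lam) / t i)"
proof -
  have "piT t x * g x = inverse (S t) * (\<Sum>i=1..d. (p x * g x * indicator (Xs i) x) / t i)" for x
    unfolding pi_theta_def S_def[symmetric] by (simp add: sum_distrib_left sum_distrib_right divide_inverse mult_ac)
  then have "piI t g = inverse (S t) * (\<integral>x. (\<Sum>i=1..d. (p x * g x * indicator (Xs i) x) / t i) \<partial>lam)"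
    unfolding piI_def by simp
  also have "(\<integral>x. (\<Sum>i=1..d. (p x * g x * indicator (Xs i) x) / t i) \<partial>lam)
      = (\<Sum>i=1..d. (\<integral>x. p x * g x * indicator (Xs i) x \<partial>lam) / t i)"
    using integrable_mult_bdd[OF integrable_mult_bdd[OF p_int g] indicator_Xs_bdd]
    by (subst Bochner_Integration.integral_sum) auto
  finally show ?thesis .
qed

lemma piI_tendsto:
  assumes g: "g \<in> bdd_borel B" and t: "\<And>i. i \<in> {1..d} \<Longrightarrow> (\<lambda>n. t n i) \<longlonglongrightarrow> ts i"
  shows "(\<lambda>n. piI (t n) g) \<longlonglongrightarrow> piI ts g"
proof -
  have "ts i \<noteq> 0" if "i \<in> {1..d}" for i using ts_pos[OF that] by simp
  then show ?thesis
    unfolding piI_formula[OF g] S_def using S_pos[OF ts_Theta]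
    by (intro tendsto_intros t) (auto simp: S_def)
qed

lemma piI_theta_meas:
  assumes g: "g \<in> bdd_borel B" shows "(\<lambda>\<omega>. piI (\<theta> n \<omega>) g) \<in> borel_measurable M"
  unfolding piI_formula[OF g] S_def
  by (intro borel_measurable_times borel_measurable_inverse borel_measurable_sum borel_measurable_divide
      borel_measurable_const theta_meas)

lemma strong_law:
  assumes g: "g \<in> bdd_borel B"
  shows "AE \<omega> in M. (\<lambda>n. (\<Sum>k=1..n. g (X k \<omega>)) / real n) \<longlonglongrightarrow> piI ts g"
proof -
  have "AE \<omega> in M. summable (\<lambda>k. 1 / real (Suc k) * (g (X (Suc k) \<omega>) - piI (\<theta> k \<omega>) g))"
  proof (rule noise_summable[OF g, where v="\<lambda>k _. 1 / real (Suc k)" and a="\<lambda>k. 1 / real (Suc k)"])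
    show "summable (\<lambda>k. (1 / real (Suc k))\<^sup>2)"
      using inverse_power_summable[of 2, where 'a=real] summable_Suc_iff[of "\<lambda>n. inverse (real n ^ 2)"]
      by (simp add: power_divide inverse_eq_divide)
    show "summable (\<lambda>k. \<bar>1 / real (Suc (Suc k)) - 1 / real (Suc k)\<bar>)"
    proof -
      have "(\<lambda>n. 1 / real (Suc n)) \<longlonglongrightarrow> 0" using LIMSEQ_inverse_real_of_nat by (simp add: inverse_eq_divide)
      from telescope_summable'[OF this]
      have "summable (\<lambda>k. 1 / real (Suc k) - 1 / real (Suc (Suc k)))" .
      moreover have "\<bar>1 / real (Suc (Suc k)) - 1 / real (Suc k)\<bar> = 1 / real (Suc k) - 1 / real (Suc (Suc k))" for k
      proof -
        have "1 / real (Suc (Suc k)) \<le> 1 / real (Suc k)" by (intro divide_left_mono) auto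
        then show ?thesis by linarith
      qed
      ultimately show ?thesis by (simp only:)
    qed
  qed auto
  with theta_tendsto show ?thesis
  proof eventually_elim
    case (elim \<omega>)
    \<comment> \<open>The state at \<open>Suc k\<close> was drawn with the bias of time
      \<open>k\<close>; hence the shifted index, undone at the end by reindexing.\<close>
    have "(\<lambda>n. (\<Sum>k<n. g (X (Suc k) \<omega>) - piI (\<theta> k \<omega>) g) / real n) \<longlonglongrightarrow> 0"
      by (rule kronecker_mean[OF elim(2)])
    moreover have "(\<lambda>n. (\<Sum>k<n. piI (\<theta> k \<omega>) g) / real n) \<longlonglongrightarrow> piI ts g"
      using elim(1) by (intro cesaro_mean piI_tendsto[OF g]) auto
    ultimately have "(\<lambda>n. (\<Sum>k<n. g (X (Suc k) \<omega>) - piI (\<theta> k \<omega>) g) / real n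
        + (\<Sum>k<n. piI (\<theta> k \<omega>) g) / real n) \<longlonglongrightarrow> 0 + piI ts g" by (rule tendsto_add)
    moreover have "(\<Sum>k<n. g (X (Suc k) \<omega>) - piI (\<theta> k \<omega>) g) / real n + (\<Sum>k<n. piI (\<theta> k \<omega>) g) / real n
        = (\<Sum>k=1..n. g (X k \<omega>)) / real n" for n
      using sum.atLeast1_atMost_eq[of "\<lambda>k. g (X k \<omega>)" n] by (simp add: sum_subtractf add_divide_distrib[symmetric])
    ultimately show ?case by (simp only: add_0)
  qed
qed

section \<open>Freezing the bias over finitely many steps\<close>

lemma iter_theta_X_meas:
  assumes g: "g \<in> bdd_borel B"
  shows "(\<lambda>\<omega>. iter 0 g j (\<theta> n \<omega>) (X n \<omega>)) \<in> borel_measurable M"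
proof -
  have "g \<in> borel_measurable borel" using g by (simp add: bdd_borel_def)
  from iter_joint_meas[of "\<theta> n" M g 0 j, OF theta_meas this]
  have "(\<lambda>(\<omega>, x). iter 0 g j (\<theta> n \<omega>) x) \<in> borel_measurable (M \<Otimes>\<^sub>M borel)" .
  from measurable_compose[OF _ this, of "\<lambda>\<omega>. (\<omega>, X n \<omega>)" M] show ?thesis by simp
qed

text \<open>Taking the mean over the next state under the old bias turns a \<open>j\<close>-step
  prediction into a \<open>Suc j\<close>-step one exactly. The only error is the exchange of the new
  bias for the old one in \<open>j\<close> kernels.\<close>

lemma freeze_step:
  assumes g: "g \<in> bdd_borel B"
  shows "\<bar>(\<integral>\<omega>. iter 0 g j (\<theta> (Suc n) \<omega>) (X (Suc n) \<omega>) \<partial>M) - (\<integral>\<omega>. iter 0 g (Suc j) (\<theta> n \<omega>) (X n \<omega>) \<partial>M)\<bar>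
     \<le> real j * (4 * (\<kappa> * \<gamma> (Suc n)) * B)"
proof -
  have g_meas: "g \<in> borel_measurable borel" using g by (simp add: bdd_borel_def)
  have le: "\<bar>iter 0 g j t x\<bar> \<le> B" if "t \<in> Theta d" for j t x
    using iter_0_bdd[OF that g, of j] by (simp add: bdd_borel_def)
  have m: "(\<lambda>(\<omega>, y). iter 0 g j (\<theta> n \<omega>) y) \<in> borel_measurable (Filt n \<Otimes>\<^sub>M borel)"
    by (rule iter_joint_meas[OF theta_Filt g_meas])
  note c = transition_real[of "\<lambda>\<omega>. iter 0 g j (\<theta> n \<omega>)", OF m le[OF theta_in_Theta]]
  have eq: "(\<integral>\<omega>. iter 0 g (Suc j) (\<theta> n \<omega>) (X n \<omega>) \<partial>M) = (\<integral>\<omega>. iter 0 g j (\<theta> n \<omega>) (X (Suc n) \<omega>) \<partial>M)"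
    using c(1) by simp
  have i: "integrable M (\<lambda>\<omega>. iter 0 g j (\<theta> (Suc n) \<omega>) (X (Suc n) \<omega>))"
      "integrable M (\<lambda>\<omega>. iter 0 g j (\<theta> n \<omega>) (X (Suc n) \<omega>))"
    using le[OF theta_in_Theta] by (intro integrable_bounded[of _ B] iter_theta_X_meas[OF g] c(2); blast)+
  have "(\<integral>\<omega>. iter 0 g j (\<theta> (Suc n) \<omega>) (X (Suc n) \<omega>) \<partial>M) - (\<integral>\<omega>. iter 0 g j (\<theta> n \<omega>) (X (Suc n) \<omega>) \<partial>M)
      = (\<integral>\<omega>. iter 0 g j (\<theta> (Suc n) \<omega>) (X (Suc n) \<omega>) - iter 0 g j (\<theta> n \<omega>) (X (Suc n) \<omega>) \<partial>M)"
    using i by simp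
  also have "\<bar>\<dots>\<bar> \<le> real j * (4 * (\<kappa> * \<gamma> (Suc n)) * B)"
  proof (rule abs_integral_le)
    show "(\<lambda>\<omega>. iter 0 g j (\<theta> (Suc n) \<omega>) (X (Suc n) \<omega>) - iter 0 g j (\<theta> n \<omega>) (X (Suc n) \<omega>)) \<in> borel_measurable M"
      by (intro borel_measurable_diff iter_theta_X_meas[OF g] c(2))
    fix \<omega> assume \<omega>: "\<omega> \<in> space M"
    have "0 \<le> \<kappa> * \<gamma> (Suc n)" using kappa_pos gamma_Suc[of n] by simp
    from iter_0_ratio_close[OF theta_in_Theta[OF \<omega>] theta_in_Theta[OF \<omega>] theta_ratio_close[OF \<omega>] this g, of j "X (Suc n) \<omega>"]
    show "\<bar>iter 0 g j (\<theta> (Suc n) \<omega>) (X (Suc n) \<omega>) - iter 0 g j (\<theta> n \<omega>) (X (Suc n) \<omega>)\<bar>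
        \<le> real j * (4 * (\<kappa> * \<gamma> (Suc n)) * B)" by (simp add: abs_minus_commute)
  qed
  finally show ?thesis unfolding eq .
qed

text \<open>Each of the \<open>m\<close> exchanges affects at most \<open>j + m\<close> kernels,
  hence the product. Monotone step sizes let \<open>\<gamma> (Suc n)\<close> serve for all of them;
  \<open>j\<close> varies in the induction because every step back lengthens the prediction.\<close>

lemma freeze_steps:
  assumes g: "g \<in> bdd_borel B"
  shows "\<bar>(\<integral>\<omega>. iter 0 g j (\<theta> (n + m) \<omega>) (X (n + m) \<omega>) \<partial>M) - (\<integral>\<omega>. iter 0 g (j + m) (\<theta> n \<omega>) (X n \<omega>) \<partial>M)\<bar>
     \<le> real (m * (j + m)) * (4 * (\<kappa> * \<gamma> (Suc n)) * B)"
proof (induction m arbitrary: j)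
  case 0
  then show ?case by simp
next
  case (Suc m)
  let ?c = "4 * (\<kappa> * \<gamma> (Suc n)) * B"
  have B0: "0 \<le> B" by (rule bdd_borel_nonneg[OF g])
  have "4 * (\<kappa> * \<gamma> (Suc (n + m))) * B \<le> ?c"
    using g_mono[of "Suc n" "Suc (n + m)"] kappa_pos B0 by (intro mult_right_mono mult_left_mono) auto
  then have "real j * (4 * (\<kappa> * \<gamma> (Suc (n + m))) * B) \<le> real j * ?c" by (intro mult_left_mono) auto
  moreover have "real j * ?c + real (m * (Suc j + m)) * ?c \<le> real (Suc m * (j + Suc m)) * ?c"
  proof -
    have "real j + real (m * (Suc j + m)) \<le> real (Suc m * (j + Suc m))"
      unfolding of_nat_add[symmetric] of_nat_le_iff by simp
    then have "(real j + real (m * (Suc j + m))) * ?c \<le> real (Suc m * (j + Suc m)) * ?c"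
      using kappa_pos B0 gamma_Suc[of n] by (intro mult_right_mono) auto
    then show ?thesis by (simp only: distrib_right)
  qed
  ultimately show ?case
    using freeze_step[OF g, of j "n + m"] Suc[of "Suc j"] unfolding add_Suc_right add_Suc by linarith
qed

lemma expectation_tendsto:
  assumes g: "g \<in> bdd_borel B"
  shows "(\<lambda>n. \<integral>\<omega>. g (X n \<omega>) \<partial>M) \<longlonglongrightarrow> piI ts g"
proof -
  have B0: "0 \<le> B" by (rule bdd_borel_nonneg[OF g])
  have pi_lim: "(\<lambda>n. \<integral>\<omega>. piI (\<theta> n \<omega>) g \<partial>M) \<longlonglongrightarrow> (\<integral>\<omega>. piI ts g \<partial>M)"
  proof (rule integral_dominated_convergence[where w="\<lambda>_. B"])
    show "AE \<omega> in M. (\<lambda>n. piI (\<theta> n \<omega>) g) \<longlonglongrightarrow> piI ts g"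
      using theta_tendsto by eventually_elim (auto intro: piI_tendsto[OF g])
    show "AE \<omega> in M. norm (piI (\<theta> n \<omega>) g) \<le> B" for n
      using piI_bound[OF theta_in_Theta g] by (intro AE_I2) auto
  qed (auto intro: piI_theta_meas[OF g])
  have erg: "\<bar>(\<integral>\<omega>. iter 0 g m (\<theta> n \<omega>) (X n \<omega>) \<partial>M) - (\<integral>\<omega>. piI (\<theta> n \<omega>) g \<partial>M)\<bar> \<le> (1 - \<rho>) ^ m * (2 * B)" for n m
  proof -
    have "integrable M (\<lambda>\<omega>. iter 0 g m (\<theta> n \<omega>) (X n \<omega>))"
      using iter_0_bdd[OF theta_in_Theta g] by (intro integrable_bounded[of _ B] iter_theta_X_meas[OF g]) (simp add: bdd_borel_def)
    moreover have "integrable M (\<lambda>\<omega>. piI (\<theta> n \<omega>) g)"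
      by (intro integrable_bounded[of _ B] piI_theta_meas[OF g] piI_bound[OF theta_in_Theta g])
    ultimately have "(\<integral>\<omega>. iter 0 g m (\<theta> n \<omega>) (X n \<omega>) \<partial>M) - (\<integral>\<omega>. piI (\<theta> n \<omega>) g \<partial>M)
        = (\<integral>\<omega>. iter 0 g m (\<theta> n \<omega>) (X n \<omega>) - piI (\<theta> n \<omega>) g \<partial>M)" by simp
    also have "\<bar>\<dots>\<bar> \<le> (1 - \<rho>) ^ m * (2 * B)"
      by (intro abs_integral_le borel_measurable_diff iter_theta_X_meas[OF g] piI_theta_meas[OF g] iter_0_ergodic[OF theta_in_Theta g])
    finally show ?thesis .
  qed
  show ?thesis
  proof (rule LIMSEQ_I)
    fix r :: real assume r: "0 < r"
    have "(\<lambda>m. (1 - \<rho>) ^ m * (2 * B)) \<longlonglongrightarrow> 0 * (2 * B)"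
      by (intro tendsto_mult tendsto_const LIMSEQ_power_zero one_minus_rho)
    then have "\<forall>\<^sub>F m in sequentially. (1 - \<rho>) ^ m * (2 * B) < r / 3"
      using r by (intro order_tendstoD(2)) auto
    \<comment> \<open>The order of choice matters: \<open>m\<close> is fixed by the geometric rate
      alone, and then the freezing error vanishes as \<open>n\<close> grows.\<close>
    then obtain m where m: "(1 - \<rho>) ^ m * (2 * B) < r / 3"
      unfolding eventually_sequentially by blast
    have "(\<lambda>n. real (m * (0 + m)) * (4 * (\<kappa> * \<gamma> (Suc n)) * B)) \<longlonglongrightarrow> real (m * (0 + m)) * (4 * (\<kappa> * 0) * B)"
      by (intro tendsto_mult tendsto_const LIMSEQ_Suc[OF g_lim])
    then have "\<forall>\<^sub>F n in sequentially. real (m * (0 + m)) * (4 * (\<kappa> * \<gamma> (Suc n)) * B) < r / 3"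
      using r by (intro order_tendstoD(2)) auto
    moreover have "\<forall>\<^sub>F n in sequentially. dist (\<integral>\<omega>. piI (\<theta> n \<omega>) g \<partial>M) (\<integral>\<omega>. piI ts g \<partial>M) < r / 3"
      using tendstoD[OF pi_lim, of "r/3"] r by simp
    ultimately have "\<forall>\<^sub>F n in sequentially. norm ((\<integral>\<omega>. g (X (n + m) \<omega>) \<partial>M) - piI ts g) < r"
    proof eventually_elim
      case (elim n)
      have "\<bar>(\<integral>\<omega>. g (X (n + m) \<omega>) \<partial>M) - (\<integral>\<omega>. iter 0 g m (\<theta> n \<omega>) (X n \<omega>) \<partial>M)\<bar> < r / 3"
        using freeze_steps[OF g, of 0 n m] elim(1) by simp
      moreover have "\<bar>(\<integral>\<omega>. iter 0 g m (\<theta> n \<omega>) (X n \<omega>) \<partial>M) - (\<integral>\<omega>. piI (\<theta> n \<omega>) g \<partial>M)\<bar> < r / 3"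
        using erg[of m n] m by linarith
      moreover have "\<bar>(\<integral>\<omega>. piI (\<theta> n \<omega>) g \<partial>M) - piI ts g\<bar> < r / 3"
        using elim(2) by (simp add: dist_real_def prob_space)
      ultimately show ?case unfolding real_norm_def by linarith
    qed
    then obtain N where N: "\<And>n. N \<le> n \<Longrightarrow> norm ((\<integral>\<omega>. g (X (n + m) \<omega>) \<partial>M) - piI ts g) < r"
      unfolding eventually_sequentially by blast
    have "norm ((\<integral>\<omega>. g (X n \<omega>) \<partial>M) - piI ts g) < r" if "N + m \<le> n" for n
      using N[of "n - m"] that by simp
    then show "\<exists>no. \<forall>n\<ge>no. norm ((\<integral>\<omega>. g (X n \<omega>) \<partial>M) - piI ts g) < r" by blast
  qed
qed

lemma mult_indicator_bdd: "f \<in> bdd_borel B \<Longrightarrow> i \<in> {1..d} \<Longrightarrow> (\<lambda>x. f x * indicator (Xs i) x) \<in> bdd_borel B"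
  using Xs_meas[of i] bdd_borel_nonneg[of f B] by (auto simp: bdd_borel_def abs_mult indicator_def)

text \<open>\<open>\<theta> n\<close> and \<open>X n\<close> are dependent, so the limit cannot be
  taken factor by factor. Dominated convergence first replaces the random weights by
  \<open>ts\<close>, leaving only expectations of functions of \<open>X n\<close>.\<close>

lemma weighted_expectation_tendsto:
  assumes f: "f \<in> bdd_borel B"
  shows "(\<lambda>n. real d * (\<integral>\<omega>. (\<Sum>i=1..d. \<theta> n \<omega> i * f (X n \<omega>) * indicator (Xs i) (X n \<omega>)) \<partial>M))
         \<longlonglongrightarrow> (\<integral>x. f x * p x \<partial>lam)"
proof -
  have B0: "0 \<le> B" by (rule bdd_borel_nonneg[OF f])
  define g where "g i x = f x * indicator (Xs i) x" for i x
  have g: "g i \<in> bdd_borel B" if "i \<in> {1..d}" for i unfolding g_def[abs_def] by (rule mult_indicator_bdd[OF f that])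
  have gX_meas: "(\<lambda>\<omega>. g i (X n \<omega>)) \<in> borel_measurable M" if "i \<in> {1..d}" for i n
    using g[OF that] by (intro measurable_compose[OF X_meas]) (simp add: bdd_borel_def)
  have g_le: "\<bar>g i x\<bar> \<le> B" if "i \<in> {1..d}" for i x using g[OF that] by (simp add: bdd_borel_def)
  have th_le: "\<bar>\<theta> n \<omega> i\<bar> \<le> 1" if "i \<in> {1..d}" "\<omega> \<in> space M" for i n \<omega>
    using Theta_pos[OF theta_in_Theta[OF that(2)] that(1), of n] Theta_less_one[OF theta_in_Theta[OF that(2)] that(1), of n] by linarith
  have int1: "integrable M (\<lambda>\<omega>. \<theta> n \<omega> i * g i (X n \<omega>))" if i: "i \<in> {1..d}" for i n
  proof (rule integrable_bounded)
    show "(\<lambda>\<omega>. \<theta> n \<omega> i * g i (X n \<omega>)) \<in> borel_measurable M"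
      by (intro borel_measurable_times theta_meas gX_meas i)
    show "\<bar>\<theta> n \<omega> i * g i (X n \<omega>)\<bar> \<le> 1 * B" if "\<omega> \<in> space M" for \<omega>
      unfolding abs_mult using th_le[OF i that, of n] g_le[OF i] by (intro mult_mono) auto
  qed
  have lim: "(\<lambda>n. \<integral>\<omega>. \<theta> n \<omega> i * g i (X n \<omega>) \<partial>M) \<longlonglongrightarrow> ts i * piI ts (g i)" if i: "i \<in> {1..d}" for i
  proof -
    have intg: "integrable M (\<lambda>\<omega>. ts i * g i (X n \<omega>))" for n
      by (rule integrable_mult_right[OF integrable_bounded[OF gX_meas[OF i] g_le[OF i]]])
    have "(\<lambda>n. \<integral>\<omega>. (\<theta> n \<omega> i - ts i) * g i (X n \<omega>) \<partial>M) \<longlonglongrightarrow> (\<integral>\<omega>. 0 \<partial>M)"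
    proof (rule integral_dominated_convergence[where w="\<lambda>_. 2 * B"])
      show "AE \<omega> in M. (\<lambda>n. (\<theta> n \<omega> i - ts i) * g i (X n \<omega>)) \<longlonglongrightarrow> 0"
        using theta_tendsto
      proof eventually_elim
        case (elim \<omega>)
        then have "(\<lambda>n. \<theta> n \<omega> i - ts i) \<longlonglongrightarrow> 0" using i by (simp add: LIM_zero_iff)
        then show ?case
        proof (rule tendsto_0_le)
          show "\<forall>\<^sub>F n in sequentially. norm ((\<theta> n \<omega> i - ts i) * g i (X n \<omega>)) \<le> norm (\<theta> n \<omega> i - ts i) * B"
            using g_le[OF i] by (intro always_eventually) (auto simp: abs_mult mult_left_mono)
        qed
      qed
      show "AE \<omega> in M. norm ((\<theta> n \<omega> i - ts i) * g i (X n \<omega>)) \<le> 2 * B" for n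
      proof (rule AE_I2)
        fix \<omega> assume "\<omega> \<in> space M"
        then have "\<bar>\<theta> n \<omega> i - ts i\<bar> \<le> 2" using th_le[OF i, of \<omega> n] ts_pos[OF i] ts_less_one[OF i] by linarith
        then show "norm ((\<theta> n \<omega> i - ts i) * g i (X n \<omega>)) \<le> 2 * B"
          unfolding real_norm_def abs_mult using g_le[OF i] by (intro mult_mono) auto
      qed
    qed (auto intro!: borel_measurable_times borel_measurable_diff theta_meas gX_meas i)
    moreover have "(\<lambda>n. \<integral>\<omega>. ts i * g i (X n \<omega>) \<partial>M) \<longlonglongrightarrow> ts i * piI ts (g i)"
      unfolding integral_mult_right_zero by (intro tendsto_mult tendsto_const expectation_tendsto[OF g[OF i]])
    moreover have "(\<integral>\<omega>. \<theta> n \<omega> i * g i (X n \<omega>) \<partial>M)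
        = (\<integral>\<omega>. (\<theta> n \<omega> i - ts i) * g i (X n \<omega>) \<partial>M) + (\<integral>\<omega>. ts i * g i (X n \<omega>) \<partial>M)" for n
      unfolding left_diff_distrib using int1[OF i, of n] intg[of n]
      by (subst Bochner_Integration.integral_diff) auto
    ultimately show ?thesis using tendsto_add by fastforce
  qed
  have "(\<lambda>n. real d * (\<Sum>i=1..d. \<integral>\<omega>. \<theta> n \<omega> i * g i (X n \<omega>) \<partial>M)) \<longlonglongrightarrow> real d * (\<Sum>i=1..d. ts i * piI ts (g i))"
    by (intro tendsto_mult tendsto_const tendsto_sum lim)
  moreover have "(\<integral>\<omega>. (\<Sum>i=1..d. \<theta> n \<omega> i * f (X n \<omega>) * indicator (Xs i) (X n \<omega>)) \<partial>M)
      = (\<Sum>i=1..d. \<integral>\<omega>. \<theta> n \<omega> i * g i (X n \<omega>) \<partial>M)" for n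
    unfolding mult.assoc g_def[symmetric] by (intro Bochner_Integration.integral_sum int1)
  moreover have "real d * (\<Sum>i=1..d. ts i * piI ts (g i)) = (\<integral>x. f x * p x \<partial>lam)"
    unfolding piI_ts[OF f, symmetric] g_def[abs_def] sum_distrib_left by (simp add: mult_ac)
  ultimately show ?thesis by (simp only:)
qed

text \<open>On a single path the weights and the stratum averages converge separately, and finitely
  many strata need only finitely many exceptional null sets.\<close>

lemma WL_estimator_tendsto:
  assumes f: "f \<in> bdd_borel B"
  shows "AE \<omega> in M. (\<lambda>n. WL_estimator d Xs X \<theta> f n \<omega>) \<longlonglongrightarrow> (\<integral>x. f x * p x \<partial>lam)"
proof -
  have "AE \<omega> in M. \<forall>i\<in>{1..d}. (\<lambda>n. (\<Sum>k=1..n. f (X k \<omega>) * indicator (Xs i) (X k \<omega>)) / real n)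
      \<longlonglongrightarrow> piI ts (\<lambda>x. f x * indicator (Xs i) x)"
    by (intro AE_finite_allI strong_law[OF mult_indicator_bdd[OF f]]) auto
  with theta_tendsto show ?thesis
  proof eventually_elim
    case (elim \<omega>)
    have "(\<lambda>n. real d * (\<Sum>i=1..d. \<theta> n \<omega> i * ((\<Sum>k=1..n. f (X k \<omega>) * indicator (Xs i) (X k \<omega>)) / real n)))
        \<longlonglongrightarrow> real d * (\<Sum>i=1..d. ts i * piI ts (\<lambda>x. f x * indicator (Xs i) x))"
      using elim by (intro tendsto_mult tendsto_const tendsto_sum) auto
    moreover have "real d * (\<Sum>i=1..d. ts i * piI ts (\<lambda>x. f x * indicator (Xs i) x)) = (\<integral>x. f x * p x \<partial>lam)"
      unfolding piI_ts[OF f, symmetric] sum_distrib_left by (simp add: mult_ac)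
    ultimately show ?case unfolding WL_estimator_def by simp
  qed
qed

end

theorem theorem4:
  fixes lam :: "'a::polish_space measure"
    and p :: "'a \<Rightarrow> real"
    and d :: nat
    and Xs :: "nat \<Rightarrow> 'a set"
    and q :: "'a \<Rightarrow> 'a \<Rightarrow> real"
    and \<gamma> :: "nat \<Rightarrow> real"
    and M :: "'w measure"
    and X :: "nat \<Rightarrow> 'w \<Rightarrow> 'a"
    and \<theta> :: "nat \<Rightarrow> 'w \<Rightarrow> nat \<Rightarrow> real"
  assumes lam_sets: "sets lam = sets borel"
    and lam_sf: "sigma_finite_measure lam"
    and p_meas: "p \<in> borel_measurable borel"
    and p_int: "integrable lam p"
    and p_prob: "(\<integral>x. p x \<partial>lam) = 1"
    and d_ge: "d \<ge> 2"
    and Xs_meas: "\<forall>i\<in>{1..d}. Xs i \<in> sets borel"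
    and Xs_disj: "disjoint_family_on Xs {1..d}"
    and Xs_cover: "(\<Union>i\<in>{1..d}. Xs i) = UNIV"
    \<comment> \<open>(A1)\<close>
    and A1_inf: "\<exists>c>0. \<forall>x. c \<le> p x"
    and A1_sup: "\<exists>C. \<forall>x. p x \<le> C"
    and A1_star: "\<forall>i\<in>{1..d}. theta_star lam p Xs i > 0"
    \<comment> \<open>(A2): symmetric proposal density q w.r.t. lam with positive infimum\<close>
    and q_meas: "(\<lambda>(x, y). q x y) \<in> borel_measurable borel"
    and q_nonneg: "\<forall>x y. 0 \<le> q x y"
    and q_int: "\<forall>x. integrable lam (q x)"
    and q_dens: "\<forall>x. (\<integral>y. q x y \<partial>lam) = 1"
    and q_sym: "\<forall>x y. q x y = q y x"
    and q_inf: "\<exists>c>0. \<forall>x y. c \<le> q x y"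
    \<comment> \<open>(A3)\<close>
    and g_range: "\<forall>n\<ge>1. 0 \<le> \<gamma> n \<and> \<gamma> n < 1"
    and g_mono: "\<forall>n m. 1 \<le> n \<longrightarrow> n \<le> m \<longrightarrow> \<gamma> m \<le> \<gamma> n"
    and g_lim: "\<gamma> \<longlonglongrightarrow> 0"
    and g_div: "\<not> summable \<gamma>"
    and g_sq: "summable (\<lambda>n. (\<gamma> n)\<^sup>2)"
    \<comment> \<open>the linearized Wang--Landau algorithm on the probability space M\<close>
    and M_prob: "prob_space M"
    and X_meas: "\<forall>n. X n \<in> borel_measurable M"
    and th0_meas: "\<forall>i\<in>{1..d}. (\<lambda>\<omega>. \<theta> 0 \<omega> i) \<in> borel_measurable M"
    and th0_Theta: "\<forall>\<omega>\<in>space M. \<theta> 0 \<omega> \<in> Theta d"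
    and X_cond: "\<forall>n. \<forall>A\<in>filt_sets M d X \<theta> n. \<forall>B\<in>sets borel.
        emeasure M (A \<inter> {\<omega>\<in>space M. X (Suc n) \<omega> \<in> B})
        = (\<integral>\<^sup>+\<omega>. indicator A \<omega> * ennreal (MH_kernel lam p d Xs q (\<theta> n \<omega>) (X n \<omega>) B) \<partial>M)"
    and th_upd: "\<forall>n. \<forall>\<omega>\<in>space M. \<theta> (Suc n) \<omega>
        = (\<lambda>i. \<theta> n \<omega> i + \<gamma> (Suc n) * WL_H d Xs (X (Suc n) \<omega>) (\<theta> n \<omega>) i)"
  shows "\<forall>f::'a \<Rightarrow> real. f \<in> borel_measurable borel \<longrightarrow> (\<exists>B. \<forall>x. \<bar>f x\<bar> \<le> B) \<longrightarrow>
      ((\<lambda>n. real d * prob_space.expectation M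
            (\<lambda>\<omega>. \<Sum>i=1..d. \<theta> n \<omega> i * f (X n \<omega>) * indicator (Xs i) (X n \<omega>)))
         \<longlonglongrightarrow> (\<integral>x. f x * p x \<partial>lam))
      \<and> (AE \<omega> in M. (\<lambda>n. WL_estimator d Xs X \<theta> f n \<omega>) \<longlonglongrightarrow> (\<integral>x. f x * p x \<partial>lam))"
proof -
  obtain pl where pl: "0 < pl" "\<And>x. pl \<le> p x" using A1_inf by blast
  obtain pu where pu: "\<And>x. p x \<le> pu" using A1_sup by blast
  obtain ql where ql: "0 < ql" "\<And>x y. ql \<le> q x y" using q_inf by blast
  interpret prob_space M by (rule M_prob)
  interpret wl_process lam p d Xs q pl pu ql M \<gamma> X \<theta>
  proof unfold_locales
    show "sets lam = sets borel" "p \<in> borel_measurable borel" "integrable lam p" "(\<integral>x. p x \<partial>lam) = 1" "2 \<le> d"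
      "disjoint_family_on Xs {1..d}" "(\<Union>i\<in>{1..d}. Xs i) = UNIV" "0 < pl" "0 < ql"
      "(\<lambda>(x, y). q x y) \<in> borel_measurable borel" "\<gamma> \<longlonglongrightarrow> 0" "\<not> summable \<gamma>" "summable (\<lambda>n. (\<gamma> n)\<^sup>2)"
      by fact+
    show "pl \<le> p x" "p x \<le> pu" "ql \<le> q x y" "q x y = q y x" "integrable lam (q x)" "(\<integral>y. q x y \<partial>lam) = 1" for x y
      using pl pu ql q_sym q_int q_dens by auto
    show "Xs i \<in> sets borel" "0 < theta_star lam p Xs i" "(\<lambda>\<omega>. \<theta> 0 \<omega> i) \<in> borel_measurable M" if "i \<in> {1..d}" for i
      using that Xs_meas A1_star th0_meas by auto
    show "0 \<le> \<gamma> n \<and> \<gamma> n < 1" if "1 \<le> n" for n using that g_range by blast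
    show "\<gamma> m \<le> \<gamma> n" if "1 \<le> n" "n \<le> m" for n m using that g_mono by blast
    show "X n \<in> borel_measurable M" for n using X_meas by blast
    show "\<theta> 0 \<omega> \<in> Theta d" if "\<omega> \<in> space M" for \<omega> using that th0_Theta by blast
    show "emeasure M (A \<inter> {\<omega>\<in>space M. X (Suc n) \<omega> \<in> B})
        = (\<integral>\<^sup>+\<omega>. indicator A \<omega> * ennreal (MH_kernel lam p d Xs q (\<theta> n \<omega>) (X n \<omega>) B) \<partial>M)"
      if "A \<in> filt_sets M d X \<theta> n" "B \<in> sets borel" for n A B using that X_cond by blast
    show "\<theta> (Suc n) \<omega> = (\<lambda>i. \<theta> n \<omega> i + \<gamma> (Suc n) * WL_H d Xs (X (Suc n) \<omega>) (\<theta> n \<omega>) i)"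
      if "\<omega> \<in> space M" for n \<omega> using that th_upd by blast
  qed
  show ?thesis
  proof (intro allI impI)
    fix f :: "'a \<Rightarrow> real"
    assume "f \<in> borel_measurable borel" "\<exists>B. \<forall>x. \<bar>f x\<bar> \<le> B"
    then obtain B where f: "f \<in> bdd_borel B" by (auto simp: bdd_borel_def)
    show "((\<lambda>n. real d * prob_space.expectation M
            (\<lambda>\<omega>. \<Sum>i=1..d. \<theta> n \<omega> i * f (X n \<omega>) * indicator (Xs i) (X n \<omega>)))
         \<longlonglongrightarrow> (\<integral>x. f x * p x \<partial>lam))
      \<and> (AE \<omega> in M. (\<lambda>n. WL_estimator d Xs X \<theta> f n \<omega>) \<longlonglongrightarrow> (\<integral>x. f x * p x \<partial>lam))"
      using weighted_expectation_tendsto[OF f] WL_estimator_tendsto[OF f] by blast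
  qed
qed

end
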